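(* Let $M$ be a Polish space, $l$ a not necessarily finite measure on $M$, and let $V:M\to(-\infty,\infty]$ and $G:M\times M\to(-\infty,\infty]$ be lower semicontinuous with $G$ symmetric and such that $(x,y)\mapsto G(x,y)+V(x)+V(y)$ is bounded from below. Define $$H_n(x_1,\dots,x_n)=\sum_{1\le i<j\le n}G(x_i,x_j)+n\sum_{i=1}^nV(x_i),\qquad W(\mu)=\frac12\int_{M\times M}\big(G(x,y)+V(x)+V(y)\big)\,d\mu(x)d\mu(y)$$ for $(x_1,\dots,x_n)\in M^n$, $\mu\in\mathcal P(M)$. Let $\{\beta_n\}_{n\in\mathbb N}$ be a sequence with $\beta_n\to\infty$ and let $d\gamma_n=e^{-\frac{\beta_n}nH_n}\,dl^{\otimes n}$. Suppose that: (1) there exists $\xi>0$ such that $\int_Me^{-\xi V}\,dl<\infty$; (2) $V$ is bounded from below; (3) there exists $\epsilon\in[0,1)$ such that $(x,y)\mapsto G(x,y)+\epsilon V(x)+\epsilon V(y)$ is bounded from below; (4) $G(x,y)+V(x)+V(y)$ tends to infinity when $x,y\to\infty$ at the same time; (5) for every $\mu\in\mathcal P(M)$ with $W(\mu)<\infty$ there exists a sequence $\{\mu_n\}_{n\in\mathbb N}$ of probability measures absolutely continuous with respect to $l$ such that $\mu_n\to\mu$ and $W(\mu_n)\to W(\mu)$. Then for every bounded continuous function $f:\mathcal P(M)\to\mathbb R$, $$\frac1{n\beta_n}\log\int_{M^n}e^{-n\beta_nf\circ i_n}\,d\gamma_n\ \xrightarrow[n\to\infty]{}\ -\inf_{\mu\in\mathcal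 P(M)}\{f(\mu)+W(\mu)\}.$$
   Context: $\mathcal P(M)$ is the space of Borel probability measures on $M$ with the weak topology; $i_n(x_1,\dots,x_n)=\frac1n\sum_{i=1}^n\delta_{x_i}$. "$h(x,y)$ tends to infinity when $x,y\to\infty$ at the same time" means: for every $C\in\mathbb R$ there is a compact set $K\subset M$ such that $h\ge C$ on $K^c\times K^c$. *)

theory Defs
  imports "HOL-Probability.Probability"
begin

text \<open>The conventions are \<open>e\<^sup>-\<^sup>\<infinity> = 0\<close>, \<open>e\<^sup>\<infinity> = \<infinity>\<close>, \<open>log 0 = -\<infinity>\<close> and \<open>log \<infinity> = \<infinity>\<close>.\<close>

fun exp_ereal :: "ereal \<Rightarrow> ennreal" where
  "exp_ereal (ereal r) = ennreal (exp r)"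
| "exp_ereal PInfty = \<infinity>"
| "exp_ereal MInfty = 0"

definition ln_ennreal :: "ennreal \<Rightarrow> ereal" where
  "ln_ennreal z = (if z = 0 then -\<infinity> else if z = \<infinity> then \<infinity> else ereal (ln (enn2real z)))"

text \<open>Positive part minus negative part: \<^const>\<open>e2ennreal\<close> sends negative arguments to \<open>0\<close>.  It is
  only used for functions bounded below and finite measures, so that \<open>\<infinity> - \<infinity>\<close> does not occur.\<close>

definition ereal_integral :: "'a measure \<Rightarrow> ('a \<Rightarrow> ereal) \<Rightarrow> ereal" where
  "ereal_integral \<mu> g =
     enn2ereal (\<integral>\<^sup>+ x. e2ennreal (g x) \<partial>\<mu>) - enn2ereal (\<integral>\<^sup>+ x. e2ennreal (- g x) \<partial>\<mu>)"

definition lower_semicontinuous :: "('a::topological_space \<Rightarrow> ereal) \<Rightarrow> bool" where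
  "lower_semicontinuous g \<longleftrightarrow> (\<forall>c. open {x. c < g x})"

definition bounded_from_below :: "('a \<Rightarrow> ereal) \<Rightarrow> bool" where
  "bounded_from_below g \<longleftrightarrow> (\<exists>c::real. \<forall>x. ereal c \<le> g x)"

definition prob_measures :: "'a::topological_space measure set" where
  "prob_measures = {\<mu>. sets \<mu> = sets borel \<and> prob_space \<mu>}"

text \<open>The coarsest topology on \<^const>\<open>prob_measures\<close> for which \<open>\<mu> \<mapsto> \<integral>g d\<mu>\<close> is continuous for every
  bounded continuous \<open>g\<close>.\<close>

definition weak_topology :: "'a::topological_space measure topology" where
  "weak_topology = topology_generated_by
     {{\<mu> \<in> prob_measures. (\<integral>x. g x \<partial>\<mu>) \<in> U} | (g :: 'a \<Rightarrow> real) U.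
        continuous_on UNIV g \<and> bounded (range g) \<and> open U}"

lemma topspace_weak_topology: "topspace weak_topology = prob_measures"
proof -
  have "prob_measures \<in> {{\<mu> \<in> prob_measures. (\<integral>x. g x \<partial>\<mu>) \<in> U} | (g :: 'a \<Rightarrow> real) U.
        continuous_on UNIV g \<and> bounded (range g) \<and> open U}"
    by (rule CollectI, rule exI[of _ "\<lambda>_. 0"], rule exI[of _ UNIV]) auto
  then show ?thesis
    unfolding weak_topology_def topology_generated_by_topspace by blast
qed

text \<open>The map \<open>i\<^sub>n\<close>; a point of \<open>M\<^sup>n\<close> is a function on \<open>{1..n}\<close>.\<close>

definition empirical_measure :: "nat \<Rightarrow> (nat \<Rightarrow> 'a::topological_space) \<Rightarrow> 'a measure" where
  "empirical_measure n x =
     measure_of UNIV (sets borel) (\<lambda>A. (\<Sum>i=1..n. emeasure (return borel (x i)) A) / of_nat n)"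

lemma sets_empirical_measure [simp]: "sets (empirical_measure n x) = sets borel"
  unfolding empirical_measure_def
  by (simp add: sets.sigma_sets_eq[of borel, simplified])

lemma emeasure_empirical_measure:
  assumes "A \<in> sets borel"
  shows "emeasure (empirical_measure n x) A =
    (\<Sum>i=1..n. emeasure (return borel (x i)) A) / of_nat n"
proof (rule emeasure_measure_of[OF empirical_measure_def])
  show "sets borel \<subseteq> Pow (UNIV :: 'a set)" by simp
  show "A \<in> sets (empirical_measure n x)" using assms by simp
  show "positive (sets (empirical_measure n x))
     (\<lambda>A. (\<Sum>i=1..n. emeasure (return borel (x i)) A) / of_nat n)"
    by (simp add: positive_def)
  show "countably_additive (sets (empirical_measure n x))
     (\<lambda>A. (\<Sum>i=1..n. emeasure (return borel (x i)) A) / of_nat n)"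
  proof (rule countably_additiveI)
    fix F :: "nat \<Rightarrow> 'a set"
    assume F: "range F \<subseteq> sets (empirical_measure n x)" "disjoint_family F"
    have "(\<Sum>k. (\<Sum>i=1..n. emeasure (return borel (x i)) (F k)) / of_nat n) =
      (\<Sum>i=1..n. (\<Sum>k. emeasure (return borel (x i)) (F k))) / of_nat n"
      by (simp add: divide_ennreal_def suminf_sum)
    also have "\<dots> = (\<Sum>i=1..n. emeasure (return borel (x i)) (\<Union> (range F))) / of_nat n"
      using F by (intro arg_cong2[where f="(/)"] sum.cong suminf_emeasure refl) auto
    finally show "(\<Sum>k. (\<Sum>i=1..n. emeasure (return borel (x i)) (F k)) / of_nat n) =
      (\<Sum>i=1..n. emeasure (return borel (x i)) (\<Union> (range F))) / of_nat n" .
  qed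
qed

lemma empirical_measure_in_prob_measures:
  assumes "n \<ge> 1"
  shows "empirical_measure n x \<in> prob_measures"
proof -
  have "space (empirical_measure n x) = UNIV"
    using sets_eq_imp_space_eq[OF sets_empirical_measure[of n x]] by simp
  moreover have "emeasure (empirical_measure n x) UNIV = 1"
    using assms by (simp add: emeasure_empirical_measure ennreal_divide_self
      of_nat_less_top)
  ultimately show ?thesis
    by (auto simp: prob_measures_def intro!: prob_spaceI)
qed

definition pair_energy :: "('a \<times> 'a \<Rightarrow> ereal) \<Rightarrow> ('a \<Rightarrow> ereal) \<Rightarrow> 'a \<times> 'a \<Rightarrow> ereal" where
  "pair_energy G V = (\<lambda>(x, y). G (x, y) + V x + V y)"

definition hamiltonian ::
  "('a \<times> 'a \<Rightarrow> ereal) \<Rightarrow> ('a \<Rightarrow> ereal) \<Rightarrow> nat \<Rightarrow> (nat \<Rightarrow> 'a) \<Rightarrow> ereal" where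
  "hamiltonian G V n x =
     (\<Sum>j=1..n. \<Sum>i=1..<j. G (x i, x j)) + ereal (real n) * (\<Sum>i=1..n. V (x i))"

definition macroscopic_energy ::
  "('a \<times> 'a \<Rightarrow> ereal) \<Rightarrow> ('a \<Rightarrow> ereal) \<Rightarrow> 'a measure \<Rightarrow> ereal" where
  "macroscopic_energy G V \<mu> = ereal (1/2) * ereal_integral (\<mu> \<Otimes>\<^sub>M \<mu>) (pair_energy G V)"

text \<open>No \<open>\<sigma>\<close>-finiteness of \<open>l\<close> is required.  For finitely many factors \<^const>\<open>PiM\<close> is always a measure
  with the product values on measurable boxes.  If \<open>\<integral>exp (-\<xi>V) dl < \<infinity>\<close>, then \<open>l\<close> is \<open>\<sigma>\<close>-finite on
  \<open>{V < \<infinity>}\<close>, hence such a measure is unique on \<open>{V < \<infinity>}\<^sup>n\<close>, and the density below vanishes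
  elsewhere when \<open>n \<ge> 1\<close> and \<open>b > 0\<close>.\<close>

definition gibbs_measure ::
  "'a measure \<Rightarrow> ('a \<times> 'a \<Rightarrow> ereal) \<Rightarrow> ('a \<Rightarrow> ereal) \<Rightarrow> real \<Rightarrow> nat \<Rightarrow> (nat \<Rightarrow> 'a) measure" where
  "gibbs_measure l G V b n =
     density (\<Pi>\<^sub>M i\<in>{1..n}. l) (\<lambda>x. exp_ereal (- ereal (b / real n) * hamiltonian G V n x))"

end

theory Submission
  imports Defs "HOL-Complex_Analysis.Great_Picard" "HOL-Library.List_Lexorder"
begin

text \<open>Since \<open>\<beta>\<^sub>n \<rightarrow> \<infinity>\<close>, entropy is negligible on the scale \<open>n \<beta>\<^sub>n\<close>.

  For the upper bound, the factor \<open>\<Prod> e\<^bsup>-\<xi> V(x\<^sub>i)\<^esup>\<close>, of mass \<open>Z\<^sup>n\<close>, is split off the Gibbs density, and the rest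
  is bounded by its supremum.  By condition (3), this changes the energy only by a factor \<open>1 - \<theta>\<^sub>n\<close> with
  \<open>\<theta>\<^sub>n \<rightarrow> 0\<close> and by an additive error tending to \<open>0\<close>.  What remains is deterministic: along
  configurations of bounded energy, condition (4) makes the empirical measures tight, so a subsequence
  converges weakly, and the energy is lower semicontinuous along it.

  For the lower bound, let \<open>\<mu>\<close> have a bounded density with respect to \<open>l\<close>.  Replacing \<open>l\<close> by \<open>\<mu>\<close> costs a
  factor \<open>C\<^sup>-\<^sup>n\<close>, Jensen's inequality bounds the integral below by the exponential of the mean of
  the exponent, and the law of large numbers identifies the limit of the mean.  Truncating the density extends this to every \<open>\<mu>\<close>
  absolutely continuous with respect to \<open>l\<close> with finite energy, and condition (5) to all \<open>\<mu>\<close>.\<close>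

section \<open>Finite products of arbitrary measures\<close>

text \<open>Three infinities shape the proof. \<open>l\<close> need not be sigma-finite: products
  over \<open>l\<close> are computed from the values of \<open>PiM\<close> on boxes, and
  Radon-Nikodym is applied relative to the finite measure with density \<open>exp(-\<xi> V)\<close>.
  \<open>G\<close> and \<open>V\<close> may be \<open>\<infinity>\<close>: integrals are taken of
  the nonnegative functions \<open>Q = G + V + V + B\<close> and \<open>v = V + b\<close>, and
  Jensen's inequality takes the form of a tangent-line bound that survives an infinite exponent.
  \<open>G\<close> may be \<open>\<infinity>\<close> on the diagonal, which a product of empirical
  measures charges: the energy of a configuration is an off-diagonal mean of \<open>Q\<close>, and
  the diagonal returns only after truncation at a level \<open>m\<close>, at cost
  \<open>m / n\<close>. Both bounds rest on
  \<open>H_n = (sum over i < j of G + V + V) + (sum of V)\<close>. The pairs absorb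
  \<open>n - 1\<close> of the \<open>n\<close> copies of the sum of \<open>V\<close>; the remaining
  one contributes only order \<open>n\<close>. Splitting off the exponent \<open>\<xi>\<close> times
  the sum of \<open>V\<close> removes \<open>\<delta> n\<close> times that sum from
  \<open>H_n\<close>, with \<open>\<delta> = \<xi> / \<beta>\<close>. As the pair sum controls
  \<open>(1 - \<epsilon>) (n - 1)\<close> times the sum up to order \<open>n^2\<close>, and
  \<open>n / (n - 1) \<le> 2\<close>, this yields
  \<open>\<theta> = 2 \<delta> / (1 - \<epsilon>)\<close>.\<close>

lemma suminf_prod_emeasure_box:
  fixes c :: ennreal and d :: "nat \<Rightarrow> ennreal"
  assumes "finite I"
    and A: "\<And>i. i \<in> I \<Longrightarrow> A i \<in> sets (M i)"
    and X: "\<And>k i. i \<in> I \<Longrightarrow> X k i \<in> sets (M i)"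
    and eq: "\<And>x. x \<in> (\<Pi>\<^sub>E i\<in>I. space (M i)) \<Longrightarrow>
      c * (\<Prod>i\<in>I. indicator (A i) (x i)) = (\<Sum>k. d k * (\<Prod>i\<in>I. indicator (X k i) (x i)))"
  shows "c * (\<Prod>i\<in>I. emeasure (M i) (A i)) = (\<Sum>k. d k * (\<Prod>i\<in>I. emeasure (M i) (X k i)))"
  using assms
proof (induction I arbitrary: c d rule: finite_induct)
  case empty
  then show ?case by simp
next
  case (insert j I)
  note [measurable] = insert.prems(1,2)[OF insertI1]
  \<comment> \<open>With coordinate \<open>j\<close> frozen at \<open>y\<close>, its indicators join
    the coefficients \<open>c\<close> and \<open>d\<close>; the statement carries general
    coefficients for this reason. Integrating over \<open>y\<close> then puts the measures
    back.\<close>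
  have "c * indicator (A j) y * (\<Prod>i\<in>I. emeasure (M i) (A i)) =
      (\<Sum>k. d k * indicator (X k j) y * (\<Prod>i\<in>I. emeasure (M i) (X k i)))" if y: "y \<in> space (M j)" for y
  proof (rule insert.IH)
    fix x assume x: "x \<in> (\<Pi>\<^sub>E i\<in>I. space (M i))"
    have upd: "(\<Prod>i\<in>I. indicator (B i) ((x(j := y)) i)) = (\<Prod>i\<in>I. indicator (B i) (x i) :: ennreal)" for B
      using insert.hyps by (intro prod.cong) auto
    have "x(j := y) \<in> (\<Pi>\<^sub>E i\<in>insert j I. space (M i))"
      using x y insert.hyps by (auto simp: PiE_iff extensional_def)
    from insert.prems(3)[OF this]
    show "c * indicator (A j) y * (\<Prod>i\<in>I. indicator (A i) (x i)) =
        (\<Sum>k. d k * indicator (X k j) y * (\<Prod>i\<in>I. indicator (X k i) (x i)))"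
      by (simp only: prod.insert[OF insert.hyps] upd fun_upd_same mult.assoc)
  qed (use insert.prems in auto)
  then have "(\<integral>\<^sup>+y. c * (\<Prod>i\<in>I. emeasure (M i) (A i)) * indicator (A j) y \<partial>M j) =
      (\<integral>\<^sup>+y. (\<Sum>k. d k * (\<Prod>i\<in>I. emeasure (M i) (X k i)) * indicator (X k j) y) \<partial>M j)"
    by (intro nn_integral_cong) (simp add: mult_ac)
  also have "\<dots> = (\<Sum>k. \<integral>\<^sup>+y. d k * (\<Prod>i\<in>I. emeasure (M i) (X k i)) * indicator (X k j) y \<partial>M j)"
    by (intro nn_integral_suminf) measurable
  finally have "c * (\<Prod>i\<in>I. emeasure (M i) (A i)) * emeasure (M j) (A j) =
      (\<Sum>k. d k * (\<Prod>i\<in>I. emeasure (M i) (X k i)) * emeasure (M j) (X k j))"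
    by (simp add: nn_integral_cmult_indicator)
  then show ?case
    using insert.hyps by (simp add: mult_ac)
qed

lemma prod_indicator_PiE:
  assumes "finite I" "x \<in> extensional I"
  shows "(\<Prod>i\<in>I. indicator (B i) (x i)) = (indicator (PiE I B) x :: ennreal)"
proof (cases "x \<in> PiE I B")
  case True
  then show ?thesis by (simp add: PiE_iff)
next
  case False
  then obtain i where "i \<in> I" "x i \<notin> B i" using assms by (auto simp: PiE_iff)
  then have "(\<Prod>i\<in>I. indicator (B i) (x i)) = (0::ennreal)"
    using assms by (intro prod_zero) (auto intro!: bexI[of _ i])
  then show ?thesis using False by simp
qed

text \<open>Caratheodory's extension starts from a semiring of sets. For \<open>I = {}\<close> the
  only box is a one-point set, so the empty set is not a box and this case is excluded.\<close>

lemma semiring_of_sets_boxes: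
  assumes "finite I" "I \<noteq> {}"
  shows "semiring_of_sets (\<Pi>\<^sub>E i\<in>I. space (M i)) (PiE I ` (\<Pi> i\<in>I. sets (M i)))"
proof
  show "PiE I ` (\<Pi> i\<in>I. sets (M i)) \<subseteq> Pow (\<Pi>\<^sub>E i\<in>I. space (M i))"
    by (intro image_subsetI PowI PiE_mono) (auto simp: Pi_iff sets.sets_into_space)
  show "{} \<in> PiE I ` (\<Pi> i\<in>I. sets (M i))"
    using assms by (intro image_eqI[of _ _ "\<lambda>_. {}"]) (auto simp: PiE_eq_empty_iff)
next
  fix a b assume "a \<in> PiE I ` (\<Pi> i\<in>I. sets (M i))" "b \<in> PiE I ` (\<Pi> i\<in>I. sets (M i))"
  then obtain A B where a: "a = PiE I A" "A \<in> (\<Pi> i\<in>I. sets (M i))"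
    and b: "b = PiE I B" "B \<in> (\<Pi> i\<in>I. sets (M i))"
    by auto
  show "a \<inter> b \<in> PiE I ` (\<Pi> i\<in>I. sets (M i))"
    using a b by (intro image_eqI[of _ _ "\<lambda>i. A i \<inter> B i"]) (auto simp: PiE_Int)
  \<comment> \<open>The points of \<open>a\<close> are classified by the set \<open>J\<close> of
    coordinates at which they leave \<open>B\<close>. Distinct \<open>J\<close> give disjoint boxes,
    and \<open>J = {}\<close> gives \<open>a \<inter> b\<close>, so the nonempty \<open>J\<close>
    make up \<open>a - b\<close>.\<close>
  define E where "E J i = (if i \<in> J then A i - B i else A i \<inter> B i)" for J i
  define \<C> where "\<C> = (\<lambda>J. PiE I (E J)) ` (Pow I - {{}})"
  have "E J \<in> (\<Pi> i\<in>I. sets (M i))" for J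
  proof (rule Pi_I)
    fix i assume "i \<in> I"
    then have "A i \<in> sets (M i)" "B i \<in> sets (M i)" using a(2) b(2) by auto
    then show "E J i \<in> sets (M i)" by (auto simp: E_def)
  qed
  then have sub: "\<C> \<subseteq> PiE I ` (\<Pi> i\<in>I. sets (M i))"
    unfolding \<C>_def by (intro image_subsetI imageI)
  have E_D: "J = {i\<in>I. x i \<notin> B i}" if "J \<subseteq> I" "x \<in> PiE I (E J)" for J x
  proof -
    have "x i \<in> (if i \<in> J then A i - B i else A i \<inter> B i)" if "i \<in> I" for i
      using \<open>x \<in> PiE I (E J)\<close> that unfolding E_def by (rule PiE_mem)
    then have "i \<in> J \<longleftrightarrow> x i \<notin> B i" if "i \<in> I" for i
      using that by (metis Diff_iff IntD2)
    then show ?thesis using \<open>J \<subseteq> I\<close> by auto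
  qed
  have "finite \<C>"
    using assms by (simp add: \<C>_def)
  moreover have "disjoint \<C>"
  proof (rule disjointI)
    fix c c' assume c: "c \<in> \<C>" "c' \<in> \<C>" "c \<noteq> c'"
    obtain J where J: "J \<subseteq> I" "c = PiE I (E J)"
      using c(1) unfolding \<C>_def by auto
    obtain J' where J': "J' \<subseteq> I" "c' = PiE I (E J')"
      using c(2) unfolding \<C>_def by auto
    have "c = c'" if x: "x \<in> c" "x \<in> c'" for x
      using trans[OF E_D[OF J(1) x(1)[unfolded J(2)]] E_D[OF J'(1) x(2)[unfolded J'(2)], symmetric]]
      by (simp only: J J')
    then show "c \<inter> c' = {}" using c(3) by blast
  qed
  moreover have "a - b = \<Union>\<C>"
  proof (intro set_eqI iffI)
    fix x assume x: "x \<in> a - b"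
    let ?J = "{i\<in>I. x i \<notin> B i}"
    have "x i \<in> E ?J i" if "i \<in> I" for i
      using x that by (auto simp: a(1) E_def)
    then have xE: "x \<in> PiE I (E ?J)"
      using x by (simp add: a(1) PiE_iff)
    have "?J \<in> Pow I - {{}}"
      using x by (auto simp: a(1) b(1) PiE_iff)
    then show "x \<in> \<Union>\<C>"
      unfolding \<C>_def by (rule UN_I) (rule xE)
  next
    fix x assume "x \<in> \<Union>\<C>"
    then obtain J where J: "J \<subseteq> I" "J \<noteq> {}" "x \<in> PiE I (E J)" unfolding \<C>_def by auto
    then obtain j where j: "j \<in> J" by auto
    have "E J i \<subseteq> A i" for i by (simp add: E_def)
    then have "x \<in> a" using J(3) PiE_mono[of I "E J" A] by (auto simp: a(1))
    moreover have "j \<in> I" "x j \<notin> B j" using j J(1) E_D[OF J(1,3)] by blast+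
    ultimately show "x \<in> a - b" by (auto simp: b(1))
  qed
  ultimately show "\<exists>C\<subseteq>PiE I ` (\<Pi> i\<in>I. sets (M i)). finite C \<and> disjoint C \<and> a - b = \<Union> C"
    using sub by (intro exI[of _ \<C>] conjI)
qed

text \<open>The library has the next two facts for \<open>\<sigma>\<close>-finite factors only.\<close>

lemma emeasure_PiM_finite_index:
  assumes I: "finite I" and A: "\<And>i. i \<in> I \<Longrightarrow> A i \<in> sets (M i)"
  shows "emeasure (PiM I M) (PiE I A) = (\<Prod>i\<in>I. emeasure (M i) (A i))"
proof (cases "I = {}")
  case True
  then show ?thesis by simp
next
  case False
  let ?\<Omega> = "\<Pi>\<^sub>E i\<in>I. space (M i)"
  \<comment> \<open>\<open>PiM\<close> is itself an \<open>extend_measure\<close>, which has the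
    prescribed values as soon as some measure has them. \<open>N\<close>, built from the boxes, is
    the witness.\<close>
  define N where "N = extend_measure ?\<Omega> (\<Pi> i\<in>I. sets (M i)) (PiE I)
    (\<lambda>X. \<Prod>i\<in>I. emeasure (M i) (X i))"
  have box_sum: "(\<Sum>k. \<Prod>i\<in>I. emeasure (M i) (X k i)) = (\<Prod>i\<in>I. emeasure (M i) (B i))"
    if B: "B \<in> (\<Pi> i\<in>I. sets (M i))" and X: "\<And>k. X k \<in> (\<Pi> i\<in>I. sets (M i))"
      and disj: "disjoint_family (\<lambda>k. PiE I (X k))" and un: "(\<Union>k. PiE I (X k)) = PiE I B"
    for B and X :: "nat \<Rightarrow> _"
  proof -
    have "1 * (\<Prod>i\<in>I. emeasure (M i) (B i)) = (\<Sum>k. 1 * (\<Prod>i\<in>I. emeasure (M i) (X k i)))"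
    proof (rule suminf_prod_emeasure_box[OF I])
      fix x assume "x \<in> ?\<Omega>"
      then have x: "x \<in> extensional I" by (simp add: PiE_iff)
      show "1 * (\<Prod>i\<in>I. indicator (B i) (x i)) = (\<Sum>k. 1 * (\<Prod>i\<in>I. indicator (X k i) (x i)) :: ennreal)"
        using suminf_indicator[OF disj, of x] unfolding prod_indicator_PiE[OF I x] un by simp
    qed (use B X in \<open>auto simp: Pi_iff\<close>)
    then show ?thesis by simp
  qed
  have N: "emeasure N (PiE I B) = (\<Prod>i\<in>I. emeasure (M i) (B i))" if B: "B \<in> (\<Pi> i\<in>I. sets (M i))" for B
  proof (rule extend_measure_caratheodory[OF N_def])
    show "semiring_of_sets ?\<Omega> (PiE I ` (\<Pi> i\<in>I. sets (M i)))"
      by (rule semiring_of_sets_boxes[OF I False])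
    show zero: "(\<Prod>i\<in>I. emeasure (M i) (C i)) = 0" if e: "PiE I C = {}" for C
    proof -
      obtain i where "i \<in> I" "C i = {}" using e by (auto simp: PiE_eq_empty_iff)
      then show ?thesis by (intro prod_zero[OF I] bexI[of _ i]) simp_all
    qed
    show "(\<Prod>i\<in>I. emeasure (M i) (C i)) = (\<Prod>i\<in>I. emeasure (M i) (D i))"
      if "PiE I C = PiE I D" for C D
    proof (cases "PiE I C = {}")
      case True
      then show ?thesis using zero[of C] zero[of D] that by metis
    next
      case False
      then have "\<forall>i\<in>I. C i = D i" using that by (auto simp: PiE_eq_iff PiE_eq_empty_iff)
      then show ?thesis by simp
    qed
    show "(\<Sum>k. \<Prod>i\<in>I. emeasure (M i) (X k i)) = (\<Prod>i\<in>I. emeasure (M i) (C i))"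
      if "X \<in> UNIV \<rightarrow> (\<Pi> i\<in>I. sets (M i))" "C \<in> (\<Pi> i\<in>I. sets (M i))"
        "disjoint_family (PiE I \<circ> X)" "(\<Union>k. PiE I (X k)) = PiE I C" for X :: "nat \<Rightarrow> _" and C
      using that by (intro box_sum) (auto simp: o_def)
  qed (use B in auto)
  have sub: "PiE I ` (\<Pi> i\<in>I. sets (M i)) \<subseteq> Pow ?\<Omega>"
    using semiring_of_sets_boxes[OF I False, of M]
    by (simp add: semiring_of_sets_def subset_class_def)
  have "prod_algebra I M = PiE I ` (\<Pi> i\<in>I. sets (M i))"
    unfolding prod_algebra_eq_finite[OF I] by auto
  then have sets_N: "sets N = sets (PiM I M)"
    unfolding N_def sets_PiM by (simp add: sets_extend_measure[OF sub])
  \<comment> \<open>The index set on the right is the one in the definition of \<open>PiM\<close>,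
    which multiplies in the total mass of every factor outside the cylinder whose mass is not
    \<open>1\<close>.\<close>
  have "emeasure (PiM I M) (prod_emb I M I (PiE I A)) =
    (\<Prod>j\<in>I \<union> {i\<in>I. emeasure (M i) (space (M i)) \<noteq> 1}. if j \<in> I then emeasure (M j) (A j) else emeasure (M j) (space (M j)))"
  proof (rule emeasure_extend_measure_Pair[OF PiM_def, where \<mu>'="emeasure N"])
    fix J E assume "(J \<noteq> {} \<or> I = {}) \<and> finite J \<and> J \<subseteq> I \<and> E \<in> (\<Pi> j\<in>J. sets (M j))"
    then have J: "finite J" "J \<subseteq> I" and E: "\<forall>j\<in>J. E j \<in> sets (M j)" by auto
    define F where "F i = (if i \<in> J then E i else space (M i))" for i
    have "prod_emb I M J (Pi\<^sub>E J E) = PiE I F"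
      unfolding F_def using J E by (intro prod_emb_PiE sets.sets_into_space) auto
    moreover have "F \<in> (\<Pi> i\<in>I. sets (M i))" using E by (auto simp: F_def)
    ultimately have "emeasure N (prod_emb I M J (Pi\<^sub>E J E)) = (\<Prod>i\<in>I. emeasure (M i) (F i))"
      using N by simp
    also have "\<dots> = (\<Prod>j\<in>J \<union> {i\<in>I. emeasure (M i) (space (M i)) \<noteq> 1}.
        if j \<in> J then emeasure (M j) (E j) else emeasure (M j) (space (M j)))"
      using I J by (intro prod.mono_neutral_cong_right) (auto simp: F_def)
    finally show "emeasure N (prod_emb I M J (Pi\<^sub>E J E)) = \<dots>" .
    show "prod_emb I M J (Pi\<^sub>E J E) \<in> Pow ?\<Omega>"
      by (auto simp: prod_emb_def)
  next
    show "positive (sets (PiM I M)) (emeasure N)" "countably_additive (sets (PiM I M)) (emeasure N)"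
      using emeasure_positive[of N] emeasure_countably_additive[of N] by (simp_all add: sets_N)
  qed (use I A False in auto)
  then show ?thesis
    using A by (subst (asm) prod_emb_PiE_same_index)
      (auto intro!: prod.cong sets.sets_into_space simp: Un_absorb2)
qed

lemma nn_integral_PiM_prod:
  fixes f :: "'i \<Rightarrow> 'a \<Rightarrow> ennreal"
  assumes I: "finite I" and f: "\<And>i. i \<in> I \<Longrightarrow> f i \<in> borel_measurable (M i)"
  shows "(\<integral>\<^sup>+x. (\<Prod>i\<in>I. f i (x i)) \<partial>PiM I M) = (\<Prod>i\<in>I. \<integral>\<^sup>+y. f i y \<partial>M i)"
proof -
  have "(\<integral>\<^sup>+x. (\<Prod>i\<in>I. f i (x i)) \<partial>PiM I M) = (\<Prod>i\<in>I. \<integral>\<^sup>+y. f i y \<partial>M i)"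
    if "finite J" "J \<subseteq> I" "\<And>i. i \<in> I \<Longrightarrow> f i \<in> borel_measurable (M i)"
      "\<And>i. i \<in> I - J \<Longrightarrow> \<exists>A\<in>sets (M i). f i = indicator A" for J and f :: "'i \<Rightarrow> 'a \<Rightarrow> ennreal"
    using that
  \<comment> \<open>\<open>J\<close> contains the coordinates whose function is not yet known to be
    an indicator. With no such coordinate the claim is the value on a box; each step frees one more
    coordinate, which replaces Fubini.\<close>
  proof (induction J arbitrary: f rule: finite_induct)
    case empty
    then have "\<forall>i\<in>I. \<exists>A. A \<in> sets (M i) \<and> f i = indicator A" by auto
    then obtain A where A: "\<And>i. i \<in> I \<Longrightarrow> A i \<in> sets (M i) \<and> f i = indicator (A i)" by metis
    have "(\<integral>\<^sup>+x. (\<Prod>i\<in>I. f i (x i)) \<partial>PiM I M) = (\<integral>\<^sup>+x. indicator (PiE I A) x \<partial>PiM I M)"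
      using A by (intro nn_integral_cong)
        (simp add: prod_indicator_PiE[OF I, symmetric] space_PiM PiE_iff)
    also have "\<dots> = (\<Prod>i\<in>I. emeasure (M i) (A i))"
      using A I by (subst nn_integral_indicator) (auto simp: emeasure_PiM_finite_index intro!: sets_PiM_I_finite)
    finally show ?case using A by simp
  next
    case (insert j J)
    then have j: "j \<in> I" by simp
    define R where "R x = (\<Prod>i\<in>I-{j}. f i (x i))" for x
    have [measurable]: "R \<in> borel_measurable (PiM I M)"
      unfolding R_def using insert.prems by measurable
    have split: "(\<Prod>i\<in>I. (f(j := h)) i (x i)) = h (x j) * R x" for h x
      using j I unfolding R_def by (subst prod.remove[of _ j]) (auto intro!: arg_cong2[where f="(*)"] prod.cong)
    have split': "(\<Prod>i\<in>I. \<integral>\<^sup>+y. (f(j := h)) i y \<partial>M i) =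
        (\<integral>\<^sup>+y. h y \<partial>M j) * (\<Prod>i\<in>I-{j}. \<integral>\<^sup>+y. f i y \<partial>M i)" for h
      using j I by (subst prod.remove[of _ j]) (auto intro!: arg_cong2[where f="(*)"] prod.cong)
    have "(\<integral>\<^sup>+x. h (x j) * R x \<partial>PiM I M) =
        (\<integral>\<^sup>+y. h y \<partial>M j) * (\<Prod>i\<in>I-{j}. \<integral>\<^sup>+y. f i y \<partial>M i)" if "h \<in> borel_measurable (M j)" for h
      using that
    \<comment> \<open>With the other factors fixed in \<open>R\<close>, both sides are additive,
      homogeneous and monotonically continuous in \<open>h\<close>, so indicators suffice; for these
      the outer induction hypothesis applies.\<close>
    proof (induction rule: borel_measurable_induct)
      case (cong g h)
      have "(\<integral>\<^sup>+x. g (x j) * R x \<partial>PiM I M) = (\<integral>\<^sup>+x. h (x j) * R x \<partial>PiM I M)"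
        using cong j by (intro nn_integral_cong) (auto simp: space_PiM PiE_iff)
      moreover have "(\<integral>\<^sup>+y. g y \<partial>M j) = (\<integral>\<^sup>+y. h y \<partial>M j)"
        using cong by (intro nn_integral_cong) auto
      ultimately show ?case using cong by simp
    next
      case (set A)
      have "(\<integral>\<^sup>+x. (\<Prod>i\<in>I. (f(j := indicator A)) i (x i)) \<partial>PiM I M) =
          (\<Prod>i\<in>I. \<integral>\<^sup>+y. (f(j := indicator A)) i y \<partial>M i)"
      proof (rule insert.IH)
        show "(f(j := indicator A)) i \<in> borel_measurable (M i)" if "i \<in> I" for i
          using that insert.prems(2)[OF that] set by auto
        show "\<exists>A'\<in>sets (M i). (f(j := indicator A)) i = indicator A'" if "i \<in> I - J" for i
          using that insert.prems(3)[of i] set by (cases "i = j") auto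
      qed (use insert.prems in auto)
      then show ?case
        unfolding split split' .
    next
      case (mult u c)
      note [measurable] = mult(2)
      show ?case
        using mult j by (simp add: nn_integral_cmult mult.assoc)
    next
      case (add u v)
      note [measurable] = add(1,3)
      show ?case
        using add j by (simp add: nn_integral_add distrib_right)
    next
      case (seq U)
      note [measurable] = seq(1)
      have "(\<integral>\<^sup>+x. (SUP k. U k) (x j) * R x \<partial>PiM I M) = (\<integral>\<^sup>+x. (SUP k. U k (x j) * R x) \<partial>PiM I M)"
        by (simp add: SUP_mult_right_ennreal image_comp)
      also have "\<dots> = (SUP k. \<integral>\<^sup>+x. U k (x j) * R x \<partial>PiM I M)"
        using seq j by (intro nn_integral_monotone_convergence_SUP)
          (auto simp: incseq_def le_fun_def intro!: mult_right_mono)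
      also have "\<dots> = (SUP k. \<integral>\<^sup>+y. U k y \<partial>M j) * (\<Prod>i\<in>I-{j}. \<integral>\<^sup>+y. f i y \<partial>M i)"
        using seq by (simp add: SUP_mult_right_ennreal)
      also have "(SUP k. \<integral>\<^sup>+y. U k y \<partial>M j) = (\<integral>\<^sup>+y. (SUP k. U k) y \<partial>M j)"
        using seq by (subst nn_integral_monotone_convergence_SUP[symmetric])
          (auto intro!: nn_integral_cong simp: image_comp)
      finally show ?case .
    qed
    from this[of "f j"] show ?case
      using split[of "f j"] split'[of "f j"] insert.prems j by simp
  qed
  from this[OF I subset_refl f] show ?thesis by simp
qed

text \<open>Uniqueness from the values on boxes is applied to \<open>density M \<rho>\<close>, the
  one measure here assumed sigma-finite. The box values of the right side come from
  \<open>nn_integral_PiM_prod\<close>, which is valid for any \<open>M\<close>.\<close>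

lemma PiM_density:
  fixes M :: "'a measure" and \<rho> :: "'a \<Rightarrow> ennreal"
  assumes I: "finite I" and [measurable]: "\<rho> \<in> borel_measurable M"
    and sf: "sigma_finite_measure (density M \<rho>)"
  shows "PiM I (\<lambda>_. density M \<rho>) = density (PiM I (\<lambda>_. M)) (\<lambda>x. \<Prod>i\<in>I. \<rho> (x i))"
proof -
  interpret product_sigma_finite "\<lambda>_. density M \<rho>"
    using sf by (simp add: product_sigma_finite_def)
  have sets_eq: "sets (PiM I (\<lambda>_. M)) = sets (PiM I (\<lambda>_. density M \<rho>))"
    by (rule sets_PiM_cong) auto
  show ?thesis
  proof (rule PiM_eqI[OF I, symmetric])
    fix A assume "\<And>i. i \<in> I \<Longrightarrow> A i \<in> sets (density M \<rho>)"
    then have A[measurable]: "\<And>i. i \<in> I \<Longrightarrow> A i \<in> sets M" by simp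
    have "emeasure (density (PiM I (\<lambda>_. M)) (\<lambda>x. \<Prod>i\<in>I. \<rho> (x i))) (PiE I A) =
        (\<integral>\<^sup>+x. (\<Prod>i\<in>I. \<rho> (x i)) * indicator (PiE I A) x \<partial>PiM I (\<lambda>_. M))"
      using I A by (intro emeasure_density) auto
    also have "\<dots> = (\<integral>\<^sup>+x. (\<Prod>i\<in>I. \<rho> (x i) * indicator (A i) (x i)) \<partial>PiM I (\<lambda>_. M))"
      by (intro nn_integral_cong)
        (simp add: prod.distrib prod_indicator_PiE[OF I] space_PiM PiE_iff)
    also have "\<dots> = (\<Prod>i\<in>I. \<integral>\<^sup>+y. \<rho> y * indicator (A i) y \<partial>M)"
      using A by (intro nn_integral_PiM_prod[OF I]) auto
    also have "\<dots> = (\<Prod>i\<in>I. emeasure (density M \<rho>) (A i))"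
      using A by (intro prod.cong) (auto simp: emeasure_density)
    finally show "emeasure (density (PiM I (\<lambda>_. M)) (\<lambda>x. \<Prod>i\<in>I. \<rho> (x i))) (PiE I A) = \<dots>" .
  qed (simp add: sets_eq)
qed

section \<open>Empirical measures and the weak topology\<close>

lemma prob_measuresD:
  assumes "\<mu> \<in> prob_measures"
  shows "sets \<mu> = sets borel" "prob_space \<mu>" "space \<mu> = UNIV"
  using assms sets_eq_imp_space_eq[of \<mu> borel] by (auto simp: prob_measures_def)

text \<open>As the law of a uniformly chosen sample point, the empirical measure inherits the
  integral formulas of finite distributions, and a uniform variable on the unit interval can realise
  it.\<close>

lemma empirical_measure_eq_distr:
  assumes "n \<ge> 1"
  shows "empirical_measure n x = distr (measure_pmf (pmf_of_set {1..n})) borel x"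
proof (rule measure_eqI)
  fix A :: "'a set" assume "A \<in> sets (empirical_measure n x)"
  then have A: "A \<in> sets borel" by simp
  have "emeasure (distr (measure_pmf (pmf_of_set {1..n})) borel x) A =
      of_nat (card ({1..n} \<inter> x -` A)) / of_nat (card {1..n})"
    using A assms by (simp add: emeasure_distr emeasure_pmf_of_set ennreal_of_nat_eq_real_of_nat
      flip: divide_ennreal)
  also have "of_nat (card ({1..n} \<inter> x -` A)) = (\<Sum>i=1..n. indicator A (x i) :: ennreal)"
    by (simp add: indicator_def sum.If_cases vimage_def)
  finally show "emeasure (empirical_measure n x) A =
      emeasure (distr (measure_pmf (pmf_of_set {1..n})) borel x) A"
    using A by (simp add: emeasure_empirical_measure)
qed simp

lemma nn_integral_empirical_measure:
  assumes "n \<ge> 1" "g \<in> borel_measurable borel"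
  shows "(\<integral>\<^sup>+y. g y \<partial>empirical_measure n x) = (\<Sum>i=1..n. g (x i)) / of_nat n"
  using assms by (simp add: empirical_measure_eq_distr nn_integral_distr nn_integral_pmf_of_set)

lemma integral_empirical_measure:
  fixes g :: "'a::topological_space \<Rightarrow> real"
  assumes "n \<ge> 1" "g \<in> borel_measurable borel"
  shows "(\<integral>y. g y \<partial>empirical_measure n x) = (\<Sum>i=1..n. g (x i)) / n"
  using assms by (simp add: empirical_measure_eq_distr integral_distr integral_pmf_of_set)

lemma nn_integral_pair_empirical_measure:
  fixes x :: "nat \<Rightarrow> 'a::second_countable_topology"
  assumes n: "n \<ge> 1" and h: "h \<in> borel_measurable borel"
  shows "(\<integral>\<^sup>+z. h z \<partial>(empirical_measure n x \<Otimes>\<^sub>M empirical_measure n x)) =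
    (\<Sum>i=1..n. \<Sum>j=1..n. h (x i, x j)) / of_nat n / of_nat n"
proof -
  let ?m = "empirical_measure n x"
  interpret prob_space ?m
    using empirical_measure_in_prob_measures[OF n] by (rule prob_measuresD)
  have sets_m: "sets (?m \<Otimes>\<^sub>M ?m) = sets borel"
    by (simp add: borel_prod[symmetric] cong: sets_pair_measure_cong)
  have [measurable]: "h \<in> borel_measurable (borel \<Otimes>\<^sub>M borel)" using h by (simp add: borel_prod)
  have "(\<integral>\<^sup>+z. h z \<partial>(?m \<Otimes>\<^sub>M ?m)) = (\<integral>\<^sup>+y. (\<integral>\<^sup>+z. h (y, z) \<partial>?m) \<partial>?m)"
    using h by (intro nn_integral_fst[symmetric]) (simp add: measurable_cong_sets[OF sets_m refl])
  also have "\<dots> = (\<integral>\<^sup>+y. (\<Sum>j=1..n. h (y, x j)) / of_nat n \<partial>?m)"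
    using n by (intro nn_integral_cong nn_integral_empirical_measure) measurable
  also have "\<dots> = (\<Sum>i=1..n. (\<Sum>j=1..n. h (x i, x j)) / of_nat n) / of_nat n"
    using n by (intro nn_integral_empirical_measure) measurable
  finally show ?thesis by (simp add: divide_ennreal_def sum_distrib_right)
qed

text \<open>The property "eventually in the open set" passes from the generating sets to finite
  intersections and arbitrary unions, so testing against single functions \<open>g\<close>
  suffices.\<close>

lemma limitin_weak_topologyI:
  assumes \<mu>: "\<mu> \<in> prob_measures" and ev: "eventually (\<lambda>n. \<mu>s n \<in> prob_measures) F"
    and lim: "\<And>g :: 'a::topological_space \<Rightarrow> real. continuous_on UNIV g \<Longrightarrow> bounded (range g) \<Longrightarrow>
      ((\<lambda>n. \<integral>x. g x \<partial>\<mu>s n) \<longlongrightarrow> (\<integral>x. g x \<partial>\<mu>)) F"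
  shows "limitin weak_topology \<mu>s \<mu> F"
  unfolding limitin_def topspace_weak_topology
proof (intro conjI allI impI \<mu>, elim conjE)
  fix U assume "openin weak_topology U" "\<mu> \<in> U"
  then show "eventually (\<lambda>n. \<mu>s n \<in> U) F"
    unfolding weak_topology_def openin_topology_generated_by_iff
  proof (induction rule: generate_topology_on.induct)
    case (Int a b)
    then show ?case by (simp add: eventually_conj_iff)
  next
    case (UN K)
    then obtain k where k: "k \<in> K" "\<mu> \<in> k" by auto
    from UN.IH[OF this] show ?case using k(1) by (auto elim!: eventually_mono)
  next
    case (Basis s)
    then obtain g :: "'a \<Rightarrow> real" and S where s: "s = {\<mu> \<in> prob_measures. (\<integral>x. g x \<partial>\<mu>) \<in> S}"
      and g: "continuous_on UNIV g" "bounded (range g)" and S: "open S"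
      by blast
    with Basis have "(\<integral>x. g x \<partial>\<mu>) \<in> S" by simp
    from topological_tendstoD[OF lim[OF g] S this] ev
    show ?case unfolding s by eventually_elim simp
  qed simp
qed

lemma continuous_map_empirical_measure:
  fixes n :: nat
  assumes n: "n \<ge> 1"
  shows "continuous_map euclidean weak_topology
    (empirical_measure n :: (nat \<Rightarrow> 'a::topological_space) \<Rightarrow> _)"
  unfolding weak_topology_def
proof (rule continuous_on_generated_topo)
  fix U :: "'a measure set"
  assume "U \<in> {{\<mu> \<in> prob_measures. (\<integral>x. g x \<partial>\<mu>) \<in> U} | (g :: 'a \<Rightarrow> real) U.
        continuous_on UNIV g \<and> bounded (range g) \<and> open U}"
  then obtain g :: "'a \<Rightarrow> real" and S where U: "U = {\<mu> \<in> prob_measures. (\<integral>x. g x \<partial>\<mu>) \<in> S}"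
    and g: "continuous_on UNIV g" and S: "open S"
    by blast
  have "empirical_measure n -` U = (\<lambda>x. (\<Sum>i=1..n. g (x i)) / n) -` S"
    using empirical_measure_in_prob_measures[OF n]
      integral_empirical_measure[OF n borel_measurable_continuous_onI[OF g]]
    by (auto simp: U)
  moreover have "continuous_on UNIV (\<lambda>x. (\<Sum>i=1..n. g (x i)) / n)"
    by (intro continuous_intros continuous_on_compose2[OF g] continuous_on_product_coordinates) (use n in auto)
  ultimately show "openin euclidean (empirical_measure n -` U \<inter> topspace euclidean)"
    using S by (simp add: open_vimage)
next
  show "empirical_measure n ` topspace euclidean \<subseteq> \<Union> {{\<mu> \<in> prob_measures. (\<integral>x. g x \<partial>\<mu>) \<in> U} | (g :: 'a \<Rightarrow> real) U.
        continuous_on UNIV g \<and> bounded (range g) \<and> open U}"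
    using empirical_measure_in_prob_measures[OF n]
      topspace_weak_topology[where ?'a='a, unfolded weak_topology_def topology_generated_by_topspace] by blast
qed

text \<open>No sigma-algebra on measures is used: \<open>f\<close> composed with \<open>i_n\<close>
  is continuous on the sequence space, whose Borel sets are the product sets by second
  countability.\<close>

lemma measurable_compose_empirical_measure:
  fixes f :: "'a::{second_countable_topology} measure \<Rightarrow> real"
  assumes f: "continuous_map weak_topology euclideanreal f"
    and n: "n \<ge> 1" and sets_l: "sets l = sets borel"
  shows "(\<lambda>x. f (empirical_measure n x)) \<in> borel_measurable (\<Pi>\<^sub>M i\<in>{1..n}. l)"
proof -
  have "continuous_on UNIV (\<lambda>x. f (empirical_measure n x))"
    using continuous_map_compose[OF continuous_map_empirical_measure[OF n] f] by (simp add: o_def)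
  then have *: "(\<lambda>x. f (empirical_measure n x)) \<in> borel_measurable (\<Pi>\<^sub>M i\<in>UNIV. borel)"
    unfolding measurable_cong_sets[OF sets_PiM_equal_borel refl] by (rule borel_measurable_continuous_onI)
  have "(\<lambda>x. x) \<in> measurable (\<Pi>\<^sub>M i\<in>{1..n}. l) (\<Pi>\<^sub>M i\<in>UNIV. borel)"
  proof (rule measurable_PiM_single')
    fix i :: nat
    show "(\<lambda>x. x i) \<in> borel_measurable (\<Pi>\<^sub>M i\<in>{1..n}. l)"
    proof (cases "i \<in> {1..n}")
      case True
      then have "(\<lambda>x. x i) \<in> measurable (\<Pi>\<^sub>M i\<in>{1..n}. l) l" by measurable
      then show ?thesis by (simp add: measurable_cong_sets[OF refl sets_l])
    next
      \<comment> \<open>Points of the finite product are \<open>undefined\<close> off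
        \<open>{1..n}\<close>, so this coordinate is constant.\<close>
      case False
      then show ?thesis
        by (subst measurable_cong[where g="\<lambda>_. undefined"]) (auto simp: space_PiM PiE_iff extensional_def)
    qed
  qed simp
  from measurable_compose[OF this *] show ?thesis .
qed

section \<open>Independent samples and the law of large numbers\<close>

lemma distr_PiM_coordinate:
  assumes I: "finite I" and P: "prob_space \<mu>" and i: "i \<in> I"
  shows "distr (\<Pi>\<^sub>M i\<in>I. \<mu>) \<mu> (\<lambda>x. x i) = \<mu>"
proof (rule measure_eqI)
  interpret prob_space \<mu> by fact
  fix A assume "A \<in> sets (distr (\<Pi>\<^sub>M i\<in>I. \<mu>) \<mu> (\<lambda>x. x i))"
  then have A: "A \<in> sets \<mu>" by simp
  let ?B = "\<lambda>k. if k = i then A else space \<mu>"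
  have "(\<lambda>x. x i) -` A \<inter> space (\<Pi>\<^sub>M i\<in>I. \<mu>) = PiE I ?B"
    using i sets.sets_into_space[OF A] by (auto simp: space_PiM PiE_iff split: if_splits) (metis subsetD)
  then have "emeasure (distr (\<Pi>\<^sub>M i\<in>I. \<mu>) \<mu> (\<lambda>x. x i)) A = (\<Prod>k\<in>I. emeasure \<mu> (?B k))"
    using i A I by (simp add: emeasure_distr emeasure_PiM_finite_index)
  also have "\<dots> = emeasure \<mu> A"
    using i I by (subst prod.remove[OF I i]) (simp add: emeasure_space_1)
  finally show "emeasure (distr (\<Pi>\<^sub>M i\<in>I. \<mu>) \<mu> (\<lambda>x. x i)) A = emeasure \<mu> A" .
qed simp

lemma distr_PiM_coordinate_pair:
  assumes I: "finite I" and P: "prob_space \<mu>" and i: "i \<in> I" and j: "j \<in> I" and ij: "i \<noteq> j"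
  shows "distr (\<Pi>\<^sub>M i\<in>I. \<mu>) (\<mu> \<Otimes>\<^sub>M \<mu>) (\<lambda>x. (x i, x j)) = \<mu> \<Otimes>\<^sub>M \<mu>"
proof (rule pair_measure_eqI[symmetric])
  interpret prob_space \<mu> by fact
  show "sigma_finite_measure \<mu>" "sigma_finite_measure \<mu>" by unfold_locales
  fix A B assume A: "A \<in> sets \<mu>" and B: "B \<in> sets \<mu>"
  let ?B = "\<lambda>k. if k = i then A else if k = j then B else space \<mu>"
  have "(\<lambda>x. (x i, x j)) -` (A \<times> B) \<inter> space (\<Pi>\<^sub>M i\<in>I. \<mu>) = PiE I ?B"
    using i j ij sets.sets_into_space[OF A] sets.sets_into_space[OF B]
    by (auto simp: space_PiM PiE_iff split: if_splits) (metis subsetD)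
  then have "emeasure (distr (\<Pi>\<^sub>M i\<in>I. \<mu>) (\<mu> \<Otimes>\<^sub>M \<mu>) (\<lambda>x. (x i, x j))) (A \<times> B) =
      (\<Prod>k\<in>I. emeasure \<mu> (?B k))"
    using i j A B I by (simp add: emeasure_distr emeasure_PiM_finite_index)
  also have "\<dots> = (\<Prod>k\<in>{i, j}. emeasure \<mu> (?B k))"
    using i j I by (intro prod.mono_neutral_right) (auto simp: emeasure_space_1)
  also have "\<dots> = emeasure \<mu> A * emeasure \<mu> B"
    using ij by simp
  finally show "emeasure \<mu> A * emeasure \<mu> B =
    emeasure (distr (\<Pi>\<^sub>M i\<in>I. \<mu>) (\<mu> \<Otimes>\<^sub>M \<mu>) (\<lambda>x. (x i, x j))) (A \<times> B)" ..
qed simp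

lemma indep_vars_PiM_coordinates:
  assumes I: "finite I" "I \<noteq> {}" and P: "prob_space \<mu>"
  shows "prob_space.indep_vars (\<Pi>\<^sub>M i\<in>I. \<mu>) (\<lambda>_. \<mu>) (\<lambda>i x. x i) I"
proof -
  interpret P: prob_space "\<Pi>\<^sub>M i\<in>I. \<mu>" by (intro prob_space_PiM P)
  have "distr (\<Pi>\<^sub>M i\<in>I. \<mu>) (\<Pi>\<^sub>M i\<in>I. \<mu>) (\<lambda>x. \<lambda>i\<in>I. x i) =
      distr (\<Pi>\<^sub>M i\<in>I. \<mu>) (\<Pi>\<^sub>M i\<in>I. \<mu>) (\<lambda>x. x)"
    by (rule distr_cong) (auto simp: space_PiM PiE_iff extensional_restrict)
  also have "\<dots> = (\<Pi>\<^sub>M i\<in>I. distr (\<Pi>\<^sub>M i\<in>I. \<mu>) \<mu> (\<lambda>x. x i))"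
    unfolding distr_id by (rule PiM_cong) (simp_all add: distr_PiM_coordinate[OF I(1) P])
  finally show ?thesis
    using I by (subst P.indep_vars_iff_distr_eq_PiM') auto
qed

lemma empirical_mean_tendsto_in_probability:
  fixes \<mu> :: "'a::topological_space measure" and g :: "'a \<Rightarrow> real"
  assumes \<mu>: "\<mu> \<in> prob_measures"
    and [measurable]: "g \<in> borel_measurable borel" and bdd: "bounded (range g)" and e: "e > 0"
  shows "(\<lambda>n::nat. measure (\<Pi>\<^sub>M i\<in>{1..n}. \<mu>)
    {x \<in> space (\<Pi>\<^sub>M i\<in>{1..n}. \<mu>). \<bar>(\<Sum>i=1..n. g ((x :: nat \<Rightarrow> 'a) i)) / n - (\<integral>y. g y \<partial>\<mu>)\<bar> < e}) \<longlonglongrightarrow> 1"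
proof -
  note \<mu>' = prob_measuresD[OF \<mu>]
  have [measurable]: "g \<in> borel_measurable \<mu>"
    using \<mu>'(1) by (simp add: measurable_cong_sets[OF \<mu>'(1) refl])
  obtain B where B: "B > 0" "\<And>y. \<bar>g y\<bar> \<le> B"
    using bdd by (auto simp: bounded_pos)
  define m where "m = (\<integral>y. g y \<partial>\<mu>)"
  define A where "A n = {x \<in> space (\<Pi>\<^sub>M i\<in>{1..n}. \<mu>). \<bar>(\<Sum>i=1..n. g (x i)) / n - m\<bar> < e}" for n :: nat
  \<comment> \<open>Hoeffding's exponent is \<open>2 (n e)^2\<close> divided by
    \<open>n (2 B)^2\<close>, because each variable ranges over an interval of length
    \<open>2 B\<close>.\<close>
  have lower: "1 - 2 * exp (- (e\<^sup>2 / (2 * B\<^sup>2)) * n) \<le> measure (\<Pi>\<^sub>M i\<in>{1..n}. \<mu>) (A n)" if n: "n \<ge> 1" for n :: nat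
  proof -
    interpret P: prob_space "\<Pi>\<^sub>M i\<in>{1..n}. \<mu>" by (intro prob_space_PiM \<mu>')
    have indep: "P.indep_vars (\<lambda>_. borel) (\<lambda>i x. g (x i)) {1..n}"
      using n by (intro P.indep_vars_compose2[OF indep_vars_PiM_coordinates]) (auto simp: \<mu>')
    have exp: "P.expectation (\<lambda>x. g (x i)) = m" if "i \<in> {1..n}" for i
    proof -
      have "m = (\<integral>y. g y \<partial>distr (\<Pi>\<^sub>M i\<in>{1..n}. \<mu>) \<mu> (\<lambda>x. x i))"
        using that \<mu>' by (subst distr_PiM_coordinate) (auto simp: m_def)
      then show ?thesis using that by (simp add: integral_distr)
    qed
    interpret H: Hoeffding_ineq "\<Pi>\<^sub>M i\<in>{1..n}. \<mu>" "{1..n}" "\<lambda>i x. g (x i)" "\<lambda>_. - B" "\<lambda>_. B" "real n * m"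
    proof unfold_locales
      have "- B \<le> g y" "g y \<le> B" for y using B(2)[of y] by linarith+
      then show "AE x in (\<Pi>\<^sub>M i\<in>{1..n}. \<mu>). g (x i) \<in> {- B..B}" for i :: nat by simp
      show "real n * m \<equiv> \<Sum>i\<in>{1..n}. P.expectation (\<lambda>x. g (x i))"
        by (rule eq_reflection, subst sum.cong[OF refl exp]) auto
    qed (use indep in simp_all)
    have meas: "{x \<in> space (\<Pi>\<^sub>M i\<in>{1..n}. \<mu>). \<bar>(\<Sum>i=1..n. g (x i)) - n * m\<bar> \<ge> n * e} \<in> P.events"
      by measurable
    have "A n = space (\<Pi>\<^sub>M i\<in>{1..n}. \<mu>) -
        {x \<in> space (\<Pi>\<^sub>M i\<in>{1..n}. \<mu>). \<bar>(\<Sum>i=1..n. g (x i)) - n * m\<bar> \<ge> n * e}"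
    proof -
      have "\<bar>s / n - m\<bar> < e \<longleftrightarrow> \<not> \<bar>s - n * m\<bar> \<ge> n * e" for s :: real
      proof -
        have "s - n * m = n * (s / n - m)" using n by (simp add: field_simps)
        then show ?thesis using n by (simp add: abs_mult not_le)
      qed
      then show ?thesis unfolding A_def by (simp only: set_diff_eq mem_Collect_eq) blast
    qed
    then have "measure (\<Pi>\<^sub>M i\<in>{1..n}. \<mu>) (A n) =
        1 - P.prob {x \<in> space (\<Pi>\<^sub>M i\<in>{1..n}. \<mu>). \<bar>(\<Sum>i=1..n. g (x i)) - n * m\<bar> \<ge> n * e}"
      using P.prob_compl[OF meas] by simp
    moreover have "P.prob {x \<in> space (\<Pi>\<^sub>M i\<in>{1..n}. \<mu>). \<bar>(\<Sum>i=1..n. g (x i)) - n * m\<bar> \<ge> n * e} \<le>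
        2 * exp (-2 * (n * e)\<^sup>2 / (\<Sum>i\<in>{1..n}. (B - - B)\<^sup>2))"
      using n e B by (intro H.Hoeffding_ineq_abs_ge) auto
    moreover have "-2 * (n * e)\<^sup>2 / (\<Sum>i\<in>{1..n}. (B - - B)\<^sup>2) = - (e\<^sup>2 / (2 * B\<^sup>2)) * n"
      using n B by (simp add: field_simps power2_eq_square)
    ultimately show ?thesis by simp
  qed
  have "(\<lambda>n. measure (\<Pi>\<^sub>M i\<in>{1..n}. \<mu>) (A n)) \<longlonglongrightarrow> 1"
  proof (rule tendsto_sandwich)
    show "\<forall>\<^sub>F n in sequentially. 1 - 2 * exp (- (e\<^sup>2 / (2 * B\<^sup>2)) * real n) \<le> measure (\<Pi>\<^sub>M i\<in>{1..n}. \<mu>) (A n)"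
      using eventually_ge_at_top[of 1] by eventually_elim (rule lower)
    show "\<forall>\<^sub>F n in sequentially. measure (\<Pi>\<^sub>M i\<in>{1..n}. \<mu>) (A n) \<le> 1"
      by (intro always_eventually allI prob_space.prob_le_1 prob_space_PiM \<mu>')
    have "e\<^sup>2 / (2 * B\<^sup>2) > 0" using e B by simp
    then have "filterlim (\<lambda>n. - (e\<^sup>2 / (2 * B\<^sup>2)) * real n) at_bot sequentially"
      by (intro filterlim_tendsto_neg_mult_at_bot[OF tendsto_const] filterlim_real_sequentially) simp
    then have "(\<lambda>n. exp (- (e\<^sup>2 / (2 * B\<^sup>2)) * real n)) \<longlonglongrightarrow> 0"
      by (rule filterlim_compose[OF exp_at_bot])
    from tendsto_diff[OF tendsto_const tendsto_mult[OF tendsto_const this]]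
    show "(\<lambda>n. 1 - 2 * exp (- (e\<^sup>2 / (2 * B\<^sup>2)) * real n)) \<longlonglongrightarrow> 1" by simp
  qed simp
  then show ?thesis by (simp add: A_def m_def)
qed

text \<open>The event that the empirical measure lies in \<open>U\<close> need not be measurable,
  since the induction over generated open sets passes through arbitrary unions. Hence the measurable
  sets \<open>A n\<close> inside the event; for a union, those of one member containing
  \<open>\<mu>\<close> suffice.\<close>

lemma empirical_measure_tendsto_in_probability:
  fixes \<mu> :: "'a::topological_space measure"
  assumes \<mu>: "\<mu> \<in> prob_measures" and U: "openin weak_topology U" "\<mu> \<in> U"
  shows "\<exists>A. (\<forall>n\<ge>1. A n \<in> sets (\<Pi>\<^sub>M i\<in>{1..n}. \<mu>) \<and> (\<forall>x\<in>A n. empirical_measure n x \<in> U)) \<and>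
    (\<lambda>n. measure (\<Pi>\<^sub>M i\<in>{1..n}. \<mu>) (A n)) \<longlonglongrightarrow> 1"
  using U unfolding weak_topology_def openin_topology_generated_by_iff
proof (induction rule: generate_topology_on.induct)
  case Empty
  then show ?case by simp
next
  case (Int a b)
  then have ab: "\<mu> \<in> a" "\<mu> \<in> b" by auto
  obtain A where A: "\<And>n. n \<ge> 1 \<Longrightarrow> A n \<in> sets (\<Pi>\<^sub>M i\<in>{1..n}. \<mu>)"
      "\<And>n x. n \<ge> 1 \<Longrightarrow> x \<in> A n \<Longrightarrow> empirical_measure n x \<in> a"
      "(\<lambda>n. measure (\<Pi>\<^sub>M i\<in>{1..n}. \<mu>) (A n)) \<longlonglongrightarrow> 1"
    using Int.IH(1)[OF ab(1)] by blast
  obtain B where B: "\<And>n. n \<ge> 1 \<Longrightarrow> B n \<in> sets (\<Pi>\<^sub>M i\<in>{1..n}. \<mu>)"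
      "\<And>n x. n \<ge> 1 \<Longrightarrow> x \<in> B n \<Longrightarrow> empirical_measure n x \<in> b"
      "(\<lambda>n. measure (\<Pi>\<^sub>M i\<in>{1..n}. \<mu>) (B n)) \<longlonglongrightarrow> 1"
    using Int.IH(2)[OF ab(2)] by blast
  have "(\<lambda>n. measure (\<Pi>\<^sub>M i\<in>{1..n}. \<mu>) (A n \<inter> B n)) \<longlonglongrightarrow> 1"
  proof (rule tendsto_sandwich)
    show "\<forall>\<^sub>F n in sequentially. measure (\<Pi>\<^sub>M i\<in>{1..n}. \<mu>) (A n) + measure (\<Pi>\<^sub>M i\<in>{1..n}. \<mu>) (B n) - 1 \<le>
        measure (\<Pi>\<^sub>M i\<in>{1..n}. \<mu>) (A n \<inter> B n)"
      using eventually_ge_at_top[of 1]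
    proof eventually_elim
      case (elim n)
      interpret P: prob_space "\<Pi>\<^sub>M i\<in>{1..n}. \<mu>" by (intro prob_space_PiM prob_measuresD \<mu>)
      show ?case
        using P.finite_measure_Union'[OF A(1)[OF elim] B(1)[OF elim]] 
          P.finite_measure_Diff'[OF B(1)[OF elim] A(1)[OF elim]] P.prob_le_1[of "A n \<union> B n"]
        by (simp add: Int_commute)
    qed
    show "\<forall>\<^sub>F n in sequentially. measure (\<Pi>\<^sub>M i\<in>{1..n}. \<mu>) (A n \<inter> B n) \<le> 1"
      by (intro always_eventually allI prob_space.prob_le_1 prob_space_PiM prob_measuresD \<mu>)
    show "(\<lambda>n. measure (\<Pi>\<^sub>M i\<in>{1..n}. \<mu>) (A n) + measure (\<Pi>\<^sub>M i\<in>{1..n}. \<mu>) (B n) - 1) \<longlonglongrightarrow> 1"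
      using tendsto_diff[OF tendsto_add[OF A(3) B(3)] tendsto_const[of 1]] by simp
  qed simp
  with A B show ?case by (intro exI[of _ "\<lambda>n. A n \<inter> B n"]) auto
next
  case (UN K)
  then obtain k where k: "k \<in> K" "\<mu> \<in> k" by auto
  with UN.IH[OF this] show ?case by blast
next
  case (Basis s)
  then obtain g :: "'a \<Rightarrow> real" and S where s: "s = {\<mu> \<in> prob_measures. (\<integral>x. g x \<partial>\<mu>) \<in> S}"
    and g: "continuous_on UNIV g" "bounded (range g)" and S: "open S"
    by blast
  have g_meas: "g \<in> borel_measurable borel" using g by (intro borel_measurable_continuous_onI)
  then have [measurable]: "g \<in> borel_measurable \<mu>"
    by (simp add: measurable_cong_sets[OF prob_measuresD(1)[OF \<mu>] refl])
  obtain e where e: "e > 0" "ball (\<integral>x. g x \<partial>\<mu>) e \<subseteq> S"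
    using S Basis(2) by (auto simp: s open_contains_ball)
  let ?A = "\<lambda>n::nat. {x \<in> space (\<Pi>\<^sub>M i\<in>{1..n}. \<mu>). \<bar>(\<Sum>i=1..n. g ((x :: nat \<Rightarrow> 'a) i)) / n - (\<integral>y. g y \<partial>\<mu>)\<bar> < e}"
  have "?A n \<in> sets (\<Pi>\<^sub>M i\<in>{1..n}. \<mu>)" for n by measurable
  moreover have "empirical_measure n x \<in> s" if "n \<ge> 1" "x \<in> ?A n" for n x
    using that e empirical_measure_in_prob_measures[OF that(1)]
    by (auto simp: s integral_empirical_measure[OF that(1) g_meas] dist_real_def abs_minus_commute
      intro!: subsetD[OF e(2)])
  ultimately show ?case
    using empirical_mean_tendsto_in_probability[OF \<mu> g_meas g(2) e(1)]
    by (intro exI[of _ ?A]) blast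
qed

section \<open>Compactness of tight sequences of empirical measures\<close>

lemma take_mono_list_lexorder:
  fixes u v :: "'a::linorder list"
  assumes "u \<le> v"
  shows "take j u \<le> take j v"
  using assms
proof (induction j arbitrary: u v)
  case (Suc j)
  then show ?case by (cases u; cases v) auto
qed simp

lemma down_closed_eq_lessThan_card:
  fixes S :: "nat set"
  assumes "finite S" and down: "\<And>i j. i \<le> j \<Longrightarrow> j \<in> S \<Longrightarrow> i \<in> S"
  shows "S = {..<card S}"
proof (cases "S = {}")
  case False
  then have "Max S \<in> S" using assms(1) by simp
  then have "S = {..<Suc (Max S)}"
    using down assms(1) by (auto simp: less_Suc_eq_le)
  then show ?thesis by (metis card_lessThan)
qed simp

lemma sorted_enumeration_exists:
  fixes key :: "nat \<Rightarrow> 'k::linorder"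
  shows "\<exists>\<sigma>. bij_betw \<sigma> {..<n} {1..n} \<and> (\<forall>i j. i \<le> j \<longrightarrow> j < n \<longrightarrow> key (\<sigma> i) \<le> key (\<sigma> j))"
proof -
  define xs where "xs = sort_key key [1..<Suc n]"
  have xs: "length xs = n" "set xs = {1..n}" "distinct xs" "sorted (map key xs)"
    by (auto simp: xs_def)
  have "bij_betw ((!) xs) {..<n} {1..n}"
    using xs by (intro bij_betw_nth) auto
  moreover have "key (xs ! i) \<le> key (xs ! j)" if "i \<le> j" "j < n" for i j
    using sorted_nth_mono[OF xs(4) that(1)] that xs(1) by simp
  ultimately show ?thesis by blast
qed

text \<open>The positions satisfying \<open>P\<close> form an initial segment, whose length is the
  number of indices satisfying \<open>P\<close>. With \<open>P\<close> the condition that a code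
  lies below a word, counts alone determine which code stands at a given position.\<close>

lemma sorted_enumeration_less_card_iff:
  fixes \<sigma> :: "nat \<Rightarrow> nat"
  assumes bij: "bij_betw \<sigma> {..<n} {1..n}"
    and down: "\<And>i j. i \<le> j \<Longrightarrow> j < n \<Longrightarrow> P (\<sigma> j) \<Longrightarrow> P (\<sigma> i)"
    and m: "m < n"
  shows "P (\<sigma> m) \<longleftrightarrow> m < card {i\<in>{1..n}. P i}"
proof -
  define S where "S = {m\<in>{..<n}. P (\<sigma> m)}"
  have "bij_betw \<sigma> S {i\<in>{1..n}. P i}"
    using bij unfolding S_def bij_betw_def by (auto simp: inj_on_def image_iff)
  then have "card S = card {i\<in>{1..n}. P i}" by (rule bij_betw_same_card)
  moreover have "S = {..<card S}"
    by (rule down_closed_eq_lessThan_card) (auto simp: S_def intro: down)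
  ultimately show ?thesis using m by (auto simp: S_def)
qed

text \<open>The interval is half-open so that \<open>nat \<lfloor>n * t\<rfloor>\<close> is below
  \<open>n\<close> for every \<open>t\<close> in it.\<close>

abbreviation unit_uniform :: "real measure" where
  "unit_uniform \<equiv> uniform_measure lborel {0..<1}"

lemma emeasure_unit_interval: "emeasure lborel {0..<1::real} = 1"
  by simp

lemma prob_space_unit_uniform: "prob_space unit_uniform"
  by (rule prob_space_uniform_measure) (simp_all add: emeasure_unit_interval)

lemma measurable_unit_uniform: "measurable unit_uniform N = measurable borel N"
  by (rule measurable_cong_sets) simp_all

lemma measurable_nat_floor [measurable]:
  "(\<lambda>t. nat \<lfloor>real n * t\<rfloor>) \<in> measurable borel (count_space UNIV)"
  by simp

lemma nat_floor_less_iff: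
  fixes t :: real
  assumes "n \<ge> 1" "t \<ge> 0"
  shows "nat \<lfloor>real n * t\<rfloor> < c \<longleftrightarrow> t < c / n"
proof -
  have "nat \<lfloor>real n * t\<rfloor> < c \<longleftrightarrow> \<lfloor>real n * t\<rfloor> < int c"
    using assms by (simp add: nat_less_iff)
  also have "\<dots> \<longleftrightarrow> real n * t < c" by (simp add: floor_less_iff)
  also have "\<dots> \<longleftrightarrow> t < c / n" using assms by (simp add: field_simps)
  finally show ?thesis .
qed

lemma distr_unit_uniform_floor:
  assumes n: "n \<ge> 1"
  shows "distr unit_uniform (count_space UNIV) (\<lambda>t. nat \<lfloor>real n * t\<rfloor>) = measure_pmf (pmf_of_set {..<n})"
proof (rule measure_eqI_countable[where A=UNIV])
  fix m :: nat
  have "emeasure (distr unit_uniform (count_space UNIV) (\<lambda>t. nat \<lfloor>real n * t\<rfloor>)) {m} =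
      emeasure unit_uniform ((\<lambda>t. nat \<lfloor>real n * t\<rfloor>) -` {m})"
    by (subst emeasure_distr) (simp_all add: measurable_unit_uniform)
  also have "\<dots> = emeasure lborel ({0..<1} \<inter> (\<lambda>t. nat \<lfloor>real n * t\<rfloor>) -` {m}) / emeasure lborel {0..<1::real}"
    using measurable_sets[OF measurable_nat_floor, of "{m}" n]
    by (intro emeasure_uniform_measure) auto
  also have "{0..<1} \<inter> (\<lambda>t. nat \<lfloor>real n * t\<rfloor>) -` {m} = (if m < n then {m / n..<(m + 1) / n} else {})"
  proof -
    define a b where "a = real m / n" and "b = real (m + 1) / n"
    have "nat \<lfloor>real n * t\<rfloor> = m \<longleftrightarrow> a \<le> t \<and> t < b" if "t \<ge> 0" for t
    proof -
      have "nat \<lfloor>real n * t\<rfloor> < m \<longleftrightarrow> t < a" "nat \<lfloor>real n * t\<rfloor> < m + 1 \<longleftrightarrow> t < b"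
        unfolding a_def b_def by (rule nat_floor_less_iff[OF n that])+
      then show ?thesis by linarith
    qed
    note eq = this
    have ab: "0 \<le> a" "m < n \<Longrightarrow> b \<le> 1" "\<not> m < n \<Longrightarrow> 1 \<le> a"
      using n by (auto simp: a_def b_def)
    show ?thesis
      unfolding a_def[symmetric] b_def[symmetric]
    proof (rule set_eqI)
      fix t
      show "t \<in> {0..<1} \<inter> (\<lambda>t. nat \<lfloor>real n * t\<rfloor>) -` {m} \<longleftrightarrow> t \<in> (if m < n then {a..<b} else {})"
        using eq[of t] ab by (cases "t \<ge> 0"; cases "m < n") auto
    qed
  qed
  also have "emeasure lborel \<dots> / emeasure lborel {0..<1::real} = ennreal (if m < n then 1 / n else 0)"
    using n by (simp add: divide_right_mono diff_divide_distrib[symmetric] divide_ennreal_def)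
  also have "\<dots> = emeasure (measure_pmf (pmf_of_set {..<n})) {m}"
    using n by (subst emeasure_pmf_of_set) (auto simp: lessThan_empty_iff)
  finally show "emeasure (distr unit_uniform (count_space UNIV) (\<lambda>t. nat \<lfloor>real n * t\<rfloor>)) {m} =
    emeasure (measure_pmf (pmf_of_set {..<n})) {m}" .
qed auto

lemma distr_unit_uniform_empirical_measure:
  assumes n: "n \<ge> 1" and bij: "bij_betw \<sigma> {..<n} {1..n}"
  shows "distr unit_uniform borel (\<lambda>t. x (\<sigma> (nat \<lfloor>real n * t\<rfloor>))) = empirical_measure n x"
proof -
  have "distr unit_uniform borel (\<lambda>t. x (\<sigma> (nat \<lfloor>real n * t\<rfloor>))) =
      distr (distr unit_uniform (count_space UNIV) (\<lambda>t. nat \<lfloor>real n * t\<rfloor>)) borel (\<lambda>m. x (\<sigma> m))"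
    by (subst distr_distr) (simp_all add: measurable_unit_uniform o_def)
  also have "\<dots> = distr (measure_pmf (map_pmf \<sigma> (pmf_of_set {..<n}))) borel x"
    unfolding distr_unit_uniform_floor[OF n] map_pmf_rep_eq
    by (subst distr_distr) (auto simp: o_def)
  also have "map_pmf \<sigma> (pmf_of_set {..<n}) = pmf_of_set {1..n}"
    using n by (intro map_pmf_of_set_bij_betw[OF bij]) (auto simp: lessThan_empty_iff)
  finally show ?thesis by (simp add: empirical_measure_eq_distr[OF n])
qed

lemma measure_unit_uniform_greaterThanLessThan:
  assumes "0 \<le> a" "a \<le> b" "b \<le> 1"
  shows "measure unit_uniform {a<..<b} = b - a"
proof -
  have "{0..<1} \<inter> {a<..<b} = {a<..<b}" using assms by auto
  then show ?thesis
    using assms by (subst measure_uniform_measure)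
      (simp_all add: emeasure_unit_interval measure_def)
qed

text \<open>A form of the Prokhorov and Skorokhod theorems.  Points are coded by the sequence of indices
  of nearby points of a dense sequence; listing the sample in lexicographic order of these codes
  makes the set of times at which the code starts with a given word an interval.\<close>

lemma tight_empirical_measures_coupling:
  fixes x :: "nat \<Rightarrow> nat \<Rightarrow> 'a::polish_space" and n :: "nat \<Rightarrow> nat"
  assumes n: "\<And>k. n k \<ge> 1"
    and tight: "\<And>\<eta>::real. \<eta> > 0 \<Longrightarrow> \<exists>K. compact K \<and>
      (\<forall>\<^sub>F k in sequentially. (1 - \<eta>) * n k \<le> card {i\<in>{1..n k}. x k i \<in> K})"
  obtains r Y Z where "strict_mono (r :: nat \<Rightarrow> nat)"
    "\<And>k. Y k \<in> borel_measurable borel" "Z \<in> borel_measurable borel"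
    "\<And>k. distr unit_uniform borel (Y k) = empirical_measure (n (r k)) (x (r k))"
    "\<And>t. (\<lambda>k. Y k t) \<longlonglongrightarrow> Z t"
proof -
  obtain D0 :: "'a set" where D0: "countable D0" "\<And>X. open X \<Longrightarrow> X \<noteq> {} \<Longrightarrow> \<exists>d\<in>D0. d \<in> X"
    by (rule countable_dense_setE) blast
  define D where "D = from_nat_into D0"
  have "D0 \<noteq> {}" using D0(2)[of UNIV] by auto
  then have D_dense: "\<exists>i. dist y (D i) < e" if "e > 0" for y e
    using D0(2)[of "ball y e"] D0(1) that unfolding D_def
    by (metis ball_eq_empty from_nat_into_surj mem_ball not_le open_ball)
  \<comment> \<open>Digit \<open>j\<close> locates \<open>y\<close> within \<open>(1/2)^j\<close>,
    so a code that stabilises digit by digit forces a Cauchy sequence.\<close>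
  define dig where "dig j y = (LEAST i. dist y (D i) < (1/2)^j)" for j :: nat and y
  have dig: "dist y (D (dig j y)) < (1/2)^j" for j y
    unfolding dig_def by (rule LeastI_ex) (simp add: D_dense)
  define wd where "wd j y = map (\<lambda>i. dig i y) [0..<j]" for j y
  have wd_take: "wd j y = take j (wd k y)" if "j \<le> k" for j k y
    using that by (simp add: wd_def take_map)
  have len_wd [simp]: "length (wd j y) = j" for j y by (simp add: wd_def)

  \<comment> \<open>Counts of sample points with code prefix at most \<open>w\<close>
    (\<open>True\<close>) or below \<open>w\<close> (\<open>False\<close>). Divided by
    \<open>n k\<close> they are the end points of the time interval on which the sorted sample has
    prefix \<open>w\<close>.\<close>
  define C where "C b w k = card {i\<in>{1..n k}. if b then wd (length w) (x k i) \<le> w else wd (length w) (x k i) < w}"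
    for b w k
  define F where "F k p = C (fst p) (snd p) k / n k" for k p
  have F_bounds: "F k p \<in> {0..1}" for k p
  proof -
    have "C (fst p) (snd p) k \<le> card {1..n k}" unfolding C_def by (rule card_mono) auto
    then show ?thesis using n[of k] by (simp add: F_def)
  qed
  have "norm (F k p) \<le> 1" for k p using F_bounds[of k p] by simp
  \<comment> \<open>There are only countably many words, so a diagonal subsequence makes all the end
    points converge at once.\<close>
  then obtain r where r: "strict_mono (r :: nat \<Rightarrow> nat)"
    and conv: "\<And>p. p \<in> UNIV \<Longrightarrow> \<exists>l. (\<lambda>k. F (r k) p) \<longlonglongrightarrow> l"
    by (rule function_convergent_subsequence[of UNIV F 1, OF countableI_type]) blast
  define \<Phi> where "\<Phi> p = lim (\<lambda>k. F (r k) p)" for p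
  have \<Phi>: "(\<lambda>k. F (r k) p) \<longlonglongrightarrow> \<Phi> p" for p
    using conv[of p] unfolding \<Phi>_def by (simp add: convergent_def convergent_LIMSEQ_iff[symmetric])
  have \<Phi>_bounds: "0 \<le> \<Phi> p" "\<Phi> p \<le> 1" for p
  proof -
    show "0 \<le> \<Phi> p" by (rule LIMSEQ_le_const[OF \<Phi>]) (use F_bounds[of _ p] in auto)
    show "\<Phi> p \<le> 1" by (rule LIMSEQ_le_const2[OF \<Phi>]) (use F_bounds[of _ p] in auto)
  qed
  have F_diff: "F k (True, w) - F k (False, w) = card {i\<in>{1..n k}. wd (length w) (x k i) = w} / n k" for k w
  proof -
    have "{i\<in>{1..n k}. wd (length w) (x k i) \<le> w} =
        {i\<in>{1..n k}. wd (length w) (x k i) < w} \<union> {i\<in>{1..n k}. wd (length w) (x k i) = w}"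
      by (auto simp: order_le_less)
    moreover have "card \<dots> = card {i\<in>{1..n k}. wd (length w) (x k i) < w} + card {i\<in>{1..n k}. wd (length w) (x k i) = w}"
      by (rule card_Un_disjoint) auto
    ultimately show ?thesis by (simp add: F_def C_def diff_divide_distrib[symmetric])
  qed
  have \<Phi>_le: "\<Phi> (False, w) \<le> \<Phi> (True, w)" for w
  proof (rule LIMSEQ_le[OF \<Phi> \<Phi>], intro exI allI impI)
    show "F (r k) (False, w) \<le> F (r k) (True, w)" for k
    proof -
      have "0 \<le> F (r k) (True, w) - F (r k) (False, w)"
        unfolding F_diff by simp
      then show ?thesis by simp
    qed
  qed
  have \<Phi>_sep: "\<Phi> (True, w) \<le> \<Phi> (False, v)" if "w < v" "length w = length v" for w v
  proof (rule LIMSEQ_le[OF \<Phi> \<Phi>], intro exI allI impI)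
    fix k
    have "C True w (r k) \<le> C False v (r k)"
      unfolding C_def using that by (intro card_mono) auto
    then show "F (r k) (True, w) \<le> F (r k) (False, v)"
      by (simp add: F_def divide_right_mono)
  qed
  \<comment> \<open>The limit interval is taken open: a time inside it satisfies the strict
    inequalities with the end points at stage \<open>k\<close> for all large
    \<open>k\<close>.\<close>
  define J where "J w = {\<Phi> (False, w)<..<\<Phi> (True, w)}" for w
  interpret U: prob_space unit_uniform by (rule prob_space_unit_uniform)
  define G where "G j = (\<Union>w\<in>{w. length w = j}. J w)" for j
  have G_meas: "G j \<in> sets borel" for j
    unfolding G_def by (intro sets.countable_UN'') (auto simp: J_def)
  have AE_G: "AE t in unit_uniform. t \<in> G j" for j
  proof -
    \<comment> \<open>Tightness enters here. Words of length \<open>j\<close> are infinitely many,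
      so mass could be lost in the limit; up to \<open>\<eta>\<close>, finitely many words carry all
      the mass, uniformly in \<open>k\<close>, and finite sums pass to the limit.\<close>
    have "1 - \<eta> \<le> U.prob (G j)" if \<eta>: "\<eta> > 0" for \<eta> :: real
    proof -
      obtain K where K: "compact K"
        and ev: "\<forall>\<^sub>F k in sequentially. (1 - \<eta>) * n k \<le> card {i\<in>{1..n k}. x k i \<in> K}"
        using tight[OF \<eta>] by blast
      \<comment> \<open>Finitely many balls of radius \<open>(1/2)^i\<close> cover \<open>K\<close>,
        and the least index of a ball containing \<open>y\<close> is at most the largest index used
        in the cover.\<close>
      have "\<exists>B. \<forall>y\<in>K. dig i y < B" for i
      proof -
        have "K \<subseteq> (\<Union>b\<in>UNIV. ball (D b) ((1/2)^i))"
          using D_dense[of "(1/2)^i"] by (auto simp: dist_commute)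
        then obtain S where S: "finite S" "K \<subseteq> (\<Union>b\<in>S. ball (D b) ((1/2)^i))"
          using compactE_image[OF K, of UNIV "\<lambda>b. ball (D b) ((1/2)^i)"] by auto
        have "dig i y < Suc (Max S)" if y: "y \<in> K" for y
        proof -
          obtain b where b: "b \<in> S" "dist y (D b) < (1/2)^i" using S(2) y by (auto simp: dist_commute)
          have "dig i y \<le> b" unfolding dig_def using b(2) by (rule Least_le)
          then show ?thesis using b(1) S(1) by (meson Max_ge le_imp_less_Suc le_trans)
        qed
        then show ?thesis by blast
      qed
      then obtain B where B: "\<And>i y. y \<in> K \<Longrightarrow> dig i y < B i" by metis
      \<comment> \<open>\<open>Suc j\<close> instead of \<open>j\<close> keeps the set under
        \<open>Max\<close> nonempty when \<open>j = 0\<close>.\<close>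
      define W where "W = {w. set w \<subseteq> {..<Max (B ` {..<Suc j})} \<and> length w = j}"
      have "finite W" unfolding W_def by (intro finite_lists_length_eq) simp
      have wd_W: "wd j y \<in> W" if "y \<in> K" for y
      proof -
        have "dig i y < Max (B ` {..<Suc j})" if "i < j" for i
          using B[OF \<open>y \<in> K\<close>, of i] that by (intro less_le_trans[OF _ Max_ge]) auto
        then show ?thesis by (auto simp: W_def wd_def)
      qed
      have lower: "1 - \<eta> \<le> (\<Sum>w\<in>W. F k (True, w) - F k (False, w))"
        if k: "(1 - \<eta>) * n k \<le> card {i\<in>{1..n k}. x k i \<in> K}" for k
      proof -
        have "card {i\<in>{1..n k}. x k i \<in> K} \<le> card (\<Union>w\<in>W. {i\<in>{1..n k}. wd j (x k i) = w})"
          using wd_W by (intro card_mono finite_UN_I \<open>finite W\<close>) auto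
        also have "\<dots> = (\<Sum>w\<in>W. card {i\<in>{1..n k}. wd j (x k i) = w})"
          using \<open>finite W\<close> by (intro card_UN_disjoint) auto
        finally have "(1 - \<eta>) * n k \<le> (\<Sum>w\<in>W. card {i\<in>{1..n k}. wd j (x k i) = w})"
          using k by linarith
        then have "1 - \<eta> \<le> (\<Sum>w\<in>W. card {i\<in>{1..n k}. wd j (x k i) = w}) / n k"
          using n[of k] by (simp add: field_simps)
        also have "\<dots> = (\<Sum>w\<in>W. F k (True, w) - F k (False, w))"
          unfolding F_diff by (simp add: sum_divide_distrib W_def)
        finally show ?thesis .
      qed
      have "(\<lambda>k. \<Sum>w\<in>W. F (r k) (True, w) - F (r k) (False, w)) \<longlonglongrightarrow> (\<Sum>w\<in>W. \<Phi> (True, w) - \<Phi> (False, w))"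
        by (intro tendsto_intros \<Phi>)
      then have "1 - \<eta> \<le> (\<Sum>w\<in>W. \<Phi> (True, w) - \<Phi> (False, w))"
        by (rule tendsto_lowerbound) (use eventually_subseq[OF r ev] lower in \<open>auto elim: eventually_mono\<close>)
      also have "\<dots> = (\<Sum>w\<in>W. U.prob (J w))"
        unfolding J_def
        by (intro sum.cong refl measure_unit_uniform_greaterThanLessThan[symmetric] \<Phi>_bounds \<Phi>_le)
      also have "\<dots> = U.prob (\<Union>w\<in>W. J w)"
      proof (rule U.finite_measure_finite_Union[symmetric, OF \<open>finite W\<close>])
        show "J ` W \<subseteq> U.events" by (auto simp: J_def)
        have "J v \<inter> J w = {}" if "v < w" "length v = length w" for v w
          using \<Phi>_sep[OF that] by (auto simp: J_def)
        then have "J v \<inter> J w = {}" if "v \<noteq> w" "length v = length w" for v w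
          using that by (metis Int_commute linorder_neqE)
        then show "disjoint_family_on J W"
          by (simp add: disjoint_family_on_def W_def)
      qed
      also have "\<dots> \<le> U.prob (G j)"
        using G_meas by (intro U.finite_measure_mono) (auto simp: G_def W_def)
      finally show ?thesis .
    qed
    then have "1 \<le> U.prob (G j) + \<eta>" if "\<eta> > 0" for \<eta>
      using that by fastforce
    then have "1 \<le> U.prob (G j)"
      by (rule field_le_epsilon)
    then have "U.prob (G j) = 1" using U.prob_le_1[of "G j"] by linarith
    then show ?thesis using G_meas[of j] by (subst (asm) U.prob_eq_1) auto
  qed

  \<comment> \<open>At stage \<open>k\<close> the sort key is the prefix of length \<open>k\<close>.
    A fixed word is shorter than the key from some stage on, and sorting by the key also sorts every
    shorter prefix.\<close>
  have "\<exists>\<sigma>. bij_betw \<sigma> {..<n k} {1..n k} \<and> (\<forall>i j. i \<le> j \<longrightarrow> j < n k \<longrightarrow> wd k (x k (\<sigma> i)) \<le> wd k (x k (\<sigma> j)))" for k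
    by (rule sorted_enumeration_exists)
  then obtain \<sigma> where \<sigma>: "\<And>k. bij_betw (\<sigma> k) {..<n k} {1..n k}"
      "\<And>k i j. i \<le> j \<Longrightarrow> j < n k \<Longrightarrow> wd k (x k (\<sigma> k i)) \<le> wd k (x k (\<sigma> k j))"
    by metis
  define X where "X k t = x k (\<sigma> k (nat \<lfloor>real (n k) * t\<rfloor>))" for k and t :: real
  have X_meas: "X k \<in> borel_measurable borel" for k
    unfolding X_def by measurable
  have wd_X: "wd (length w) (X k t) = w"
    if "length w \<le> k" "0 \<le> t" "t < 1" "F k (False, w) < t" "t < F k (True, w)" for k w t
  proof -
    define m where "m = nat \<lfloor>real (n k) * t\<rfloor>"
    have m: "m < n k"
      using nat_floor_less_iff[OF n[of k] that(2), of "n k"] that(3) n[of k] by (simp add: m_def)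
    have wd_mono: "wd (length w) (x k (\<sigma> k i)) \<le> wd (length w) (x k (\<sigma> k j))" if "i \<le> j" "j < n k" for i j
      using take_mono_list_lexorder[OF \<sigma>(2)[OF that], of "length w"] by (simp add: wd_take[OF \<open>length w \<le> k\<close>, symmetric])
    have "m < C True w k" "\<not> m < C False w k"
      unfolding m_def nat_floor_less_iff[OF n[of k] that(2)]
      using that(4,5) by (simp_all add: F_def)
    moreover have "m < C False w k \<longleftrightarrow> wd (length w) (x k (\<sigma> k m)) < w"
      unfolding C_def using wd_mono
      by (subst sorted_enumeration_less_card_iff[OF \<sigma>(1) _ m, symmetric]) (auto intro: le_less_trans)
    moreover have "m < C True w k \<longleftrightarrow> wd (length w) (x k (\<sigma> k m)) \<le> w"
      unfolding C_def using wd_mono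
      by (subst sorted_enumeration_less_card_iff[OF \<sigma>(1) _ m, symmetric]) (auto intro: order_trans)
    ultimately show ?thesis by (simp add: X_def m_def)
  qed
  define E where "E = {0..<1} \<inter> (\<Inter>j. G j)"
  have E_meas [measurable]: "E \<in> sets borel" using G_meas by (auto simp: E_def)
  have AE_E: "AE t in unit_uniform. t \<in> E"
  proof -
    have "AE t in unit_uniform. t \<in> {0..<1}" by (intro AE_uniform_measureI) auto
    moreover have "AE t in unit_uniform. \<forall>j. t \<in> G j" by (simp add: AE_all_countable AE_G)
    ultimately show ?thesis by eventually_elim (simp add: E_def)
  qed
  have Cauchy_X: "convergent (\<lambda>k. X (r k) t)" if t: "t \<in> E" for t
  proof -
    have close: "\<exists>c. \<forall>\<^sub>F k in sequentially. dist (X (r k) t) (D c) < (1/2)^j" for j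
    proof -
      \<comment> \<open>Digit \<open>j\<close> is the last letter of a word of length
        \<open>Suc j\<close>. The word \<open>w\<close> depends on \<open>t\<close> but not on
        \<open>k\<close>, so from some stage on all positions are near the same dense point
        \<open>D (w ! j)\<close>.\<close>
      obtain w where w: "length w = Suc j" "t \<in> J w" using t by (auto simp: E_def G_def)
      have "\<forall>\<^sub>F k in sequentially. F (r k) (False, w) < t" "\<forall>\<^sub>F k in sequentially. t < F (r k) (True, w)"
        using w(2) by (auto simp: J_def intro: order_tendstoD[OF \<Phi>])
      moreover have "\<forall>\<^sub>F k in sequentially. Suc j \<le> k" by (rule eventually_ge_at_top)
      ultimately have "\<forall>\<^sub>F k in sequentially. dist (X (r k) t) (D (w ! j)) < (1/2)^j"
      proof eventually_elim
        case (elim k)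
        have "Suc j \<le> r k" using elim(3) seq_suble[OF r, of k] by linarith
        then have "wd (Suc j) (X (r k) t) = w"
          using wd_X[of w "r k" t] elim w t by (auto simp: E_def)
        then have "w ! j = dig j (X (r k) t)"
          unfolding wd_def by (metis diff_zero length_upt lessI nth_map nth_upt add_0)
        then show ?case using dig by simp
      qed
      then show ?thesis by blast
    qed
    have "Cauchy (\<lambda>k. X (r k) t)"
    proof (rule metric_CauchyI)
      fix e :: real assume "e > 0"
      then obtain j where j: "(1/2)^j < e / 2"
        using real_arch_pow_inv[of "e / 2" "1 / 2"] by auto
      obtain c N where "\<And>k. k \<ge> N \<Longrightarrow> dist (X (r k) t) (D c) < (1/2)^j"
        using close[of j] by (auto simp: eventually_sequentially)
      then have "dist (X (r k) t) (X (r l) t) < e" if "k \<ge> N" "l \<ge> N" for k l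
        using that j dist_triangle_half_l[of "X (r k) t" "D c" e "X (r l) t"] by fastforce
      then show "\<exists>N. \<forall>k\<ge>N. \<forall>l\<ge>N. dist (X (r k) t) (X (r l) t) < e" by blast
    qed
    then show ?thesis by (rule Cauchy_convergent)
  qed
  \<comment> \<open>Outside \<open>E\<close>, a null event, a constant is used: this keeps the laws
    and makes convergence hold for every \<open>t\<close>.\<close>
  define Y where "Y k t = (if t \<in> E then X (r k) t else D 0)" for k t
  define Z where "Z t = lim (\<lambda>k. Y k t)" for t
  have Y_meas: "Y k \<in> borel_measurable borel" for k
    unfolding Y_def using X_meas by measurable
  have lim: "(\<lambda>k. Y k t) \<longlonglongrightarrow> Z t" for t
    using Cauchy_X[of t] unfolding Z_def Y_def
    by (cases "t \<in> E") (auto simp: convergent_LIMSEQ_iff)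
  show thesis
  proof (rule that[OF r Y_meas _ _ lim])
    show "Z \<in> borel_measurable borel"
      using Y_meas lim by (rule borel_measurable_LIMSEQ_metric)
    show "distr unit_uniform borel (Y k) = empirical_measure (n (r k)) (x (r k))" for k
    proof -
      have "distr unit_uniform borel (Y k) = distr unit_uniform borel (X (r k))"
        using AE_E Y_meas X_meas by (intro distr_cong_AE) (auto simp: Y_def elim: eventually_mono)
      then show ?thesis
        unfolding X_def using distr_unit_uniform_empirical_measure[OF n \<sigma>(1)] by metis
    qed
  qed
qed

section \<open>Lower semicontinuity of the energy\<close>

text \<open>The divisor is \<open>n^2\<close>, not the number \<open>n (n - 1)\<close> of terms:
  this is the integral against the product of empirical measures with the diagonal left out, where
  \<open>Q\<close> may be infinite.\<close>

definition off_diagonal_mean :: "('a \<times> 'a \<Rightarrow> ennreal) \<Rightarrow> nat \<Rightarrow> (nat \<Rightarrow> 'a) \<Rightarrow> ennreal" where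
  "off_diagonal_mean Q n x = (\<Sum>i=1..n. \<Sum>j\<in>{1..n}-{i}. Q (x i, x j)) / of_nat n / of_nat n"

lemma borel_measurable_open_superlevels:
  fixes Q :: "'a::topological_space \<Rightarrow> 'b::{linorder_topology, second_countable_topology}"
  assumes "\<And>c. open {z. c < Q z}"
  shows "Q \<in> borel_measurable borel"
  by (rule borel_measurableI_greater) (use assms in \<open>simp add: borel_open\<close>)

lemma superlevels_open_le_liminf:
  fixes Q :: "'a::topological_space \<Rightarrow> 'b::complete_linorder"
  assumes lsc: "\<And>c. open {z. c < Q z}" and lim: "z \<longlonglongrightarrow> z0"
  shows "Q z0 \<le> liminf (\<lambda>k. Q (z k))"
  unfolding le_Liminf_iff
proof (intro allI impI)
  fix c assume "c < Q z0"
  then show "eventually (\<lambda>k. c < Q (z k)) sequentially"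
    using topological_tendstoD[OF lim lsc[of c]] by simp
qed

lemma nn_integral_pair_distr:
  fixes Y :: "'b \<Rightarrow> 'a::second_countable_topology"
  assumes M: "prob_space M" and Y: "Y \<in> borel_measurable M" and h: "h \<in> borel_measurable borel"
  shows "(\<integral>\<^sup>+z. h z \<partial>(distr M borel Y \<Otimes>\<^sub>M distr M borel Y)) =
    (\<integral>\<^sup>+p. h (Y (fst p), Y (snd p)) \<partial>(M \<Otimes>\<^sub>M M))"
proof -
  interpret D: prob_space "distr M borel Y"
    by (rule prob_space.prob_space_distr[OF M Y])
  have "distr M borel Y \<Otimes>\<^sub>M distr M borel Y = distr (M \<Otimes>\<^sub>M M) (borel \<Otimes>\<^sub>M borel) (\<lambda>(s, t). (Y s, Y t))"
    by (rule pair_measure_distr[OF Y Y]) unfold_locales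
  then show ?thesis
    using h Y by (simp add: nn_integral_distr borel_prod case_prod_beta measurable_pair)
qed

text \<open>The \<open>m\<close> points outside \<open>K\<close> form \<open>m (m - 1)\<close>
  ordered off-diagonal pairs, each costing at least \<open>C\<close>.\<close>

lemma card_outside_le_off_diagonal_mean:
  fixes Q :: "'a \<times> 'a \<Rightarrow> ennreal"
  assumes C: "C \<ge> 0" "\<And>y z. y \<notin> K \<Longrightarrow> z \<notin> K \<Longrightarrow> ennreal C \<le> Q (y, z)"
    and n: "n \<ge> 1" and bdd: "off_diagonal_mean Q n x \<le> ennreal A" and A: "A \<ge> 0"
    and m: "m = card {i\<in>{1..n}. x i \<notin> K}"
  shows "C * m * (real m - 1) \<le> A * n\<^sup>2"
proof -
  define S where "S = {i\<in>{1..n}. x i \<notin> K}"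
  have [simp]: "finite S" by (auto simp: S_def)
  have m_S: "card S = m" by (simp add: m S_def)
  have "ennreal (C * m * (real m - 1)) \<le> ennreal (A * n\<^sup>2)"
  proof (cases "m = 0")
    case False
    have "ennreal (C * m * (real m - 1)) = (\<Sum>i\<in>S. \<Sum>j\<in>S-{i}. ennreal C)"
    proof -
      have "card (S - {i}) = m - 1" if "i \<in> S" for i
        using that by (simp add: m_S)
      then have "(\<Sum>i\<in>S. \<Sum>j\<in>S-{i}. ennreal C) = ennreal (\<Sum>i\<in>S. \<Sum>j\<in>S-{i}. C)"
        using C(1) by (simp add: sum_nonneg del: sum_constant)
      also have "(\<Sum>i\<in>S. \<Sum>j\<in>S-{i}. C) = (\<Sum>i\<in>S. (real m - 1) * C)"
        using \<open>\<And>i. i \<in> S \<Longrightarrow> card (S - {i}) = m - 1\<close> False by (intro sum.cong refl) (simp add: of_nat_diff)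
      also have "\<dots> = C * m * (real m - 1)"
        by (simp add: m_S)
      finally show ?thesis ..
    qed
    also have "\<dots> \<le> (\<Sum>i\<in>S. \<Sum>j\<in>S-{i}. Q (x i, x j))"
      using C(2) by (intro sum_mono) (auto simp: S_def)
    also have "\<dots> \<le> (\<Sum>i\<in>S. \<Sum>j\<in>{1..n}-{i}. Q (x i, x j))"
      by (intro sum_mono sum_mono2) (auto simp: S_def)
    also have "\<dots> \<le> (\<Sum>i=1..n. \<Sum>j\<in>{1..n}-{i}. Q (x i, x j))"
      by (intro sum_mono2) (auto simp: S_def)
    also have "\<dots> = off_diagonal_mean Q n x * of_nat n * of_nat n"
    proof -
      have "a / of_nat n * of_nat n = (a :: ennreal)" for a
        using n ennreal_divide_self[of "of_nat n"]
        by (simp add: divide_ennreal_def mult.assoc mult.commute[of "inverse _"] of_nat_less_top)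
      then show ?thesis by (simp add: off_diagonal_mean_def)
    qed
    also have "\<dots> \<le> ennreal A * of_nat n * of_nat n"
      using bdd by (intro mult_right_mono) auto
    also have "\<dots> = ennreal (A * n\<^sup>2)"
      using A by (simp add: ennreal_of_nat_eq_real_of_nat ennreal_mult[symmetric] power2_eq_square mult.assoc)
    finally show ?thesis .
  qed (use A in simp)
  then show ?thesis using A by (simp add: ennreal_le_iff)
qed

lemma tight_of_bounded_off_diagonal_mean:
  fixes Q :: "'a::topological_space \<times> 'a \<Rightarrow> ennreal"
  assumes infty: "\<And>C::real. \<exists>K. compact K \<and> (\<forall>y\<in>-K. \<forall>z\<in>-K. ennreal C \<le> Q (y, z))"
    and n: "filterlim n at_top sequentially" "\<And>k. n k \<ge> 1"
    and bdd: "\<forall>\<^sub>F k in sequentially. off_diagonal_mean Q (n k) (x k) \<le> ennreal A" and A: "A \<ge> 0"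
    and \<eta>: "\<eta> > (0::real)"
  shows "\<exists>K. compact K \<and> (\<forall>\<^sub>F k in sequentially. (1 - \<eta>) * n k \<le> card {i\<in>{1..n k}. x k i \<in> K})"
proof -
  \<comment> \<open>More than \<open>\<eta> n\<close> points outside, with
    \<open>\<eta> n \<ge> 2\<close>, give \<open>m (m - 1) \<ge> (\<eta> n)^2 / 2\<close>. Times
    \<open>C\<close> this equals \<open>A n^2 + \<eta>^2 n^2 / 2\<close>; the \<open>+ 1\<close>
    makes the contradiction strict.\<close>
  define C where "C = 2 * A / \<eta>\<^sup>2 + 1"
  have C: "C > 0" using A \<eta> by (simp add: C_def add_nonneg_pos)
  obtain K where K: "compact K" "\<And>y z. y \<notin> K \<Longrightarrow> z \<notin> K \<Longrightarrow> ennreal C \<le> Q (y, z)"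
    using infty[of C] by auto
  have "\<forall>\<^sub>F k in sequentially. 2 / \<eta> \<le> real (n k)"
    using filterlim_compose[OF filterlim_real_sequentially n(1)] by (simp add: filterlim_at_top)
  with bdd have "\<forall>\<^sub>F k in sequentially. (1 - \<eta>) * n k \<le> card {i\<in>{1..n k}. x k i \<in> K}"
  proof eventually_elim
    case (elim k)
    define m where "m = card {i\<in>{1..n k}. x k i \<notin> K}"
    have "card {i\<in>{1..n k}. x k i \<in> K} + m = card ({i\<in>{1..n k}. x k i \<in> K} \<union> {i\<in>{1..n k}. x k i \<notin> K})"
      unfolding m_def by (rule card_Un_disjoint[symmetric]) auto
    also have "{i\<in>{1..n k}. x k i \<in> K} \<union> {i\<in>{1..n k}. x k i \<notin> K} = {1..n k}" by auto
    finally have sum: "card {i\<in>{1..n k}. x k i \<in> K} + m = n k" by simp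
    have "m \<le> \<eta> * n k"
    proof (rule ccontr)
      assume "\<not> m \<le> \<eta> * n k"
      then have m: "\<eta> * n k < m" by simp
      have 1: "\<eta> * n k \<ge> 2" using elim(2) \<eta> by (simp add: field_simps)
      have "(\<eta> * n k) * (\<eta> * n k / 2) \<le> m * (real m - 1)"
        using m 1 by (intro mult_mono) auto
      then have "C * ((\<eta> * n k) * (\<eta> * n k / 2)) \<le> C * (m * (real m - 1))"
        using C by (intro mult_left_mono) auto
      also have "\<dots> \<le> A * (real (n k))\<^sup>2"
        using card_outside_le_off_diagonal_mean[OF _ K(2) n(2) elim(1) A m_def] C by (simp add: mult.assoc)
      also have "\<dots> < (A + \<eta>\<^sup>2 / 2) * (real (n k))\<^sup>2"
        using \<eta> n(2)[of k] by (intro mult_strict_right_mono) auto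
      also have "\<dots> = C * ((\<eta> * n k) * (\<eta> * n k / 2))"
        using \<eta> by (simp add: C_def field_simps power2_eq_square)
      finally show False by simp
    qed
    moreover have "real (card {i\<in>{1..n k}. x k i \<in> K}) = n k - real m"
      using sum by linarith
    ultimately show ?case by (simp add: algebra_simps)
  qed
  with K(1) show ?thesis by blast
qed

text \<open>Each of the \<open>n\<close> diagonal terms is at most \<open>m\<close> after
  truncation, hence the error \<open>n m / n^2\<close>.\<close>

lemma pair_mean_truncated_le_off_diagonal_mean:
  fixes Q :: "'a \<times> 'a \<Rightarrow> ennreal"
  assumes n: "n \<ge> 1"
  shows "(\<Sum>i=1..n. \<Sum>j=1..n. min (Q (x i, x j)) (of_nat m)) / of_nat n / of_nat n \<le>
    off_diagonal_mean Q n x + ennreal (m / n)"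
proof -
  have "(\<Sum>i=1..n. \<Sum>j=1..n. min (Q (x i, x j)) (of_nat m)) \<le>
      (\<Sum>i=1..n. (\<Sum>j\<in>{1..n}-{i}. Q (x i, x j)) + of_nat m)"
  proof (intro sum_mono)
    fix i assume i: "i \<in> {1..n}"
    have "(\<Sum>j=1..n. min (Q (x i, x j)) (of_nat m)) =
        (\<Sum>j\<in>{1..n}-{i}. min (Q (x i, x j)) (of_nat m)) + min (Q (x i, x i)) (of_nat m)"
      using i by (subst sum.remove[of _ i]) (auto simp: add.commute)
    also have "\<dots> \<le> (\<Sum>j\<in>{1..n}-{i}. Q (x i, x j)) + of_nat m"
      by (intro add_mono sum_mono) auto
    finally show "(\<Sum>j=1..n. min (Q (x i, x j)) (of_nat m)) \<le> \<dots>" .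
  qed
  also have "\<dots> = (\<Sum>i=1..n. \<Sum>j\<in>{1..n}-{i}. Q (x i, x j)) + of_nat n * of_nat m"
    by (simp add: sum.distrib)
  finally have "(\<Sum>i=1..n. \<Sum>j=1..n. min (Q (x i, x j)) (of_nat m)) / of_nat n / of_nat n \<le>
      ((\<Sum>i=1..n. \<Sum>j\<in>{1..n}-{i}. Q (x i, x j)) + of_nat n * of_nat m) / of_nat n / of_nat n"
    by (intro divide_right_mono_ennreal)
  also have "\<dots> = off_diagonal_mean Q n x + of_nat n * of_nat m / of_nat n / of_nat n"
    by (simp add: off_diagonal_mean_def add_divide_distrib_ennreal)
  also have "of_nat n * of_nat m / of_nat n / of_nat n = ennreal (m / n)"
    using n by (simp add: ennreal_of_nat_eq_real_of_nat ennreal_mult[symmetric] divide_ennreal)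
  finally show ?thesis .
qed

text \<open>With the pointwise convergent representatives of the coupling, lower semicontinuity of
  the energy is Fatou's lemma on the product of two copies of the unit interval. The order of limits
  matters: first \<open>k\<close> at a fixed truncation level \<open>m\<close>, so that the diagonal
  error \<open>m / n\<close> vanishes, then \<open>m\<close> by monotone convergence.\<close>

lemma empirical_measures_energy_compactness:
  fixes Q :: "'a::polish_space \<times> 'a \<Rightarrow> ennreal" and n :: "nat \<Rightarrow> nat"
  assumes lsc: "\<And>c. open {z. c < Q z}"
    and infty: "\<And>C::real. \<exists>K. compact K \<and> (\<forall>y\<in>-K. \<forall>z\<in>-K. ennreal C \<le> Q (y, z))"
    and n: "filterlim n at_top sequentially" "\<And>k. n k \<ge> 1"
    and lim: "(\<lambda>k. off_diagonal_mean Q (n k) (x k)) \<longlonglongrightarrow> ennreal \<rho>" and \<rho>: "\<rho> \<ge> 0"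
  obtains r \<mu> where "strict_mono (r :: nat \<Rightarrow> nat)" "\<mu> \<in> prob_measures"
    "limitin weak_topology (\<lambda>k. empirical_measure (n (r k)) (x (r k))) \<mu> sequentially"
    "(\<integral>\<^sup>+z. Q z \<partial>(\<mu> \<Otimes>\<^sub>M \<mu>)) \<le> ennreal \<rho>"
proof -
  note Q_meas = borel_measurable_open_superlevels[OF lsc]
  have "ennreal \<rho> < ennreal (\<rho> + 1)" using \<rho> by (simp add: ennreal_less_iff)
  then have bdd: "\<forall>\<^sub>F k in sequentially. off_diagonal_mean Q (n k) (x k) \<le> ennreal (\<rho> + 1)"
    by (rule eventually_mono[OF order_tendstoD(2)[OF lim]]) simp
  obtain r Y Z where r: "strict_mono (r :: nat \<Rightarrow> nat)"
    and Y: "\<And>k. Y k \<in> borel_measurable borel" and Z: "Z \<in> borel_measurable borel"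
    and distr_Y: "\<And>k. distr unit_uniform borel (Y k) = empirical_measure (n (r k)) (x (r k))"
    and Y_Z: "\<And>t. (\<lambda>k. Y k t) \<longlonglongrightarrow> Z t"
    using tight_empirical_measures_coupling[where n=n and x=x, OF n(2)
      tight_of_bounded_off_diagonal_mean[where n=n and x=x, OF infty n bdd]] \<rho> by auto
  interpret U: prob_space unit_uniform by (rule prob_space_unit_uniform)
  have YU: "Y k \<in> borel_measurable unit_uniform" for k using Y by (simp add: measurable_unit_uniform)
  have ZU: "Z \<in> borel_measurable unit_uniform" using Z by (simp add: measurable_unit_uniform)
  define \<mu> where "\<mu> = distr unit_uniform borel Z"
  have \<mu>: "\<mu> \<in> prob_measures"
    unfolding \<mu>_def prob_measures_def using U.prob_space_distr[OF ZU] by simp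
  have weak: "limitin weak_topology (\<lambda>k. empirical_measure (n (r k)) (x (r k))) \<mu> sequentially"
  proof (rule limitin_weak_topologyI[OF \<mu>])
    show "\<forall>\<^sub>F k in sequentially. empirical_measure (n (r k)) (x (r k)) \<in> prob_measures"
      by (intro always_eventually allI empirical_measure_in_prob_measures n(2))
    fix g :: "'a \<Rightarrow> real" assume g: "continuous_on UNIV g" "bounded (range g)"
    then have gm: "g \<in> borel_measurable borel" by (intro borel_measurable_continuous_onI)
    obtain B where B: "\<And>y. norm (g y) \<le> B" using g(2) by (auto simp: bounded_iff)
    have "(\<lambda>k. \<integral>t. g (Y k t) \<partial>unit_uniform) \<longlonglongrightarrow> (\<integral>t. g (Z t) \<partial>unit_uniform)"
    proof (rule integral_dominated_convergence[where w="\<lambda>_. B"])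
      show "(\<lambda>t. g (Z t)) \<in> borel_measurable unit_uniform" "\<And>k. (\<lambda>t. g (Y k t)) \<in> borel_measurable unit_uniform"
        using gm YU ZU by simp_all
      show "AE t in unit_uniform. (\<lambda>k. g (Y k t)) \<longlonglongrightarrow> g (Z t)"
        using continuous_on_tendsto_compose[OF g(1) Y_Z] by simp
      show "\<And>k. AE t in unit_uniform. norm (g (Y k t)) \<le> B" using B by simp
    qed (rule U.integrable_const)
    then show "(\<lambda>k. \<integral>y. g y \<partial>empirical_measure (n (r k)) (x (r k))) \<longlonglongrightarrow> (\<integral>y. g y \<partial>\<mu>)"
      unfolding distr_Y[symmetric] \<mu>_def by (simp only: integral_distr[OF YU gm] integral_distr[OF ZU gm])
  qed
  have trunc: "(\<integral>\<^sup>+z. min (Q z) (of_nat m) \<partial>(\<mu> \<Otimes>\<^sub>M \<mu>)) \<le> ennreal \<rho>" for m :: nat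
  proof -
    define h where "h z = min (Q z) (of_nat m)" for z
    have h_meas: "h \<in> borel_measurable borel" unfolding h_def using Q_meas by measurable
    then have hm: "h \<in> borel_measurable (borel \<Otimes>\<^sub>M borel)" by (simp add: borel_prod)
    have h_lsc: "open {z. c < h z}" for c
      using lsc[of c] by (cases "c < of_nat m") (simp_all add: h_def)
    have "(\<integral>\<^sup>+z. h z \<partial>(\<mu> \<Otimes>\<^sub>M \<mu>)) = (\<integral>\<^sup>+p. h (Z (fst p), Z (snd p)) \<partial>(unit_uniform \<Otimes>\<^sub>M unit_uniform))"
      unfolding \<mu>_def by (rule nn_integral_pair_distr[OF prob_space_unit_uniform ZU h_meas])
    also have "\<dots> \<le> (\<integral>\<^sup>+p. liminf (\<lambda>k. h (Y k (fst p), Y k (snd p))) \<partial>(unit_uniform \<Otimes>\<^sub>M unit_uniform))"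
      by (intro nn_integral_mono superlevels_open_le_liminf h_lsc tendsto_Pair Y_Z)
    also have "\<dots> \<le> liminf (\<lambda>k. \<integral>\<^sup>+p. h (Y k (fst p), Y k (snd p)) \<partial>(unit_uniform \<Otimes>\<^sub>M unit_uniform))"
      by (intro nn_integral_liminf measurable_compose[OF _ hm] measurable_Pair
        measurable_compose[OF measurable_fst YU] measurable_compose[OF measurable_snd YU])
    also have "\<dots> = liminf (\<lambda>k. \<integral>\<^sup>+z. h z \<partial>(empirical_measure (n (r k)) (x (r k)) \<Otimes>\<^sub>M empirical_measure (n (r k)) (x (r k))))"
      unfolding distr_Y[symmetric] by (simp only: nn_integral_pair_distr[OF prob_space_unit_uniform YU h_meas])
    also have "\<dots> \<le> liminf (\<lambda>k. off_diagonal_mean Q (n (r k)) (x (r k)) + ennreal (m / n (r k)))"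
      unfolding nn_integral_pair_empirical_measure[OF n(2) h_meas]
      by (intro Liminf_mono always_eventually allI)
        (unfold h_def, rule pair_mean_truncated_le_off_diagonal_mean[OF n(2)])
    also have "\<dots> = ennreal \<rho>"
    proof (rule lim_imp_Liminf)
      have nr: "filterlim (\<lambda>k. n (r k)) at_top sequentially"
        using filterlim_compose[OF n(1) filterlim_subseq[OF r]] .
      have "(\<lambda>k. m / real (n (r k))) \<longlonglongrightarrow> 0"
        by (rule real_tendsto_divide_at_top[OF tendsto_const filterlim_compose[OF filterlim_real_sequentially nr]])
      then have "(\<lambda>k. ennreal (m / n (r k))) \<longlonglongrightarrow> ennreal 0" by (rule tendsto_ennrealI)
      from tendsto_add[OF LIMSEQ_subseq_LIMSEQ[OF lim r] this]
      show "(\<lambda>k. off_diagonal_mean Q (n (r k)) (x (r k)) + ennreal (m / n (r k))) \<longlonglongrightarrow> ennreal \<rho>"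
        by (simp add: o_def)
    qed simp
    finally show ?thesis by (simp add: h_def)
  qed
  have "(\<integral>\<^sup>+z. Q z \<partial>(\<mu> \<Otimes>\<^sub>M \<mu>)) = (\<integral>\<^sup>+z. (SUP m. min (Q z) (of_nat m)) \<partial>(\<mu> \<Otimes>\<^sub>M \<mu>))"
    by (intro nn_integral_cong) (simp add: inf_min[symmetric] inf_SUP[symmetric] ennreal_SUP_of_nat_eq_top)
  also have "\<dots> = (SUP m. \<integral>\<^sup>+z. min (Q z) (of_nat m) \<partial>(\<mu> \<Otimes>\<^sub>M \<mu>))"
  proof (rule nn_integral_monotone_convergence_SUP)
    show "incseq (\<lambda>m z. min (Q z) (of_nat m))"
      by (auto simp: incseq_def le_fun_def intro!: min.coboundedI2)
    have "sets (\<mu> \<Otimes>\<^sub>M \<mu>) = sets borel"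
      by (simp add: \<mu>_def borel_prod[symmetric] cong: sets_pair_measure_cong)
    note cong = measurable_cong_sets[OF this refl]
    show "(\<lambda>z. min (Q z) (of_nat m)) \<in> borel_measurable (\<mu> \<Otimes>\<^sub>M \<mu>)" for m
      unfolding cong using Q_meas by measurable
  qed
  also have "\<dots> \<le> ennreal \<rho>" by (intro SUP_least trunc)
  finally show thesis using that[OF r \<mu> weak] by blast
qed

section \<open>Integrals, sums and truncated measures\<close>

lemma exp_ereal_infinity [simp]: "exp_ereal \<infinity> = \<infinity>" "exp_ereal (-\<infinity>) = 0"
  using exp_ereal.simps(2,3) by simp_all

lemma exp_ereal_eq:
  "exp_ereal x = (if x = \<infinity> then \<infinity> else if x = -\<infinity> then 0 else ennreal (exp (real_of_ereal x)))"
  by (cases x) auto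

lemma borel_measurable_exp_ereal [measurable]: "exp_ereal \<in> borel_measurable borel"
  unfolding exp_ereal_eq[abs_def] by measurable

lemma ln_ennreal_mono: "a \<le> b \<Longrightarrow> ln_ennreal a \<le> ln_ennreal b"
  by (cases a; cases b) (auto simp: ln_ennreal_def ennreal_eq_0_iff not_le top_unique)

lemma ln_ennreal_ennreal: "0 < y \<Longrightarrow> ln_ennreal (ennreal y) = ereal (ln y)"
  by (simp add: ln_ennreal_def)

text \<open>Pointwise, \<open>g + B\<close> plus the negative part of \<open>g\<close> equals the
  positive part plus \<open>B\<close>. The negative part is at most \<open>B\<close>, so its
  integral is finite and can be subtracted.\<close>

lemma ereal_integral_eq_shifted:
  assumes M: "prob_space M" and g[measurable]: "g \<in> borel_measurable M"
    and B: "0 \<le> B" "\<And>x. ereal (- B) \<le> g x"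
  shows "ereal_integral M g = enn2ereal (\<integral>\<^sup>+x. e2ennreal (g x + ereal B) \<partial>M) - ereal B"
proof -
  interpret prob_space M by fact
  define p where "p = (\<integral>\<^sup>+x. e2ennreal (g x) \<partial>M)"
  define m where "m = (\<integral>\<^sup>+x. e2ennreal (- g x) \<partial>M)"
  define q where "q = (\<integral>\<^sup>+x. e2ennreal (g x + ereal B) \<partial>M)"
  have pw: "e2ennreal (g x + ereal B) + e2ennreal (- g x) = e2ennreal (g x) + ennreal B" for x
  proof (cases "g x")
    case (real r)
    then have "- B \<le> r" using B(2)[of x] by simp
    then show ?thesis
      using B(1) real by (cases "r \<ge> 0") (simp_all add: ennreal_plus[symmetric] ennreal_neg del: ennreal_plus)
  qed (use B(2)[of x] in \<open>auto simp: e2ennreal_infty\<close>)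
  have "q + m = (\<integral>\<^sup>+x. e2ennreal (g x + ereal B) + e2ennreal (- g x) \<partial>M)"
    unfolding q_def m_def by (rule nn_integral_add[symmetric]) measurable
  also have "\<dots> = p + ennreal B"
    unfolding pw p_def by (subst nn_integral_add) (auto simp: emeasure_space_1)
  finally have sum: "q + m = p + ennreal B" .
  have "m \<le> (\<integral>\<^sup>+x. ennreal B \<partial>M)"
    unfolding m_def
  proof (rule nn_integral_mono)
    fix x
    have "- g x \<le> ereal B" using B(2)[of x] by (cases "g x") auto
    then have "e2ennreal (- g x) \<le> e2ennreal (ereal B)" by (rule e2ennreal_mono)
    then show "e2ennreal (- g x) \<le> ennreal B" by simp
  qed
  also have "\<dots> = ennreal B" by (simp add: emeasure_space_1)
  finally obtain m' where m': "m = ennreal m'" "0 \<le> m'"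
    by (cases m) (auto simp: top_unique)
  have "enn2ereal p - enn2ereal m = enn2ereal q - ereal B"
  proof (cases p)
    case (real p')
    then obtain q' where q': "q = ennreal q'" "0 \<le> q'"
      using sum B(1) m' by (cases q) (auto simp: ennreal_plus[symmetric] simp del: ennreal_plus)
    then have "q' + m' = p' + B"
      using sum real m' B(1) by (simp add: ennreal_plus[symmetric] del: ennreal_plus)
    then show ?thesis using real q' m' by (simp add: enn2ereal_ennreal algebra_simps)
  next
    case top
    then have "q = top" using sum m' by (cases q) (auto simp: ennreal_plus[symmetric] simp del: ennreal_plus)
    then show ?thesis using top m' by (simp add: enn2ereal_ennreal)
  qed
  then show ?thesis by (simp add: ereal_integral_def p_def m_def q_def)
qed

text \<open>Jensen's inequality through the tangent of \<open>exp\<close> at \<open>- a\<close>. The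
  linear term is moved to the larger side, so the pointwise bound contains only nonnegative terms
  and also holds where \<open>X\<close> is infinite.\<close>

lemma exp_neg_nn_integral_le:
  assumes M: "prob_space M" and [measurable]: "X \<in> borel_measurable M"
    and a: "(\<integral>\<^sup>+x. X x \<partial>M) = ennreal a" "0 \<le> a"
  shows "ennreal (exp (- a)) \<le> (\<integral>\<^sup>+x. exp_ereal (- enn2ereal (X x)) \<partial>M)"
proof -
  interpret prob_space M by fact
  have pw: "ennreal (exp (- a) * (1 + a)) \<le> exp_ereal (- enn2ereal (X x)) + ennreal (exp (- a)) * X x" for x
  proof (cases "X x")
    case (real r)
    have "exp (- a) * (1 + a - r) \<le> exp (- a) * exp (a - r)"
      using exp_ge_add_one_self[of "a - r"] by (intro mult_left_mono) (linarith, simp)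
    then have "exp (- a) * (1 + a) \<le> exp (- r) + exp (- a) * r"
      by (simp add: exp_add[symmetric] algebra_simps)
    then show ?thesis
      using real by (simp add: enn2ereal_ennreal ennreal_mult[symmetric] ennreal_plus[symmetric] del: ennreal_plus)
  next
    case top
    then show ?thesis by (simp add: ennreal_mult_top)
  qed
  have "ennreal (exp (- a) * (1 + a)) = (\<integral>\<^sup>+x. ennreal (exp (- a) * (1 + a)) \<partial>M)"
    by (simp add: emeasure_space_1)
  also have "\<dots> \<le> (\<integral>\<^sup>+x. exp_ereal (- enn2ereal (X x)) + ennreal (exp (- a)) * X x \<partial>M)"
    by (intro nn_integral_mono pw)
  also have "\<dots> = (\<integral>\<^sup>+x. exp_ereal (- enn2ereal (X x)) \<partial>M) + ennreal (exp (- a)) * ennreal a"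
    by (subst nn_integral_add) (auto simp: nn_integral_cmult a)
  finally have le: "ennreal (exp (- a) * (1 + a)) \<le>
      (\<integral>\<^sup>+x. exp_ereal (- enn2ereal (X x)) \<partial>M) + ennreal (exp (- a)) * ennreal a" .
  have eq: "ennreal (exp (- a) * (1 + a)) = ennreal (exp (- a)) + ennreal (exp (- a) * a)"
    using a(2) by (subst ennreal_plus[symmetric]) (auto simp: algebra_simps)
  have eq': "ennreal (exp (- a)) * ennreal a = ennreal (exp (- a) * a)"
    using a(2) by (intro ennreal_mult[symmetric]) auto
  from le have "ennreal (exp (- a)) + ennreal (exp (- a) * a) \<le>
      (\<integral>\<^sup>+x. exp_ereal (- enn2ereal (X x)) \<partial>M) + ennreal (exp (- a) * a)"
    unfolding eq eq' .
  then have "ennreal (exp (- a) * a) = \<infinity> \<or>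
      ennreal (exp (- a)) \<le> (\<integral>\<^sup>+x. exp_ereal (- enn2ereal (X x)) \<partial>M)"
    by (simp only: add.commute[of _ "ennreal (exp (- a) * a)"] ennreal_add_left_cancel_le)
  then show ?thesis by (simp only: infinity_ennreal_def ennreal_neq_top simp_thms)
qed

text \<open>The deviation from \<open>f \<mu>\<close> is at most \<open>e / 2\<close> on the sets
  supplied by the law of large numbers and at most \<open>2 * F\<close> off them; a single
  integrable bound with an indicator covers both.\<close>

lemma expectation_empirical_measure_tendsto:
  fixes f :: "'a::second_countable_topology measure \<Rightarrow> real"
  assumes \<mu>: "\<mu> \<in> prob_measures"
    and f: "continuous_map weak_topology euclideanreal f"
    and bdd: "\<And>\<nu>. \<nu> \<in> prob_measures \<Longrightarrow> \<bar>f \<nu>\<bar> \<le> F"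
  shows "(\<lambda>n. \<integral>x. f (empirical_measure n x) \<partial>(\<Pi>\<^sub>M i\<in>{1..n}. \<mu>)) \<longlonglongrightarrow> f \<mu>"
proof (rule metric_LIMSEQ_I)
  fix e :: real assume e: "e > 0"
  have F: "F \<ge> 0" using bdd[OF \<mu>] by linarith
  define U where "U = {\<nu> \<in> topspace weak_topology. f \<nu> \<in> ball (f \<mu>) (e / 2)}"
  have U: "openin weak_topology U"
    unfolding U_def using f by (rule openin_continuous_map_preimage) simp
  have \<mu>_U: "\<mu> \<in> U" using e \<mu> by (simp add: U_def topspace_weak_topology)
  obtain A where A: "\<And>n. n \<ge> 1 \<Longrightarrow> A n \<in> sets (\<Pi>\<^sub>M i\<in>{1..n}. \<mu>)"
      "\<And>n x. n \<ge> 1 \<Longrightarrow> x \<in> A n \<Longrightarrow> empirical_measure n x \<in> U"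
    and lim: "(\<lambda>n. measure (\<Pi>\<^sub>M i\<in>{1..n}. \<mu>) (A n)) \<longlonglongrightarrow> 1"
    using empirical_measure_tendsto_in_probability[OF \<mu> U \<mu>_U] by blast
  have "(\<lambda>n. 2 * F * (1 - measure (\<Pi>\<^sub>M i\<in>{1..n}. \<mu>) (A n))) \<longlonglongrightarrow> 2 * F * (1 - 1)"
    by (intro tendsto_intros lim)
  then have "\<forall>\<^sub>F n in sequentially. 2 * F * (1 - measure (\<Pi>\<^sub>M i\<in>{1..n}. \<mu>) (A n)) < e / 2"
    by (rule order_tendstoD) (use e in simp)
  with eventually_ge_at_top[of 1]
  have "\<forall>\<^sub>F n in sequentially. dist (\<integral>x. f (empirical_measure n x) \<partial>(\<Pi>\<^sub>M i\<in>{1..n}. \<mu>)) (f \<mu>) < e"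
  proof eventually_elim
    case (elim n)
    note n = elim(1)
    define PP where "PP = (\<Pi>\<^sub>M i\<in>{1..n}. \<mu>)"
    interpret P: prob_space PP unfolding PP_def by (intro prob_space_PiM prob_measuresD \<mu>)
    note meas = measurable_compose_empirical_measure[OF f n prob_measuresD(1)[OF \<mu>], folded PP_def]
    note [measurable] = meas A(1)[OF n, folded PP_def]
    have fb: "\<bar>f (empirical_measure n x)\<bar> \<le> F" for x
      using bdd empirical_measure_in_prob_measures[OF n] by blast
    have int: "integrable PP (\<lambda>x. f (empirical_measure n x))"
      using fb by (intro P.integrable_const_bound[of _ F] meas) simp
    have ind: "integrable PP (\<lambda>x. e / 2 + 2 * F * (1 - indicator (A n) x))"
    proof (rule P.integrable_const_bound[of _ "e / 2 + 2 * F"])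
      show "AE x in PP. norm (e / 2 + 2 * F * (1 - indicator (A n) x)) \<le> e / 2 + 2 * F"
        using e F by (intro always_eventually allI) (auto simp: indicator_def)
    qed measurable
    have "\<bar>(\<integral>x. f (empirical_measure n x) \<partial>PP) - f \<mu>\<bar> =
        \<bar>\<integral>x. f (empirical_measure n x) - f \<mu> \<partial>PP\<bar>"
      using int by (subst Bochner_Integration.integral_diff) (simp_all add: P.prob_space)
    also have "\<dots> \<le> (\<integral>x. \<bar>f (empirical_measure n x) - f \<mu>\<bar> \<partial>PP)"
      by (rule integral_abs_bound)
    also have "\<dots> \<le> (\<integral>x. e / 2 + 2 * F * (1 - indicator (A n) x) \<partial>PP)"
    proof (intro integral_mono ind)
      show "integrable PP (\<lambda>x. \<bar>f (empirical_measure n x) - f \<mu>\<bar>)"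
        using int by (intro integrable_abs Bochner_Integration.integrable_diff) auto
      fix x
      show "\<bar>f (empirical_measure n x) - f \<mu>\<bar> \<le> e / 2 + 2 * F * (1 - indicator (A n) x)"
      proof (cases "x \<in> A n")
        case True
        then show ?thesis using A(2)[OF n True] by (simp add: U_def dist_real_def abs_minus_commute)
      next
        case False
        then show ?thesis using fb[of x] bdd[OF \<mu>] e by (simp add: abs_le_iff)
      qed
    qed
    also have "\<dots> = e / 2 + 2 * F * (1 - P.prob (A n))"
    proof -
      have "integrable PP (indicator (A n) :: _ \<Rightarrow> real)"
        by (rule P.integrable_const_bound[of _ 1]) auto
      then show ?thesis by (simp add: P.prob_space)
    qed
    finally show ?case using elim(2)[folded PP_def] by (simp add: dist_real_def PP_def)
  qed
  then show "\<exists>N. \<forall>n\<ge>N. dist (\<integral>x. f (empirical_measure n x) \<partial>(\<Pi>\<^sub>M i\<in>{1..n}. \<mu>)) (f \<mu>) < e"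
    by (simp add: eventually_sequentially)
qed

section \<open>Sums over pairs of indices\<close>

lemma sum_off_diagonal_eq_twice_sum_upper:
  fixes h :: "nat \<Rightarrow> nat \<Rightarrow> 'b::comm_monoid_add"
  assumes sym: "\<And>i j. h i j = h j i"
  shows "(\<Sum>i=1..n. \<Sum>j\<in>{1..n}-{i}. h i j) = (\<Sum>j=1..n. \<Sum>i=1..<j. h i j) + (\<Sum>j=1..n. \<Sum>i=1..<j. h i j)"
proof (induction n)
  case (Suc n)
  have "(\<Sum>j\<in>{1..Suc n}-{i}. h i j) = (\<Sum>j\<in>{1..n}-{i}. h i j) + h i (Suc n)" if "i \<in> {1..n}" for i
  proof -
    have "{1..Suc n} - {i} = insert (Suc n) ({1..n} - {i})" using that by auto
    then show ?thesis by (simp add: add.commute)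
  qed
  moreover have "{1..Suc n} - {Suc n} = {1..n}" "{1..<Suc n} = {1..n}" by auto
  ultimately have "(\<Sum>i=1..Suc n. \<Sum>j\<in>{1..Suc n}-{i}. h i j) =
      (\<Sum>i=1..n. \<Sum>j\<in>{1..n}-{i}. h i j) + (\<Sum>i=1..n. h i (Suc n)) + (\<Sum>j=1..n. h j (Suc n))"
    by (simp add: sum.distrib sym[of "Suc n"])
  then show ?case
    unfolding Suc.IH using \<open>{1..<Suc n} = {1..n}\<close> by (simp add: ac_simps)
qed simp

text \<open>Each index belongs to \<open>n - 1\<close> pairs.\<close>

lemma sum_upper_add_eq:
  fixes v :: "nat \<Rightarrow> real"
  shows "(\<Sum>j=1..n. \<Sum>i=1..<j. v i + v j) = (real n - 1) * (\<Sum>i=1..n. v i)"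
proof (induction n)
  case (Suc n)
  have "{1..<Suc n} = {1..n}" by auto
  with Suc show ?case by (simp add: sum.distrib algebra_simps)
qed simp

lemma sum_upper_const:
  "(\<Sum>j=1..n. \<Sum>i=1..<j. c) = real n * (real n - 1) / 2 * (c :: real)"
proof (induction n)
  case (Suc n)
  then show ?case by (simp add: field_simps)
qed simp

section \<open>Conditioning a probability measure on large sets\<close>

lemma uniform_measure_in_prob_measures:
  assumes \<mu>: "\<mu> \<in> prob_measures" and "measure \<mu> A > 0"
  shows "uniform_measure \<mu> A \<in> prob_measures"
proof -
  interpret prob_space \<mu> using \<mu> by (rule prob_measuresD)
  have "prob_space (uniform_measure \<mu> A)"
    using assms(2) by (intro prob_space_uniform_measure) (auto simp: measure_def)
  then show ?thesis by (simp add: prob_measures_def prob_measuresD(1)[OF \<mu>])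
qed

text \<open>Dominated convergence, applied to \<open>g\<close> times the indicator and, with
  \<open>g = 1\<close>, to the normalising mass. In the application \<open>A m\<close> is the set
  where a density is at most \<open>m\<close>, and \<open>N\<close> the set where it is
  finite.\<close>

lemma limitin_uniform_measure:
  fixes \<mu> :: "'a::topological_space measure"
  assumes \<mu>: "\<mu> \<in> prob_measures" and A: "\<And>m. A m \<in> sets \<mu>"
    and lim: "\<And>x. x \<in> N \<Longrightarrow> \<forall>\<^sub>F m in sequentially. x \<in> A m" and N: "AE x in \<mu>. x \<in> N"
  shows "(\<lambda>m. measure \<mu> (A m)) \<longlonglongrightarrow> 1"
    and "limitin weak_topology (\<lambda>m. uniform_measure \<mu> (A m)) \<mu> sequentially"
proof -
  interpret prob_space \<mu> using \<mu> by (rule prob_measuresD)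
  have conv: "(\<lambda>m. \<integral>x. g x * indicator (A m) x \<partial>\<mu>) \<longlonglongrightarrow> (\<integral>x. g x \<partial>\<mu>)"
    if [measurable]: "g \<in> borel_measurable \<mu>" and "bounded (range g)" for g :: "'a \<Rightarrow> real"
  proof -
    obtain K where K: "\<And>x. norm (g x) \<le> K" using \<open>bounded (range g)\<close> by (auto simp: bounded_iff)
    note [measurable] = A
    show ?thesis
    proof (rule integral_dominated_convergence[where w="\<lambda>_. K"])
      show "AE x in \<mu>. (\<lambda>m. g x * indicator (A m) x) \<longlonglongrightarrow> g x"
        using N
      proof eventually_elim
        case (elim x)
        show ?case
          by (rule tendsto_eventually) (use lim[OF elim] in eventually_elim, simp)
      qed
      show "AE x in \<mu>. norm (g x * indicator (A m) x) \<le> K" for m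
        using K order_trans[OF norm_ge_zero K] by (auto simp: indicator_def)
    qed auto
  qed
  show p: "(\<lambda>m. measure \<mu> (A m)) \<longlonglongrightarrow> 1"
    using conv[of "\<lambda>_. 1"] A by (simp add: prob_space)
  have pos: "\<forall>\<^sub>F m in sequentially. 0 < measure \<mu> (A m)"
    by (rule order_tendstoD(1)[OF p]) simp
  show "limitin weak_topology (\<lambda>m. uniform_measure \<mu> (A m)) \<mu> sequentially"
  proof (rule limitin_weak_topologyI[OF \<mu>])
    show "\<forall>\<^sub>F m in sequentially. uniform_measure \<mu> (A m) \<in> prob_measures"
      using pos by eventually_elim (rule uniform_measure_in_prob_measures[OF \<mu>])
    fix g :: "'a \<Rightarrow> real" assume g: "continuous_on UNIV g" "bounded (range g)"
    have [measurable]: "g \<in> borel_measurable \<mu>"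
      using borel_measurable_continuous_onI[OF g(1)] by (simp add: measurable_cong_sets[OF prob_measuresD(1)[OF \<mu>] refl])
    note [measurable] = A
    have "(\<lambda>m. (\<integral>x. g x * indicator (A m) x \<partial>\<mu>) / measure \<mu> (A m)) \<longlonglongrightarrow> (\<integral>x. g x \<partial>\<mu>) / 1"
      using g by (intro tendsto_divide conv p) auto
    moreover have "\<forall>\<^sub>F m in sequentially. (\<integral>x. g x * indicator (A m) x \<partial>\<mu>) / measure \<mu> (A m) =
        (\<integral>x. g x \<partial>uniform_measure \<mu> (A m))"
      using pos
    proof eventually_elim
      case (elim m)
      have "uniform_measure \<mu> (A m) = density \<mu> (\<lambda>x. ennreal (indicator (A m) x / measure \<mu> (A m)))"
        unfolding uniform_measure_def emeasure_eq_measure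
        using elim by (intro density_cong AE_I2) (auto simp: indicator_def divide_ennreal[of 1, simplified])
      then have "(\<integral>x. g x \<partial>uniform_measure \<mu> (A m)) = (\<integral>x. (indicator (A m) x / measure \<mu> (A m)) *\<^sub>R g x \<partial>\<mu>)"
        by (simp only:) (rule integral_density, auto)
      then show ?case by (simp add: mult.commute)
    qed
    ultimately show "(\<lambda>m. \<integral>x. g x \<partial>uniform_measure \<mu> (A m)) \<longlonglongrightarrow> (\<integral>x. g x \<partial>\<mu>)"
      by (auto intro: Lim_transform_eventually)
  qed
qed

text \<open>Dropping the indicator of \<open>A\<close> only enlarges the integral; each of the two
  variables contributes one normalising factor.\<close>

lemma nn_integral_pair_uniform_measure_le:
  assumes M: "prob_space M" and A: "A \<in> sets M" and p: "measure M A > 0"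
    and [measurable]: "h \<in> borel_measurable (M \<Otimes>\<^sub>M M)"
  shows "(\<integral>\<^sup>+z. h z \<partial>(uniform_measure M A \<Otimes>\<^sub>M uniform_measure M A)) \<le>
    (\<integral>\<^sup>+z. h z \<partial>(M \<Otimes>\<^sub>M M)) / ennreal (measure M A) / ennreal (measure M A)"
proof -
  interpret prob_space M by fact
  let ?U = "uniform_measure M A"
  interpret U: prob_space ?U
    using p by (intro prob_space_uniform_measure) (auto simp: measure_def)
  note [measurable] = A
  have le: "(\<integral>\<^sup>+x. g x \<partial>?U) \<le> (\<integral>\<^sup>+x. g x \<partial>M) / ennreal (measure M A)" if g: "g \<in> borel_measurable M" for g
  proof -
    have "(\<integral>\<^sup>+x. g x \<partial>?U) = (\<integral>\<^sup>+x. g x * indicator A x \<partial>M) / emeasure M A"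
      using g A by (rule nn_integral_uniform_measure)
    also have "\<dots> \<le> (\<integral>\<^sup>+x. g x \<partial>M) / emeasure M A"
      by (intro divide_right_mono_ennreal nn_integral_mono) (auto simp: indicator_def)
    finally show ?thesis by (simp add: emeasure_eq_measure)
  qed
  have "(\<integral>\<^sup>+z. h z \<partial>(?U \<Otimes>\<^sub>M ?U)) = (\<integral>\<^sup>+x. (\<integral>\<^sup>+y. h (x, y) \<partial>?U) \<partial>?U)"
  proof (rule U.nn_integral_fst[symmetric])
    have "sets (?U \<Otimes>\<^sub>M ?U) = sets (M \<Otimes>\<^sub>M M)" by (intro sets_pair_measure_cong) simp_all
    from measurable_cong_sets[OF this refl] show "h \<in> borel_measurable (?U \<Otimes>\<^sub>M ?U)" by simp
  qed
  also have "\<dots> \<le> (\<integral>\<^sup>+x. (\<integral>\<^sup>+y. h (x, y) \<partial>M) / ennreal (measure M A) \<partial>?U)"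
    by (intro nn_integral_mono le) (simp add: measurable_compose[OF measurable_Pair1'])
  also have "\<dots> \<le> (\<integral>\<^sup>+x. (\<integral>\<^sup>+y. h (x, y) \<partial>M) / ennreal (measure M A) \<partial>M) / ennreal (measure M A)"
    by (intro le) measurable
  also have "(\<integral>\<^sup>+x. (\<integral>\<^sup>+y. h (x, y) \<partial>M) / ennreal (measure M A) \<partial>M) =
      (\<integral>\<^sup>+z. h z \<partial>(M \<Otimes>\<^sub>M M)) / ennreal (measure M A)"
    by (subst nn_integral_divide) (simp_all add: nn_integral_fst)
  finally show ?thesis .
qed

section \<open>Energies bounded from below\<close>

lemma lower_semicontinuous_add:
  fixes f g :: "'a::topological_space \<Rightarrow> ereal"
  assumes f: "lower_semicontinuous f" "\<And>x. -\<infinity> < f x" and g: "lower_semicontinuous g" "\<And>x. -\<infinity> < g x"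
  shows "lower_semicontinuous (\<lambda>x. f x + g x)"
  unfolding lower_semicontinuous_def
proof
  fix c :: ereal
  show "open {x. c < f x + g x}"
  proof (cases c)
    case (real c')
    have "\<exists>r. ereal r < f x \<and> ereal (c' - r) < g x" if less: "ereal c' < f x + g x" for x
    proof (cases "g x")
      case g_real: (real t)
      show ?thesis
      proof (cases "f x")
        case (real s)
        then show ?thesis
          \<comment> \<open>The surplus \<open>s + t - c'\<close> is shared equally between the two
            summands.\<close>
          using less g_real by (intro exI[of _ "s - (s + t - c') / 2"]) (simp add: field_simps)
      next
        case PInf
        then show ?thesis using g_real by (intro exI[of _ "c' - t + 1"]) simp
      qed (use f(2)[of x] in simp)
    next
      case PInf
      obtain s where "ereal s < f x" using f(2)[of x] by (metis ereal_dense2)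
      then show ?thesis using PInf by auto
    qed (use g(2)[of x] in simp)
    moreover have "ereal c' < f x + g x" if "ereal r < f x" "ereal (c' - r) < g x" for x r
      using that by (cases "f x"; cases "g x") auto
    ultimately have eq: "{x. c < f x + g x} = (\<Union>r. {x. ereal r < f x} \<inter> {x. ereal (c' - r) < g x})"
      unfolding real by blast
    show ?thesis
      unfolding eq using f(1) g(1)
      by (intro open_UN ballI open_Int) (simp_all add: lower_semicontinuous_def)
  next
    case MInf
    have "-\<infinity> < f x + g x" for x using f(2)[of x] g(2)[of x] by (cases "f x"; cases "g x") auto
    then show ?thesis using MInf by simp
  qed simp
qed

lemma lower_semicontinuous_compose:
  assumes "lower_semicontinuous f" "continuous_on UNIV h"
  shows "lower_semicontinuous (\<lambda>x. f (h x))"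
  using assms open_vimage[of "{y. _ < f y}" h] by (simp add: lower_semicontinuous_def vimage_def)

lemma less_e2ennreal_iff: "c < e2ennreal y \<longleftrightarrow> enn2ereal c < y"
proof (cases "0 \<le> y")
  case True
  then show ?thesis by (simp add: less_ennreal.rep_eq enn2ereal_e2ennreal)
next
  case False
  then have "e2ennreal y = 0" by (simp add: e2ennreal_neg)
  then show ?thesis using False enn2ereal_nonneg[of c] by (auto simp del: enn2ereal_nonneg)
qed

text \<open>The constants whose existence the theorem assumes are fixed, the lower bounds written as
  \<open>- B\<close>, \<open>- b\<close>, \<open>- c\<close> with nonnegative \<open>B\<close>,
  \<open>b\<close>, \<open>c\<close>. Condition (5) is left out: it enters only in
  \<open>log_partition_function_tendsto\<close>.\<close>

locale interacting_gas =
  fixes l :: "'a::polish_space measure" and V :: "'a \<Rightarrow> ereal" and G :: "'a \<times> 'a \<Rightarrow> ereal"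
    and B b c \<epsilon> \<xi> :: real
  assumes sets_l: "sets l = sets borel"
    and G_range: "\<And>x y. -\<infinity> < G (x, y)"
    and V_lsc: "lower_semicontinuous V"
    and G_lsc: "lower_semicontinuous G"
    and G_sym: "\<And>x y. G (x, y) = G (y, x)"
    and B: "0 \<le> B" "\<And>x y. ereal (- B) \<le> G (x, y) + V x + V y"
    and b: "0 \<le> b" "\<And>x. ereal (- b) \<le> V x"
    and c: "0 \<le> c" "\<And>x y. ereal (- c) \<le> G (x, y) + ereal \<epsilon> * V x + ereal \<epsilon> * V y"
    and \<epsilon>: "0 \<le> \<epsilon>" "\<epsilon> < 1"
    and \<xi>: "\<xi> > 0" "(\<integral>\<^sup>+x. exp_ereal (- ereal \<xi> * V x) \<partial>l) < \<infinity>"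
    and confining: "\<And>C::real. \<exists>K. compact K \<and> (\<forall>x\<in>-K. \<forall>y\<in>-K. ereal C \<le> G (x, y) + V x + V y)"
begin

text \<open>The shift by \<open>B\<close> makes the pair energy nonnegative, so
  \<open>e2ennreal\<close> loses nothing; in exchange the energy becomes \<open>(q - B) / 2\<close>,
  with \<open>q\<close> the integral of \<open>Q\<close>.\<close>

definition Q :: "'a \<times> 'a \<Rightarrow> ennreal" where
  "Q z = e2ennreal (pair_energy G V z + ereal B)"

definition v :: "'a \<Rightarrow> ennreal" where
  "v x = e2ennreal (V x + ereal b)"

definition partition_function :: "('a measure \<Rightarrow> real) \<Rightarrow> real \<Rightarrow> nat \<Rightarrow> ennreal" where
  "partition_function f \<beta> n =
    (\<integral>\<^sup>+x. exp_ereal (ereal (- (real n * \<beta> * f (empirical_measure n x)))) \<partial>gibbs_measure l G V \<beta> n)"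

lemma V_range: "-\<infinity> < V x"
  using b(2)[of x] by (cases "V x") auto

lemma pair_energy_lsc: "lower_semicontinuous (pair_energy G V)"
proof -
  have "lower_semicontinuous (\<lambda>z. G z + V (fst z) + V (snd z))"
  proof (intro lower_semicontinuous_add)
    show "lower_semicontinuous (\<lambda>z :: 'a \<times> 'a. V (fst z))" "lower_semicontinuous (\<lambda>z :: 'a \<times> 'a. V (snd z))"
      by (intro lower_semicontinuous_compose[OF V_lsc] continuous_intros)+
    show "-\<infinity> < G z" for z using G_range by (cases z) simp
    then show "-\<infinity> < G z + V (fst z)" for z
      using V_range[of "fst z"] by (cases "G z"; cases "V (fst z)") (auto dest: meta_spec[of _ z])
  qed (rule G_lsc V_range)+
  moreover have "pair_energy G V = (\<lambda>z. G z + V (fst z) + V (snd z))"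
    by (auto simp: fun_eq_iff pair_energy_def)
  ultimately show ?thesis by simp
qed

lemma Q_lsc: "open {z. t < Q z}"
proof -
  have "s < p + ereal B \<longleftrightarrow> s - ereal B < p" for s p
    by (cases p rule: ereal_cases; cases s rule: ereal_cases) (simp_all add: algebra_simps less_diff_eq)
  then have "{z. t < Q z} = {z. enn2ereal t - ereal B < pair_energy G V z}"
    by (simp only: Q_def less_e2ennreal_iff)
  then show ?thesis using pair_energy_lsc by (simp add: lower_semicontinuous_def)
qed

lemma Q_confining: "\<exists>K. compact K \<and> (\<forall>y\<in>-K. \<forall>z\<in>-K. ennreal C \<le> Q (y, z))"
proof -
  obtain K where K: "compact K" "\<And>y z. y \<in> -K \<Longrightarrow> z \<in> -K \<Longrightarrow> ereal C \<le> G (y, z) + V y + V z"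
    using confining[of C] by auto
  have "ennreal C \<le> Q (y, z)" if "y \<in> -K" "z \<in> -K" for y z
  proof -
    have "ereal C + ereal 0 \<le> pair_energy G V (y, z) + ereal B"
      using K(2)[OF that] B(1) by (intro add_mono) (auto simp: pair_energy_def)
    then have "e2ennreal (ereal C) \<le> Q (y, z)"
      unfolding Q_def by (intro e2ennreal_mono) simp
    then show ?thesis by simp
  qed
  with K(1) show ?thesis by blast
qed

lemma V_meas [measurable]: "V \<in> borel_measurable borel"
  by (rule borel_measurable_open_superlevels) (use V_lsc in \<open>simp add: lower_semicontinuous_def\<close>)

lemma G_meas [measurable]: "G \<in> borel_measurable (borel \<Otimes>\<^sub>M borel)"
  unfolding borel_prod
  by (rule borel_measurable_open_superlevels) (use G_lsc in \<open>simp add: lower_semicontinuous_def\<close>)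

lemma V_meas_l [measurable]: "V \<in> borel_measurable l"
  using V_meas by (simp add: measurable_cong_sets[OF sets_l refl])

lemma pair_energy_meas [measurable]: "pair_energy G V \<in> borel_measurable (borel \<Otimes>\<^sub>M borel)"
  unfolding pair_energy_def by measurable

lemma Q_meas [measurable]: "Q \<in> borel_measurable (borel \<Otimes>\<^sub>M borel)"
  unfolding Q_def by measurable

lemma v_meas [measurable]: "v \<in> borel_measurable borel"
  unfolding v_def by measurable

lemma sets_pair_prob:
  assumes "\<mu> \<in> prob_measures"
  shows "sets (\<mu> \<Otimes>\<^sub>M \<mu>) = sets (borel \<Otimes>\<^sub>M (borel :: 'a measure))"
  using prob_measuresD(1)[OF assms] by (intro sets_pair_measure_cong)

lemma Q_meas_pair: "\<mu> \<in> prob_measures \<Longrightarrow> Q \<in> borel_measurable (\<mu> \<Otimes>\<^sub>M \<mu>)"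
  using Q_meas by (simp add: measurable_cong_sets[OF sets_pair_prob refl])

lemma macroscopic_energy_eq:
  assumes \<mu>: "\<mu> \<in> prob_measures"
  shows "macroscopic_energy G V \<mu> = ereal (1/2) * (enn2ereal (\<integral>\<^sup>+z. Q z \<partial>(\<mu> \<Otimes>\<^sub>M \<mu>)) - ereal B)"
proof -
  interpret prob_space \<mu> using \<mu> by (rule prob_measuresD)
  interpret pair_prob_space \<mu> \<mu> ..
  show ?thesis
    unfolding macroscopic_energy_def Q_def
  proof (subst ereal_integral_eq_shifted)
    show "prob_space (\<mu> \<Otimes>\<^sub>M \<mu>)" by unfold_locales
    show "pair_energy G V \<in> borel_measurable (\<mu> \<Otimes>\<^sub>M \<mu>)"
      using pair_energy_meas by (simp add: measurable_cong_sets[OF sets_pair_prob[OF \<mu>] refl])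
    show "ereal (- B) \<le> pair_energy G V z" for z
      using B(2) by (cases z) (simp add: pair_energy_def)
  qed (simp_all add: B)
qed

lemma macroscopic_energy_finiteE:
  assumes \<mu>: "\<mu> \<in> prob_measures" and fin: "macroscopic_energy G V \<mu> < \<infinity>"
  obtains q where "(\<integral>\<^sup>+z. Q z \<partial>(\<mu> \<Otimes>\<^sub>M \<mu>)) = ennreal q" "0 \<le> q"
    "macroscopic_energy G V \<mu> = ereal ((q - B) / 2)"
proof (cases "\<integral>\<^sup>+z. Q z \<partial>(\<mu> \<Otimes>\<^sub>M \<mu>)")
  case (real q)
  then show ?thesis
    by (intro that[of q]) (simp_all add: macroscopic_energy_eq[OF \<mu>] enn2ereal_ennreal)
next
  case top
  then show ?thesis using fin by (simp add: macroscopic_energy_eq[OF \<mu>])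
qed

text \<open>The pair energy minus the expression bounded below by \<open>- c\<close> is
  \<open>(1 - \<epsilon>) (V x + V y)\<close>. One \<open>b\<close> pays for the shift in
  \<open>v x\<close>, the other for \<open>V y \<ge> - b\<close>; here
  \<open>1 - \<epsilon> \<le> 1\<close> and \<open>B \<ge> 0\<close> are used.\<close>

lemma v_le_Q: "ennreal (1 - \<epsilon>) * v x \<le> Q (x, y) + ennreal (c + 2 * b)"
proof (cases "V x = \<infinity> \<or> V y = \<infinity> \<or> G (x, y) = \<infinity>")
  case True
  then have "pair_energy G V (x, y) = \<infinity>"
    using V_range[of x] V_range[of y] G_range[of x y] by (auto simp: pair_energy_def)
  then show ?thesis by (simp add: Q_def e2ennreal_infty)
next
  case False
  then obtain vx vy g where r: "V x = ereal vx" "V y = ereal vy" "G (x, y) = ereal g"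
    using V_range[of x] V_range[of y] G_range[of x y]
    by (cases "V x"; cases "V y"; cases "G (x, y)") auto
  have h: "- b \<le> vx" "- b \<le> vy" "- c \<le> g + \<epsilon> * vx + \<epsilon> * vy" "- B \<le> g + vx + vy"
    using b(2)[of x] b(2)[of y] c(2)[of x y] B(2)[of x y] r by auto
  have "(1 - \<epsilon>) * (vy + b) \<ge> 0" using h \<epsilon> by simp
  then have "(1 - \<epsilon>) * (vx + b) \<le> (g + vx + vy + B) + (c + 2 * b)"
    using h B(1) mult_nonneg_nonneg[OF \<epsilon>(1) b(1)] by (simp add: algebra_simps)
  then show ?thesis
    using r h \<epsilon> c(1) b(1) by (simp add: v_def Q_def pair_energy_def ennreal_mult[symmetric]
      ennreal_plus[symmetric] del: ennreal_plus)
qed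

text \<open>Integrating \<open>v_le_Q\<close> over both variables. Finite energy thus gives the
  leftover sum of \<open>V\<close> a finite mean and makes \<open>V\<close> finite almost
  everywhere, which the lower bound and \<open>density_exists\<close> require.\<close>

lemma nn_integral_v_finite:
  assumes \<mu>: "\<mu> \<in> prob_measures" and q: "(\<integral>\<^sup>+z. Q z \<partial>(\<mu> \<Otimes>\<^sub>M \<mu>)) = ennreal q"
  obtains w where "(\<integral>\<^sup>+x. v x \<partial>\<mu>) = ennreal w" "0 \<le> w"
proof -
  interpret prob_space \<mu> using \<mu> by (rule prob_measuresD)
  interpret pair_prob_space \<mu> \<mu> ..
  note [measurable] = Q_meas_pair[OF \<mu>]
  have v\<mu> [measurable]: "v \<in> borel_measurable \<mu>"
    using v_meas by (simp add: measurable_cong_sets[OF prob_measuresD(1)[OF \<mu>] refl])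
  have "ennreal (1 - \<epsilon>) * (\<integral>\<^sup>+x. v x \<partial>\<mu>) = (\<integral>\<^sup>+x. (\<integral>\<^sup>+y. ennreal (1 - \<epsilon>) * v x \<partial>\<mu>) \<partial>\<mu>)"
    by (simp add: nn_integral_cmult prob_space.emeasure_space_1[OF prob_measuresD(2)[OF \<mu>]])
  also have "\<dots> \<le> (\<integral>\<^sup>+x. (\<integral>\<^sup>+y. Q (x, y) + ennreal (c + 2 * b) \<partial>\<mu>) \<partial>\<mu>)"
    by (intro nn_integral_mono v_le_Q)
  also have "\<dots> = (\<integral>\<^sup>+z. Q z + ennreal (c + 2 * b) \<partial>(\<mu> \<Otimes>\<^sub>M \<mu>))"
    by (rule sigma_finite_measure.nn_integral_fst[OF
      prob_space_imp_sigma_finite[OF prob_measuresD(2)[OF \<mu>]]]) measurable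
  also have "\<dots> = ennreal q + ennreal (c + 2 * b)"
    using P.emeasure_space_1 by (subst nn_integral_add) (simp_all add: q)
  also have "\<dots> < \<infinity>" by simp
  finally have "(\<integral>\<^sup>+x. v x \<partial>\<mu>) < \<infinity>"
    using \<epsilon> by (auto simp: ennreal_mult_less_top)
  then show thesis by (cases "\<integral>\<^sup>+x. v x \<partial>\<mu>") (auto intro: that)
qed

end

section \<open>Bounds for the Boltzmann weight\<close>

context interacting_gas
begin

text \<open>Only pairs with \<open>i < j\<close> enter, so \<open>G\<close> may be infinite on the
  diagonal.\<close>

definition finite_configuration :: "nat \<Rightarrow> (nat \<Rightarrow> 'a) \<Rightarrow> bool" where
  "finite_configuration n x \<longleftrightarrow>
    (\<forall>i\<in>{1..n}. V (x i) \<noteq> \<infinity>) \<and> (\<forall>j\<in>{1..n}. \<forall>i\<in>{1..<j}. G (x i, x j) \<noteq> \<infinity>)"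

text \<open>\<open>real_of_ereal\<close> turns infinite values into \<open>0\<close>, so this sum
  and the two after it have their intended meaning on finite configurations.\<close>

definition potential_sum :: "nat \<Rightarrow> (nat \<Rightarrow> 'a) \<Rightarrow> real" where
  "potential_sum n x = (\<Sum>i=1..n. real_of_ereal (V (x i)))"

definition interaction_sum :: "nat \<Rightarrow> (nat \<Rightarrow> 'a) \<Rightarrow> real" where
  "interaction_sum n x = (\<Sum>j=1..n. \<Sum>i=1..<j. real_of_ereal (G (x i, x j)))"

definition pair_sum :: "nat \<Rightarrow> (nat \<Rightarrow> 'a) \<Rightarrow> real" where
  "pair_sum n x = (\<Sum>j=1..n. \<Sum>i=1..<j. real_of_ereal (pair_energy G V (x i, x j)))"

lemma hamiltonian_infinite:
  assumes "n \<ge> 1" "\<not> finite_configuration n x"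
  shows "hamiltonian G V n x = \<infinity>"
proof -
  have "(\<Sum>i=1..n. V (x i)) = \<infinity> \<or> (\<Sum>j=1..n. \<Sum>i=1..<j. G (x i, x j)) = \<infinity>"
    using assms(2) unfolding finite_configuration_def sum_Pinfty by fastforce
  then show ?thesis using assms(1) by (auto simp: hamiltonian_def)
qed

context
  fixes n :: nat and x :: "nat \<Rightarrow> 'a"
  assumes fin: "finite_configuration n x"
begin

lemma V_real: "i \<in> {1..n} \<Longrightarrow> V (x i) = ereal (real_of_ereal (V (x i)))"
  using fin V_range[of "x i"] by (cases "V (x i)") (auto simp: finite_configuration_def)

lemma G_real: "j \<in> {1..n} \<Longrightarrow> i \<in> {1..<j} \<Longrightarrow> G (x i, x j) = ereal (real_of_ereal (G (x i, x j)))"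
  using fin G_range[of "x i" "x j"] by (cases "G (x i, x j)") (auto simp: finite_configuration_def)

lemma pair_energy_real:
  assumes "j \<in> {1..n}" "i \<in> {1..<j}"
  shows "pair_energy G V (x i, x j) =
    ereal (real_of_ereal (G (x i, x j)) + real_of_ereal (V (x i)) + real_of_ereal (V (x j)))"
proof -
  have "i \<in> {1..n}" using assms by auto
  from G_real[OF assms] V_real[OF this] V_real[OF assms(1)] show ?thesis
    unfolding pair_energy_def by (metis (no_types, lifting) case_prod_conv plus_ereal.simps(1))
qed

lemma hamiltonian_finite: "hamiltonian G V n x = ereal (interaction_sum n x + n * potential_sum n x)"
proof -
  have "(\<Sum>j=1..n. \<Sum>i=1..<j. G (x i, x j)) = (\<Sum>j=1..n. \<Sum>i=1..<j. ereal (real_of_ereal (G (x i, x j))))"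
    using G_real by (intro sum.cong refl)
  moreover have "(\<Sum>i=1..n. V (x i)) = (\<Sum>i=1..n. ereal (real_of_ereal (V (x i))))"
    using V_real by (intro sum.cong refl)
  ultimately show ?thesis
    by (simp only: hamiltonian_def interaction_sum_def potential_sum_def sum_ereal times_ereal.simps plus_ereal.simps)
qed

text \<open>Together with \<open>hamiltonian_finite\<close> this gives the Hamiltonian as
  \<open>pair_sum + potential_sum\<close>: the main part is of order \<open>n^2\<close>, and a
  single sum of \<open>V\<close> is left over.\<close>

lemma pair_sum_eq: "pair_sum n x = interaction_sum n x + (real n - 1) * potential_sum n x"
proof -
  have "pair_sum n x = (\<Sum>j=1..n. \<Sum>i=1..<j. real_of_ereal (G (x i, x j)) +
      (real_of_ereal (V (x i)) + real_of_ereal (V (x j))))"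
    unfolding pair_sum_def by (intro sum.cong refl) (simp add: pair_energy_real)
  also have "\<dots> = interaction_sum n x + (real n - 1) * potential_sum n x"
    by (simp only: sum.distrib[of _ "\<lambda>_. _ + _"] sum.distrib interaction_sum_def potential_sum_def
      sum_upper_add_eq[symmetric])
  finally show ?thesis .
qed

lemma potential_sum_ge: "- b * n \<le> potential_sum n x"
proof -
  have "- b \<le> real_of_ereal (V (x i))" if "i \<in> {1..n}" for i
    using b(2)[of "x i"] V_real[OF that] by (metis ereal_less_eq(3))
  then have "(\<Sum>i=1..n. - b) \<le> potential_sum n x"
    unfolding potential_sum_def by (rule sum_mono)
  then show ?thesis by (simp add: mult.commute)
qed

lemma pair_sum_ge: "- (B * (real n * (real n - 1) / 2)) \<le> pair_sum n x"
proof -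
  have "- B \<le> real_of_ereal (pair_energy G V (x i, x j))" if "j \<in> {1..n}" "i \<in> {1..<j}" for i j
  proof -
    have "ereal (- B) \<le> pair_energy G V (x i, x j)" using B(2) by (simp add: pair_energy_def)
    then show ?thesis unfolding pair_energy_real[OF that] by simp
  qed
  then have "(\<Sum>j=1..n. \<Sum>i=1..<j. - B) \<le> pair_sum n x"
    unfolding pair_sum_def by (intro sum_mono)
  then show ?thesis unfolding sum_upper_const by (simp add: mult.commute)
qed

lemma interaction_sum_ge:
  "- (c * (real n * (real n - 1) / 2)) \<le> interaction_sum n x + \<epsilon> * ((real n - 1) * potential_sum n x)"
proof -
  have "- c \<le> real_of_ereal (G (x i, x j)) + (\<epsilon> * real_of_ereal (V (x i)) + \<epsilon> * real_of_ereal (V (x j)))"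
    if j: "j \<in> {1..n}" and i: "i \<in> {1..<j}" for i j
  proof -
    have i': "i \<in> {1..n}" using i j by auto
    have "ereal (- c) \<le> ereal (real_of_ereal (G (x i, x j))) + ereal \<epsilon> * ereal (real_of_ereal (V (x i))) +
        ereal \<epsilon> * ereal (real_of_ereal (V (x j)))"
      using c(2)[of "x i" "x j"] G_real[OF j i] V_real[OF i'] V_real[OF j] by simp
    then show ?thesis by simp
  qed
  then have "(\<Sum>j=1..n. \<Sum>i=1..<j. - c) \<le> (\<Sum>j=1..n. \<Sum>i=1..<j. real_of_ereal (G (x i, x j)) +
      (\<epsilon> * real_of_ereal (V (x i)) + \<epsilon> * real_of_ereal (V (x j))))"
    by (intro sum_mono)
  also have "\<dots> = interaction_sum n x + (real n - 1) * (\<Sum>i=1..n. \<epsilon> * real_of_ereal (V (x i)))"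
    by (simp only: sum.distrib[of _ "\<lambda>_. _ + _"] sum.distrib interaction_sum_def sum_upper_add_eq[symmetric])
  also have "(\<Sum>i=1..n. \<epsilon> * real_of_ereal (V (x i))) = \<epsilon> * potential_sum n x"
    by (simp add: potential_sum_def sum_distrib_left)
  finally show ?thesis
    unfolding sum_upper_const
    by (simp only: mult.commute[of _ "- c"] mult_minus_left mult.left_commute[of "real n - 1" \<epsilon>])
qed

lemma sum_Q_upper:
  "(\<Sum>j=1..n. \<Sum>i=1..<j. Q (x i, x j)) = ennreal (pair_sum n x + B * (real n * (real n - 1) / 2))"
proof -
  have "Q (x i, x j) = ennreal (real_of_ereal (pair_energy G V (x i, x j)) + B)"
    "0 \<le> real_of_ereal (pair_energy G V (x i, x j)) + B" if "j \<in> {1..n}" "i \<in> {1..<j}" for i j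
  proof -
    have "ereal (- B) \<le> pair_energy G V (x i, x j)" using B(2) by (simp add: pair_energy_def)
    then show "0 \<le> real_of_ereal (pair_energy G V (x i, x j)) + B"
      unfolding pair_energy_real[OF that] by simp
    show "Q (x i, x j) = ennreal (real_of_ereal (pair_energy G V (x i, x j)) + B)"
      unfolding Q_def pair_energy_real[OF that] by simp
  qed
  note Q_eq = this
  have "(\<Sum>j=1..n. \<Sum>i=1..<j. Q (x i, x j)) =
      (\<Sum>j=1..n. \<Sum>i=1..<j. ennreal (real_of_ereal (pair_energy G V (x i, x j)) + B))"
    by (intro sum.cong refl Q_eq)
  also have "\<dots> = (\<Sum>j=1..n. ennreal (\<Sum>i=1..<j. real_of_ereal (pair_energy G V (x i, x j)) + B))"
    by (intro sum.cong refl sum_ennreal Q_eq)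
  also have "\<dots> = ennreal (\<Sum>j=1..n. \<Sum>i=1..<j. real_of_ereal (pair_energy G V (x i, x j)) + B)"
    by (intro sum_ennreal sum_nonneg Q_eq)
  finally have "(\<Sum>j=1..n. \<Sum>i=1..<j. Q (x i, x j)) =
      ennreal (\<Sum>j=1..n. \<Sum>i=1..<j. real_of_ereal (pair_energy G V (x i, x j)) + B)" .
  then show ?thesis
    by (simp only: sum.distrib pair_sum_def sum_upper_const mult.commute[of _ B])
qed

lemma off_diagonal_mean_Q:
  assumes n: "n \<ge> 1"
  shows "off_diagonal_mean Q n x = ennreal ((2 * pair_sum n x + B * (real n * (real n - 1))) / n\<^sup>2)"
proof -
  have "Q (x i, x j) = Q (x j, x i)" for i j
    using G_sym by (simp add: Q_def pair_energy_def add.assoc add.commute[of "V (x i)"])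
  then have "(\<Sum>i=1..n. \<Sum>j\<in>{1..n}-{i}. Q (x i, x j)) =
      (\<Sum>j=1..n. \<Sum>i=1..<j. Q (x i, x j)) + (\<Sum>j=1..n. \<Sum>i=1..<j. Q (x i, x j))"
    by (rule sum_off_diagonal_eq_twice_sum_upper)
  also have "\<dots> = ennreal (2 * pair_sum n x + B * (real n * (real n - 1)))"
    using pair_sum_ge unfolding sum_Q_upper
    by (subst ennreal_plus[symmetric]) (auto simp: algebra_simps)
  finally show ?thesis
    using n pair_sum_ge by (simp add: off_diagonal_mean_def ennreal_of_nat_eq_real_of_nat divide_ennreal
      power2_eq_square)
qed

lemma sum_v: "(\<Sum>i=1..n. v (x i)) = ennreal (potential_sum n x + b * n)"
proof -
  have "v (x i) = ennreal (real_of_ereal (V (x i)) + b)" "0 \<le> real_of_ereal (V (x i)) + b" if "i \<in> {1..n}" for i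
  proof -
    show "v (x i) = ennreal (real_of_ereal (V (x i)) + b)"
      unfolding v_def by (subst V_real[OF that]) simp
    have "ereal (- b) \<le> ereal (real_of_ereal (V (x i)))" using b(2)[of "x i"] V_real[OF that] by simp
    then show "0 \<le> real_of_ereal (V (x i)) + b" by simp
  qed
  note v_eq = this
  have "(\<Sum>i=1..n. v (x i)) = (\<Sum>i=1..n. ennreal (real_of_ereal (V (x i)) + b))"
    by (intro sum.cong refl v_eq)
  also have "\<dots> = ennreal (\<Sum>i=1..n. real_of_ereal (V (x i)) + b)"
    by (intro sum_ennreal v_eq)
  finally have "(\<Sum>i=1..n. v (x i)) = ennreal (\<Sum>i=1..n. real_of_ereal (V (x i)) + b)" .
  then show ?thesis by (simp add: sum.distrib potential_sum_def mult.commute)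
qed

text \<open>The term \<open>\<delta> n \<Sum>V\<close> taken out of the energy to integrate against the possibly infinite measure is
  absorbed by condition (3): \<open>(1 - \<epsilon>) (n - 1) \<Sum>V\<close> is the difference of the pair sum and the quantity
  bounded below in \<open>interaction_sum_ge\<close>.\<close>

lemma reduced_energy_ge:
  fixes \<delta> :: real
  assumes n: "n \<ge> 2" and \<delta>: "\<delta> \<ge> 0" and \<theta>: "\<theta> = 2 * \<delta> / (1 - \<epsilon>)" "\<theta> \<le> 1"
    and \<rho>: "off_diagonal_mean Q n x = ennreal \<rho>" "\<rho> \<ge> 0"
  shows "(real n)\<^sup>2 * ((1 - \<theta>) * \<rho> / 2 - B / 2 - b / n - \<theta> * (c + B) / 2) \<le>
    interaction_sum n x + n * potential_sum n x - \<delta> * n * potential_sum n x"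
proof -
  define T S \<Gamma> N where "T = pair_sum n x" and "S = potential_sum n x" and "\<Gamma> = interaction_sum n x" and "N = real n"
  define M where "M = N * (N - 1)"
  have N: "N \<ge> 2" using n by (simp add: N_def)
  have \<theta>0: "0 \<le> \<theta>" using \<theta>(1) \<delta> \<epsilon> by simp
  have T: "T = \<Gamma> + (N - 1) * S" using pair_sum_eq by (simp add: T_def \<Gamma>_def S_def N_def)
  have S: "- b * N \<le> S" using potential_sum_ge by (simp add: S_def N_def)
  have T1: "- (B * (M / 2)) \<le> T" using pair_sum_ge by (simp add: T_def N_def M_def)
  have G1: "- (c * (M / 2)) \<le> \<Gamma> + \<epsilon> * ((N - 1) * S)"
    using interaction_sum_ge by (simp add: \<Gamma>_def S_def N_def M_def)
  have "0 \<le> 2 * T + B * M" using T1 by simp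
  then have \<rho>_eq: "N\<^sup>2 * \<rho> = 2 * T + B * M"
    using off_diagonal_mean_Q \<rho> n N by (simp add: T_def N_def M_def)
  have NN: "M \<le> N\<^sup>2" "0 \<le> M" using N by (auto simp: M_def power2_eq_square algebra_simps)
  \<comment> \<open>\<open>Y\<close> bounds \<open>(1 - \<epsilon>) (N - 1) S\<close> from above.
    Its part with \<open>B\<close> makes it nonnegative, so that it can be multiplied by upper
    bounds; \<open>N^2\<close> replaces \<open>M\<close> for simplicity.\<close>
  define Y where "Y = T + (c + B) * N\<^sup>2 / 2"
  have cN: "c * M \<le> c * N\<^sup>2" and BN: "B * M \<le> B * N\<^sup>2"
    using c(1) B(1) NN by (auto intro: mult_left_mono)
  have cN0: "0 \<le> c * N\<^sup>2" and BN0: "0 \<le> B * N\<^sup>2" using c(1) B(1) by auto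
  have Y_eq: "Y = T + c * N\<^sup>2 / 2 + B * N\<^sup>2 / 2" by (simp add: Y_def field_simps)
  have T2: "- (B * M / 2) \<le> T" using T1 by simp
  have G2: "- (c * M / 2) \<le> \<Gamma> + \<epsilon> * ((N - 1) * S)" using G1 by simp
  have Y0: "0 \<le> Y" using T2 BN cN0 unfolding Y_eq by linarith
  have "(1 - \<epsilon>) * ((N - 1) * S) = T - (\<Gamma> + \<epsilon> * ((N - 1) * S))" by (simp add: T algebra_simps)
  also have "\<dots> \<le> Y" using G2 cN BN0 unfolding Y_eq by linarith
  finally have "(N - 1) * S \<le> Y / (1 - \<epsilon>)" using \<epsilon> by (simp add: pos_le_divide_eq mult.commute)
  then have "\<delta> * N / (N - 1) * ((N - 1) * S) \<le> \<delta> * N / (N - 1) * (Y / (1 - \<epsilon>))"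
    using \<delta> N by (intro mult_left_mono) auto
  also have "\<dots> \<le> \<delta> * 2 * (Y / (1 - \<epsilon>))"
  proof (intro mult_right_mono)
    \<comment> \<open>The estimate that trades \<open>N\<close> copies of \<open>S\<close> for
      \<open>N - 1\<close>; it is the origin of the factor \<open>2\<close> in
      \<open>\<theta>\<close> and of the condition \<open>n \<ge> 2\<close>.\<close>
    have "N / (N - 1) \<le> 2" using N by (simp add: field_simps)
    from mult_left_mono[OF this \<delta>] show "\<delta> * N / (N - 1) \<le> \<delta> * 2" by simp
  qed (use Y0 \<epsilon> in auto)
  also have "\<dots> = \<theta> * Y" by (simp add: \<theta>(1))
  finally have dS: "\<delta> * N * S \<le> \<theta> * Y" using N by simp
  have "(1 - \<theta>) * (B * M) \<le> 1 * (B * N\<^sup>2)"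
    using BN \<theta>(2) \<theta>0 B(1) NN by (intro mult_mono) auto
  then have "(1 - \<theta>) * (N\<^sup>2 * \<rho>) / 2 - B * N\<^sup>2 / 2 \<le> (1 - \<theta>) * T"
  proof -
    have "(1 - \<theta>) * (N\<^sup>2 * \<rho>) = 2 * ((1 - \<theta>) * T) + (1 - \<theta>) * (B * M)"
      unfolding \<rho>_eq by (simp add: algebra_simps)
    with \<open>(1 - \<theta>) * (B * M) \<le> 1 * (B * N\<^sup>2)\<close> show ?thesis by linarith
  qed
  \<comment> \<open>\<open>T + S\<close> is the Hamiltonian. Of its leftover \<open>S\<close> only
    \<open>S \<ge> - b N\<close> is used, which becomes the error \<open>b / n\<close>.\<close>
  moreover have "T + S - \<delta> * N * S \<ge> (1 - \<theta>) * T - b * N - \<theta> * ((c + B) * N\<^sup>2 / 2)"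
    using dS S by (simp add: Y_def algebra_simps)
  ultimately have "(1 - \<theta>) * (N\<^sup>2 * \<rho>) / 2 - B * N\<^sup>2 / 2 - b * N - \<theta> * ((c + B) * N\<^sup>2 / 2) \<le>
      \<Gamma> + N * S - \<delta> * N * S"
    by (simp add: T algebra_simps)
  moreover have "N\<^sup>2 * ((1 - \<theta>) * \<rho> / 2 - B / 2 - b / N - \<theta> * (c + B) / 2) =
      (1 - \<theta>) * (N\<^sup>2 * \<rho>) / 2 - B * N\<^sup>2 / 2 - b * N - \<theta> * ((c + B) * N\<^sup>2 / 2)"
    using N by (simp add: field_simps power2_eq_square)
  ultimately show ?thesis by (simp add: N_def \<Gamma>_def S_def)
qed

end

text \<open>\<open>reduced_energy_ge\<close> with \<open>\<delta> = \<xi> / \<beta>\<close>: after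
  multiplication by \<open>\<beta> / n\<close> the removed term is exactly \<open>\<xi>\<close>
  times the sum of \<open>V\<close>, the exponent of the integrable product. On configurations of
  infinite energy the weight is \<open>0\<close>.\<close>

lemma boltzmann_weight_le:
  assumes n: "n \<ge> 2" and \<beta>: "\<beta> > 0" and \<theta>: "\<theta> = 2 * (\<xi> / \<beta>) / (1 - \<epsilon>)" "\<theta> \<le> 1"
    and low: "\<And>\<rho>. \<rho> \<ge> 0 \<Longrightarrow> off_diagonal_mean Q n x = ennreal \<rho> \<Longrightarrow>
      t + (B / 2 + b / n + \<theta> * (c + B) / 2) \<le> \<phi> + (1 - \<theta>) * \<rho> / 2"
  shows "exp_ereal (- ereal (\<beta> / real n) * hamiltonian G V n x) * exp_ereal (ereal (- (real n * \<beta> * \<phi>))) \<le>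
    ennreal (exp (- (real n * \<beta> * t))) * (\<Prod>i=1..n. exp_ereal (- ereal \<xi> * V (x i)))"
proof (cases "finite_configuration n x")
  case False
  then have "hamiltonian G V n x = \<infinity>" using n by (intro hamiltonian_infinite) auto
  moreover have "- ereal (\<beta> / real n) * \<infinity> = -\<infinity>" using n \<beta> by (auto simp: divide_less_0_iff)
  ultimately show ?thesis by simp
next
  case True
  define \<rho> where "\<rho> = (2 * pair_sum n x + B * (real n * (real n - 1))) / n\<^sup>2"
  have \<rho>: "off_diagonal_mean Q n x = ennreal \<rho>" "\<rho> \<ge> 0"
    using off_diagonal_mean_Q[OF True] pair_sum_ge[OF True] n by (auto simp: \<rho>_def)
  define S \<Gamma> where "S = potential_sum n x" and "\<Gamma> = interaction_sum n x"
  have "(real n)\<^sup>2 * (t - \<phi>) \<le> (real n)\<^sup>2 * ((1 - \<theta>) * \<rho> / 2 - B / 2 - b / n - \<theta> * (c + B) / 2)"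
    using low[OF \<rho>(2,1)] by (intro mult_left_mono) auto
  also have "\<dots> \<le> \<Gamma> + n * S - \<xi> / \<beta> * n * S"
    unfolding \<Gamma>_def S_def using \<xi>(1) \<beta> by (intro reduced_energy_ge[OF True n _ \<theta> \<rho>]) simp
  finally have "\<beta> / n * ((real n)\<^sup>2 * (t - \<phi>)) \<le> \<beta> / n * (\<Gamma> + n * S - \<xi> / \<beta> * n * S)"
    using \<beta> n by (intro mult_left_mono) auto
  moreover have "\<beta> / n * ((real n)\<^sup>2 * (t - \<phi>)) = n * \<beta> * t - n * \<beta> * \<phi>"
    using n by (simp add: field_simps power2_eq_square)
  moreover have "\<beta> / n * (\<Gamma> + n * S - \<xi> / \<beta> * n * S) = \<beta> / n * (\<Gamma> + n * S) - \<xi> * S"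
    using n \<beta> by (simp add: field_simps)
  ultimately have le: "- (\<beta> / n * (\<Gamma> + n * S)) - n * \<beta> * \<phi> \<le> - (n * \<beta> * t) - \<xi> * S" by linarith
  have "exp_ereal (- ereal (\<beta> / real n) * hamiltonian G V n x) = ennreal (exp (- (\<beta> / n * (\<Gamma> + n * S))))"
    unfolding hamiltonian_finite[OF True] \<Gamma>_def S_def by simp
  moreover have "(\<Prod>i=1..n. exp_ereal (- ereal \<xi> * V (x i))) = ennreal (exp (- \<xi> * S))"
  proof -
    have "(\<Prod>i=1..n. exp_ereal (- ereal \<xi> * V (x i))) = (\<Prod>i=1..n. ennreal (exp (- \<xi> * real_of_ereal (V (x i)))))"
      by (intro prod.cong refl, subst V_real[OF True]) auto
    also have "\<dots> = ennreal (exp (\<Sum>i=1..n. - \<xi> * real_of_ereal (V (x i))))"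
      by (simp only: exp_sum[OF finite_atLeastAtMost] prod_ennreal[OF exp_ge_zero])
    also have "(\<Sum>i=1..n. - \<xi> * real_of_ereal (V (x i))) = - \<xi> * S"
      by (simp only: S_def potential_sum_def sum_distrib_left)
    finally show ?thesis .
  qed
  ultimately show ?thesis
    using le by (simp add: ennreal_mult[symmetric] exp_add[symmetric])
qed

text \<open>The shifts by \<open>F\<close>, \<open>B\<close> and \<open>b\<close> make every term of
  the exponent nonnegative, so that it fits the \<open>ennreal\<close> form of Jensen's inequality;
  the leading factor undoes them. On finite configurations both sides agree, elsewhere the left side
  is \<open>0\<close>.\<close>

lemma boltzmann_weight_ge:
  fixes x :: "nat \<Rightarrow> 'a"
  assumes n: "n \<ge> 1" and \<beta>: "\<beta> > 0" and F: "0 \<le> \<phi> + F"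
  shows "ennreal (exp (n * \<beta> * F + \<beta> / n * (B * (real n * (real n - 1) / 2) + b * n))) *
      exp_ereal (- enn2ereal (ennreal (n * \<beta> * (\<phi> + F)) +
        ennreal (\<beta> / n) * ((\<Sum>j=1..n. \<Sum>i=1..<j. Q (x i, x j)) + (\<Sum>i=1..n. v (x i)))))
    \<le> exp_ereal (- ereal (\<beta> / real n) * hamiltonian G V n x) * exp_ereal (ereal (- (real n * \<beta> * \<phi>)))"
proof (cases "finite_configuration n x")
  case True
  define T S where "T = pair_sum n x" and "S = potential_sum n x"
  have T: "0 \<le> T + B * (real n * (real n - 1) / 2)" using pair_sum_ge[OF True] by (simp add: T_def)
  have S: "0 \<le> S + b * n" using potential_sum_ge[OF True] by (simp add: S_def)
  have ham: "hamiltonian G V n x = ereal (T + S)"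
    unfolding hamiltonian_finite[OF True] T_def S_def pair_sum_eq[OF True] by (simp add: algebra_simps)
  define \<kappa> B' where "\<kappa> = \<beta> / n" and "B' = B * (real n * (real n - 1) / 2)"
  define \<Psi> where "\<Psi> = n * \<beta> * (\<phi> + F) + \<kappa> * (T + B' + (S + b * n))"
  have \<kappa>: "0 \<le> \<kappa>" using \<beta> by (simp add: \<kappa>_def)
  have pos: "0 \<le> n * \<beta> * (\<phi> + F)" "0 \<le> T + B' + (S + b * n)"
    using F \<beta> T S by (simp_all add: B'_def)
  have "ennreal (n * \<beta> * (\<phi> + F)) +
        ennreal \<kappa> * ((\<Sum>j=1..n. \<Sum>i=1..<j. Q (x i, x j)) + (\<Sum>i=1..n. v (x i))) = ennreal \<Psi>"
    unfolding sum_Q_upper[OF True] sum_v[OF True] T_def[symmetric] S_def[symmetric] B'_def[symmetric]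
      ennreal_plus[OF T S, folded B'_def, symmetric] ennreal_mult[OF \<kappa> pos(2), symmetric] \<Psi>_def
    using pos \<kappa> by (intro ennreal_plus[symmetric]) auto
  moreover have "0 \<le> \<Psi>" using pos \<kappa> by (simp add: \<Psi>_def)
  moreover have "exp (n * \<beta> * F + \<kappa> * (B' + b * n)) * exp (- \<Psi>) = exp (- (\<kappa> * (T + S))) * exp (- (n * \<beta> * \<phi>))"
    unfolding exp_add[symmetric] \<Psi>_def by (simp add: algebra_simps)
  ultimately show ?thesis
    unfolding ham \<kappa>_def[symmetric] B'_def[symmetric]
    by (simp add: enn2ereal_ennreal ennreal_mult[symmetric])
next
  case False
  have top: "(\<Sum>j=1..n. \<Sum>i=1..<j. Q (x i, x j)) + (\<Sum>i=1..n. v (x i)) = top"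
  proof (rule ccontr)
    assume "\<not> ?thesis"
    then have "(\<Sum>j=1..n. \<Sum>i=1..<j. Q (x i, x j)) < top" "(\<Sum>i=1..n. v (x i)) < top"
      by (auto simp: less_top)
    then have Qv: "\<And>i j. j \<in> {1..n} \<Longrightarrow> i \<in> {1..<j} \<Longrightarrow> Q (x i, x j) < top" "\<And>i. i \<in> {1..n} \<Longrightarrow> v (x i) < top"
      by (auto simp: ennreal_sum_less_top)
    have "V (x i) \<noteq> \<infinity>" if "i \<in> {1..n}" for i
      using Qv(2)[OF that] by (auto simp: v_def e2ennreal_infty)
    moreover have "G (x i, x j) \<noteq> \<infinity>" if "j \<in> {1..n}" "i \<in> {1..<j}" for i j
      using Qv(1)[OF that] by (auto simp: Q_def pair_energy_def e2ennreal_infty)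
    ultimately show False using False by (auto simp: finite_configuration_def)
  qed
  have "ennreal (\<beta> / n) * top = top" using n \<beta> by (simp add: ennreal_mult_top)
  then show ?thesis unfolding top by simp
qed

end

section \<open>The partition function\<close>

context interacting_gas
begin

lemma measurable_coordinate [measurable]:
  "i \<in> {1..n} \<Longrightarrow> (\<lambda>x. x i) \<in> borel_measurable (\<Pi>\<^sub>M i\<in>{1..n}. l)"
  using measurable_component_singleton[of i "{1..n}" "\<lambda>_. l"]
  by (simp add: measurable_cong_sets[OF refl sets_l])

lemma measurable_hamiltonian:
  "hamiltonian G V n \<in> borel_measurable (\<Pi>\<^sub>M i\<in>{1..n}. l)"
proof -
  have [measurable]: "(\<lambda>x. \<Sum>i=1..<j. G (x i, x j)) \<in> borel_measurable (\<Pi>\<^sub>M i\<in>{1..n}. l)"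
    if "j \<in> {1..n}" for j
  proof (rule borel_measurable_ereal_sum)
    fix i assume "i \<in> {1..<j}"
    then have "i \<in> {1..n}" using that by auto
    note [measurable] = measurable_coordinate[OF this] measurable_coordinate[OF that]
    show "(\<lambda>x. G (x i, x j)) \<in> borel_measurable (\<Pi>\<^sub>M i\<in>{1..n}. l)" by measurable
  qed
  show ?thesis
    unfolding hamiltonian_def[abs_def]
    by (intro borel_measurable_ereal_add borel_measurable_ereal_times borel_measurable_ereal_sum
      borel_measurable_const measurable_compose[OF measurable_coordinate V_meas]) measurable
qed

lemma measurable_weight:
  "(\<lambda>x. exp_ereal (- ereal (\<beta> / real n) * hamiltonian G V n x)) \<in> borel_measurable (\<Pi>\<^sub>M i\<in>{1..n}. l)"
  using measurable_hamiltonian[of n] by measurable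

lemma partition_function_eq:
  assumes n: "n \<ge> 1" and f: "continuous_map weak_topology euclideanreal f"
  shows "partition_function f \<beta> n = (\<integral>\<^sup>+x. exp_ereal (- ereal (\<beta> / real n) * hamiltonian G V n x) *
    exp_ereal (ereal (- (real n * \<beta> * f (empirical_measure n x)))) \<partial>(\<Pi>\<^sub>M i\<in>{1..n}. l))"
proof -
  note [measurable] = measurable_compose_empirical_measure[OF f n sets_l] measurable_weight
  show ?thesis
    unfolding partition_function_def gibbs_measure_def
    by (rule nn_integral_density) measurable
qed

section \<open>The upper bound\<close>

lemma partition_function_le:
  assumes n: "n \<ge> 2" and \<beta>: "\<beta> > 0" and \<theta>: "\<theta> = 2 * (\<xi> / \<beta>) / (1 - \<epsilon>)" "\<theta> \<le> 1"
    and f: "continuous_map weak_topology euclideanreal f"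
    and Z: "(\<integral>\<^sup>+x. exp_ereal (- ereal \<xi> * V x) \<partial>l) \<le> ennreal (exp z)"
    and low: "\<And>x \<rho>. \<rho> \<ge> 0 \<Longrightarrow> off_diagonal_mean Q n x = ennreal \<rho> \<Longrightarrow>
      t + (B / 2 + b / n + \<theta> * (c + B) / 2) \<le> f (empirical_measure n x) + (1 - \<theta>) * \<rho> / 2"
  shows "partition_function f \<beta> n \<le> ennreal (exp (n * z - n * \<beta> * t))"
proof -
  have "partition_function f \<beta> n \<le>
      (\<integral>\<^sup>+x. ennreal (exp (- (real n * \<beta> * t))) * (\<Prod>i\<in>{1..n}. exp_ereal (- ereal \<xi> * V (x i))) \<partial>(\<Pi>\<^sub>M i\<in>{1..n}. l))"
  proof (subst partition_function_eq[OF _ f])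
    show "n \<ge> 1" using n by simp
  qed (intro nn_integral_mono boltzmann_weight_le[OF n \<beta> \<theta>] low)
  also have "\<dots> = ennreal (exp (- (real n * \<beta> * t))) *
      (\<integral>\<^sup>+x. (\<Prod>i\<in>{1..n}. exp_ereal (- ereal \<xi> * V (x i))) \<partial>(\<Pi>\<^sub>M i\<in>{1..n}. l))"
    by (rule nn_integral_cmult)
      (intro borel_measurable_prod_ennreal measurable_compose[OF _ borel_measurable_exp_ereal]
        borel_measurable_ereal_times borel_measurable_const measurable_compose[OF measurable_coordinate V_meas])
  also have "(\<integral>\<^sup>+x. (\<Prod>i\<in>{1..n}. exp_ereal (- ereal \<xi> * V (x i))) \<partial>(\<Pi>\<^sub>M i\<in>{1..n}. l)) =
      (\<Prod>i\<in>{1..n}. \<integral>\<^sup>+y. exp_ereal (- ereal \<xi> * V y) \<partial>l)"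
    by (rule nn_integral_PiM_prod) measurable
  also have "\<dots> \<le> (\<Prod>i\<in>{1..n}. ennreal (exp z))"
    by (intro prod_mono_ennreal Z)
  also have "\<dots> = ennreal (exp (n * z))"
    by (simp add: ennreal_power exp_of_nat_mult)
  finally have "partition_function f \<beta> n \<le> ennreal (exp (- (real n * \<beta> * t))) * ennreal (exp (n * z))"
    by (simp add: mult_left_mono)
  also have "\<dots> = ennreal (exp (n * z - n * \<beta> * t))"
    by (simp add: ennreal_mult[symmetric] exp_add[symmetric])
  finally show ?thesis .
qed

text \<open>If the bound failed for infinitely many \<open>n\<close>, the violating configurations
  would have bounded energies \<open>\<rho>\<close>. Compactness then produces a limit measure whose
  integral of \<open>Q\<close> is at most the limit of the \<open>\<rho>\<close>, against
  \<open>low\<close>; since only this inequality is known, \<open>low\<close> is assumed for every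
  \<open>\<rho>\<close> above that integral.\<close>

lemma eventually_energy_lower_bound:
  fixes \<theta> e :: "nat \<Rightarrow> real"
  assumes f: "continuous_map weak_topology euclideanreal f"
    and F: "\<And>\<nu>. \<nu> \<in> prob_measures \<Longrightarrow> \<bar>f \<nu>\<bar> \<le> F"
    and \<theta>: "\<theta> \<longlonglongrightarrow> 0" and e: "e \<longlonglongrightarrow> e0"
    and low: "\<And>\<mu> \<rho>. \<mu> \<in> prob_measures \<Longrightarrow> \<rho> \<ge> 0 \<Longrightarrow>
      (\<integral>\<^sup>+z. Q z \<partial>(\<mu> \<Otimes>\<^sub>M \<mu>)) \<le> ennreal \<rho> \<Longrightarrow> e0 < f \<mu> + \<rho> / 2"
  shows "\<forall>\<^sub>F n in sequentially. \<forall>x \<rho>. \<rho> \<ge> 0 \<longrightarrow> off_diagonal_mean Q n x = ennreal \<rho> \<longrightarrow>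
    e n \<le> f (empirical_measure n x) + (1 - \<theta> n) * \<rho> / 2"
proof (rule ccontr)
  let ?bad = "\<lambda>n x \<rho>. \<rho> \<ge> 0 \<and> off_diagonal_mean Q n x = ennreal \<rho> \<and>
    f (empirical_measure n x) + (1 - \<theta> n) * \<rho> / 2 < e n"
  assume contr: "\<not> ?thesis"
  have fr: "\<exists>\<^sub>F n in sequentially. \<exists>x \<rho>. ?bad n x \<rho>"
  proof (rule ccontr)
    assume "\<not> ?thesis"
    then have "\<forall>\<^sub>F n in sequentially. \<not> (\<exists>x \<rho>. ?bad n x \<rho>)"
      by (simp only: not_frequently)
    then have "\<forall>\<^sub>F n in sequentially. \<forall>x \<rho>. \<rho> \<ge> 0 \<longrightarrow> off_diagonal_mean Q n x = ennreal \<rho> \<longrightarrow>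
        e n \<le> f (empirical_measure n x) + (1 - \<theta> n) * \<rho> / 2"
      by (rule eventually_mono) (meson not_less)
    with contr show False by blast
  qed
  have "\<forall>\<^sub>F n in sequentially. n \<ge> 1 \<and> \<theta> n < 1/2 \<and> e n < e0 + 1"
    using eventually_ge_at_top[of "1::nat"] order_tendstoD(2)[OF \<theta>, of "1/2"] order_tendstoD(2)[OF e, of "e0 + 1"]
    by (auto intro: eventually_conj)
  from frequently_eventually_frequently[OF fr this]
  have "\<exists>\<^sub>\<infinity>n. (\<exists>x \<rho>. ?bad n x \<rho>) \<and> n \<ge> 1 \<and> \<theta> n < 1/2 \<and> e n < e0 + 1"
    by (simp add: cofinite_eq_sequentially)
  from infinite_enumerate[OF this[unfolded INFM_iff_infinite]]
  obtain n :: "nat \<Rightarrow> nat" where n: "strict_mono n"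
    and bad: "\<And>k. \<exists>x \<rho>. ?bad (n k) x \<rho>" and n1: "\<And>k. n k \<ge> 1"
    and \<theta>n: "\<And>k. \<theta> (n k) < 1/2" and en: "\<And>k. e (n k) < e0 + 1"
    by auto
  obtain x \<rho> where x\<rho>: "\<And>k. ?bad (n k) (x k) (\<rho> k)" using bad by metis
  \<comment> \<open>From \<open>\<theta> < 1/2\<close>, a quarter of \<open>\<rho>\<close> is at
    most \<open>(1 - \<theta>) * \<rho> / 2\<close>, which is below \<open>e - f\<close> and hence
    below \<open>e0 + 1 + F\<close>.\<close>
  have bound: "\<rho> k \<in> {0..4 * (e0 + 1 + F)}" for k
  proof -
    have "- F \<le> f (empirical_measure (n k) (x k))"
      using F[OF empirical_measure_in_prob_measures[OF n1]] by (simp add: abs_le_iff minus_le_iff)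
    moreover have "1/2 * \<rho> k \<le> (1 - \<theta> (n k)) * \<rho> k"
      using x\<rho>[of k] \<theta>n[of k] by (intro mult_right_mono) auto
    ultimately show ?thesis using x\<rho>[of k] en[of k] by auto
  qed
  obtain \<rho>0 s where \<rho>0: "\<rho>0 \<in> {0..4 * (e0 + 1 + F)}" and s: "strict_mono (s :: nat \<Rightarrow> nat)"
    and \<rho>_lim: "(\<rho> \<circ> s) \<longlonglongrightarrow> \<rho>0"
    using compact_Icc[THEN compact_imp_seq_compact] bound by (meson seq_compactE)
  have ns: "strict_mono (n \<circ> s)" using n s by (rule strict_mono_o)
  obtain r \<mu> where r: "strict_mono (r :: nat \<Rightarrow> nat)" and \<mu>: "\<mu> \<in> prob_measures"
    and weak: "limitin weak_topology (\<lambda>k. empirical_measure ((n \<circ> s) (r k)) ((x \<circ> s) (r k))) \<mu> sequentially"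
    and le: "(\<integral>\<^sup>+z. Q z \<partial>(\<mu> \<Otimes>\<^sub>M \<mu>)) \<le> ennreal \<rho>0"
  proof (rule empirical_measures_energy_compactness[of Q "n \<circ> s" "x \<circ> s" \<rho>0])
    show "open {z. t < Q z}" for t by (rule Q_lsc)
    show "\<exists>K. compact K \<and> (\<forall>y\<in>-K. \<forall>z\<in>-K. ennreal C \<le> Q (y, z))" for C by (rule Q_confining)
    show "filterlim (n \<circ> s) at_top sequentially" using ns by (rule filterlim_subseq)
    show "(n \<circ> s) k \<ge> 1" for k using n1 by simp
    show "(\<lambda>k. off_diagonal_mean Q ((n \<circ> s) k) ((x \<circ> s) k)) \<longlonglongrightarrow> ennreal \<rho>0"
      using tendsto_ennrealI[OF \<rho>_lim] x\<rho> by (simp add: o_def)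
  qed (use \<rho>0 in auto)
  define m where "m = n \<circ> s \<circ> r"
  have m: "strict_mono m" unfolding m_def using ns r by (rule strict_mono_o)
  have "limitin euclideanreal (f \<circ> (\<lambda>k. empirical_measure ((n \<circ> s) (r k)) ((x \<circ> s) (r k)))) (f \<mu>) sequentially"
    by (rule continuous_map_limit[OF f weak])
  then have f_lim: "(\<lambda>k. f (empirical_measure (m k) (x (s (r k))))) \<longlonglongrightarrow> f \<mu>"
    by (simp add: o_def m_def)
  have \<rho>_lim': "(\<lambda>k. \<rho> (s (r k))) \<longlonglongrightarrow> \<rho>0"
    using LIMSEQ_subseq_LIMSEQ[OF \<rho>_lim r] by (simp add: o_def)
  have \<theta>_lim: "(\<lambda>k. \<theta> (m k)) \<longlonglongrightarrow> 0" and e_lim: "(\<lambda>k. e (m k)) \<longlonglongrightarrow> e0"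
    using LIMSEQ_subseq_LIMSEQ[OF \<theta> m] LIMSEQ_subseq_LIMSEQ[OF e m] by (simp_all add: o_def)
  have "f \<mu> + (1 - 0) * \<rho>0 / 2 \<le> e0"
  proof (rule LIMSEQ_le)
    show "(\<lambda>k. f (empirical_measure (m k) (x (s (r k)))) + (1 - \<theta> (m k)) * \<rho> (s (r k)) / 2)
        \<longlonglongrightarrow> f \<mu> + (1 - 0) * \<rho>0 / 2"
      by (intro tendsto_intros f_lim \<theta>_lim \<rho>_lim') simp
    show "\<exists>N. \<forall>k\<ge>N. f (empirical_measure (m k) (x (s (r k)))) + (1 - \<theta> (m k)) * \<rho> (s (r k)) / 2 \<le> e (m k)"
      using x\<rho> by (auto simp: m_def intro: less_imp_le)
  qed (rule e_lim)
  with low[OF \<mu> _ le] \<rho>0 show False by simp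
qed

lemma eventually_log_partition_function_less:
  fixes \<beta> :: "nat \<Rightarrow> real"
  assumes \<beta>: "filterlim \<beta> at_top sequentially"
    and f: "continuous_map weak_topology euclideanreal f"
    and F: "\<And>\<nu>. \<nu> \<in> prob_measures \<Longrightarrow> \<bar>f \<nu>\<bar> \<le> F"
    and t: "ereal t < (INF \<mu>\<in>prob_measures. ereal (f \<mu>) + macroscopic_energy G V \<mu>)" and r: "- t < r"
  shows "\<forall>\<^sub>F n in sequentially.
    ereal (1 / (real n * \<beta> n)) * ln_ennreal (partition_function f (\<beta> n) n) < ereal r"
proof -
  define \<theta> where "\<theta> n = 2 * (\<xi> / \<beta> n) / (1 - \<epsilon>)" for n
  obtain z where z: "(\<integral>\<^sup>+x. exp_ereal (- ereal \<xi> * V x) \<partial>l) \<le> ennreal (exp z)"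
  proof (cases "\<integral>\<^sup>+x. exp_ereal (- ereal \<xi> * V x) \<partial>l")
    case (real y)
    \<comment> \<open>Any upper bound for the logarithm of the mass will do. Choosing
      \<open>z = y\<close> rather than \<open>ln y\<close> also covers mass
      \<open>0\<close>.\<close>
    have "y \<le> exp y" using exp_ge_add_one_self[of y] by linarith
    then show ?thesis using real by (intro that[of y]) (simp add: ennreal_leI)
  next
    case top
    then show ?thesis using \<xi>(2) by simp
  qed
  have \<theta>: "\<theta> \<longlonglongrightarrow> 0"
  proof -
    have "(\<lambda>n. 2 * (\<xi> / \<beta> n) / (1 - \<epsilon>)) \<longlonglongrightarrow> 2 * 0 / (1 - \<epsilon>)"
      by (intro tendsto_intros real_tendsto_divide_at_top[OF tendsto_const \<beta>]) (use \<epsilon> in auto)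
    then show ?thesis by (simp add: \<theta>_def[abs_def])
  qed
  have "(\<lambda>n. t + (B / 2 + b / real n + \<theta> n * (c + B) / 2)) \<longlonglongrightarrow> t + (B / 2 + 0 + 0 * (c + B) / 2)"
    by (intro tendsto_intros \<theta> real_tendsto_divide_at_top[OF tendsto_const filterlim_real_sequentially]) simp
  \<comment> \<open>Only \<open>B / 2\<close> survives among the corrections; it cancels against the
    \<open>- B\<close> in the formula for the energy.\<close>
  then have e: "(\<lambda>n. t + (B / 2 + b / real n + \<theta> n * (c + B) / 2)) \<longlonglongrightarrow> t + B / 2" by simp
  have "t + B / 2 < f \<mu> + \<rho> / 2"
    if \<mu>: "\<mu> \<in> prob_measures" and \<rho>: "\<rho> \<ge> 0" "(\<integral>\<^sup>+z. Q z \<partial>(\<mu> \<Otimes>\<^sub>M \<mu>)) \<le> ennreal \<rho>" for \<mu> \<rho>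
  proof -
    have "ereal t < ereal (f \<mu>) + macroscopic_energy G V \<mu>"
      using t INF_lower[OF \<mu>] by (rule less_le_trans)
    also have "\<dots> \<le> ereal (f \<mu>) + ereal (1/2) * (ereal \<rho> - ereal B)"
      unfolding macroscopic_energy_eq[OF \<mu>]
    proof (intro add_left_mono ereal_mult_left_mono ereal_minus_mono order_refl)
      show "enn2ereal (\<integral>\<^sup>+z. Q z \<partial>(\<mu> \<Otimes>\<^sub>M \<mu>)) \<le> ereal \<rho>"
        using \<rho> less_eq_ennreal.rep_eq[of _ "ennreal \<rho>"] by (simp add: enn2ereal_ennreal)
    qed simp
    finally show ?thesis by (simp add: field_simps)
  qed
  from eventually_energy_lower_bound[OF f F \<theta> e this]
  have low: "\<forall>\<^sub>F n in sequentially. \<forall>x \<rho>. \<rho> \<ge> 0 \<longrightarrow> off_diagonal_mean Q n x = ennreal \<rho> \<longrightarrow>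
    t + (B / 2 + b / real n + \<theta> n * (c + B) / 2) \<le> f (empirical_measure n x) + (1 - \<theta> n) * \<rho> / 2" by simp
  have z_lim: "(\<lambda>n. z / \<beta> n - t) \<longlonglongrightarrow> 0 - t"
    by (intro tendsto_intros real_tendsto_divide_at_top[OF tendsto_const \<beta>])
  have "\<forall>\<^sub>F n in sequentially. z / \<beta> n - t < r"
    using order_tendstoD(2)[OF z_lim] r by simp
  moreover have "\<forall>\<^sub>F n in sequentially. 0 < \<beta> n"
    using \<beta> by (simp add: filterlim_at_top_dense)
  moreover have "\<forall>\<^sub>F n in sequentially. \<theta> n < 1" by (rule order_tendstoD(2)[OF \<theta>]) simp
  ultimately show ?thesis
    using low eventually_ge_at_top[of 2]
  proof eventually_elim
    case (elim n)
    have "partition_function f (\<beta> n) n \<le> ennreal (exp (n * z - n * \<beta> n * t))"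
      by (rule partition_function_le[OF elim(5,2) \<theta>_def _ f z]) (use elim in auto)
    from ln_ennreal_mono[OF this]
    have "ln_ennreal (partition_function f (\<beta> n) n) \<le> ereal (n * z - n * \<beta> n * t)"
      by (simp add: ln_ennreal_ennreal)
    then have "ereal (1 / (real n * \<beta> n)) * ln_ennreal (partition_function f (\<beta> n) n) \<le>
        ereal (1 / (real n * \<beta> n)) * ereal (n * z - n * \<beta> n * t)"
      using elim by (intro ereal_mult_left_mono) auto
    also have "\<dots> = ereal (z / \<beta> n - t)"
      using elim by (simp add: field_simps)
    also have "\<dots> < ereal r" using elim by simp
    finally show ?case .
  qed
qed

section \<open>The lower bound\<close>

lemma nn_integral_empirical_energy:
  assumes \<mu>: "\<mu> \<in> prob_measures"
    and q: "(\<integral>\<^sup>+z. Q z \<partial>(\<mu> \<Otimes>\<^sub>M \<mu>)) = ennreal q" "0 \<le> q"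
    and w: "(\<integral>\<^sup>+x. v x \<partial>\<mu>) = ennreal w" "0 \<le> w"
  shows "(\<integral>\<^sup>+x. (\<Sum>j=1..n. \<Sum>i=1..<j. Q (x i, x j)) + (\<Sum>i=1..n. v (x i)) \<partial>(\<Pi>\<^sub>M i\<in>{1..n}. \<mu>)) =
    ennreal (real n * (real n - 1) / 2 * q + n * w)"
proof -
  note \<mu>' = prob_measuresD[OF \<mu>]
  let ?P = "\<Pi>\<^sub>M i\<in>{1..n}. \<mu>"
  have coord: "(\<lambda>x. x i) \<in> measurable ?P \<mu>" if "i \<in> {1..n}" for i
    using that by (rule measurable_component_singleton)
  have Q\<mu>: "Q \<in> borel_measurable (\<mu> \<Otimes>\<^sub>M \<mu>)" by (rule Q_meas_pair[OF \<mu>])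
  have v\<mu>: "v \<in> borel_measurable \<mu>" using v_meas by (simp add: measurable_cong_sets[OF \<mu>'(1) refl])
  have pair: "(\<lambda>x. (x i, x j)) \<in> measurable ?P (\<mu> \<Otimes>\<^sub>M \<mu>)" if "j \<in> {1..n}" "i \<in> {1..<j}" for i j
    using that by (intro measurable_Pair coord) auto
  have Qm: "(\<lambda>x. Q (x i, x j)) \<in> borel_measurable ?P" if "j \<in> {1..n}" "i \<in> {1..<j}" for i j
    by (rule measurable_compose[OF pair[OF that] Q\<mu>])
  have vm: "(\<lambda>x. v (x i)) \<in> borel_measurable ?P" if "i \<in> {1..n}" for i
    by (rule measurable_compose[OF coord[OF that] v\<mu>])
  have Qi: "(\<integral>\<^sup>+x. Q (x i, x j) \<partial>?P) = ennreal q" if "j \<in> {1..n}" "i \<in> {1..<j}" for i j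
  proof -
    have "distr ?P (\<mu> \<Otimes>\<^sub>M \<mu>) (\<lambda>x. (x i, x j)) = \<mu> \<Otimes>\<^sub>M \<mu>"
      using that by (intro distr_PiM_coordinate_pair \<mu>') auto
    then show ?thesis using nn_integral_distr[OF pair[OF that], of Q] Q\<mu> q by simp
  qed
  have vi: "(\<integral>\<^sup>+x. v (x i) \<partial>?P) = ennreal w" if "i \<in> {1..n}" for i
  proof -
    have "distr ?P \<mu> (\<lambda>x. x i) = \<mu>"
      using that by (intro distr_PiM_coordinate \<mu>') auto
    then show ?thesis using nn_integral_distr[OF coord[OF that], of v] v\<mu> w by simp
  qed
  have "(\<integral>\<^sup>+x. (\<Sum>j=1..n. \<Sum>i=1..<j. Q (x i, x j)) + (\<Sum>i=1..n. v (x i)) \<partial>?P) =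
      (\<integral>\<^sup>+x. (\<Sum>j=1..n. \<Sum>i=1..<j. Q (x i, x j)) \<partial>?P) + (\<integral>\<^sup>+x. (\<Sum>i=1..n. v (x i)) \<partial>?P)"
    by (intro nn_integral_add borel_measurable_sum Qm vm)
  also have "(\<integral>\<^sup>+x. (\<Sum>j=1..n. \<Sum>i=1..<j. Q (x i, x j)) \<partial>?P) =
      (\<Sum>j=1..n. \<integral>\<^sup>+x. (\<Sum>i=1..<j. Q (x i, x j)) \<partial>?P)"
    by (intro nn_integral_sum borel_measurable_sum Qm)
  also have "\<dots> = (\<Sum>j=1..n. \<Sum>i=1..<j. \<integral>\<^sup>+x. Q (x i, x j) \<partial>?P)"
    by (intro sum.cong refl nn_integral_sum Qm)
  also have "\<dots> = (\<Sum>j=1..n. \<Sum>i=1..<j. ennreal q)"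
    by (intro sum.cong refl Qi)
  also have "\<dots> = (\<Sum>j=1..n. ennreal (\<Sum>i=1..<j. q))"
    using q by (intro sum.cong refl sum_ennreal)
  also have "\<dots> = ennreal (\<Sum>j=1..n. \<Sum>i=1..<j. q)"
    using q by (intro sum_ennreal sum_nonneg)
  also have "(\<integral>\<^sup>+x. (\<Sum>i=1..n. v (x i)) \<partial>?P) = (\<Sum>i=1..n. \<integral>\<^sup>+x. v (x i) \<partial>?P)"
    by (intro nn_integral_sum vm)
  also have "\<dots> = (\<Sum>i=1..n. ennreal w)" by (intro sum.cong refl vi)
  also have "\<dots> = ennreal (n * w)" using w by (simp add: ennreal_of_nat_eq_real_of_nat ennreal_mult)
  also have "ennreal (\<Sum>j=1..n. \<Sum>i=1..<j. q) + ennreal (n * w) = ennreal ((\<Sum>j=1..n. \<Sum>i=1..<j. q) + n * w)"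
    using q w by (intro ennreal_plus[symmetric] sum_nonneg) auto
  finally show ?thesis unfolding sum_upper_const .
qed

text \<open>The density bound makes the product law of \<open>\<mu>\<close> at most
  \<open>exp (n * C)\<close> times the product of \<open>l\<close>, so an integral under independent
  samples can replace the one against \<open>l\<close>. Jensen's inequality is then applied to the
  shifted exponent \<open>\<Phi>\<close>.\<close>

lemma partition_function_ge:
  assumes n: "n \<ge> 1" and \<beta>: "\<beta> > 0"
    and \<mu>: "\<mu> \<in> prob_measures" "\<mu> = density l \<rho>" and \<rho>: "\<rho> \<in> borel_measurable l"
    and C: "\<And>x. \<rho> x \<le> ennreal (exp C)"
    and q: "(\<integral>\<^sup>+z. Q z \<partial>(\<mu> \<Otimes>\<^sub>M \<mu>)) = ennreal q" "0 \<le> q"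
    and w: "(\<integral>\<^sup>+x. v x \<partial>\<mu>) = ennreal w" "0 \<le> w"
    and f: "continuous_map weak_topology euclideanreal f"
    and F: "\<And>\<nu>. \<nu> \<in> prob_measures \<Longrightarrow> \<bar>f \<nu>\<bar> \<le> F"
  defines "E \<equiv> \<integral>x. f (empirical_measure n x) \<partial>(\<Pi>\<^sub>M i\<in>{1..n}. \<mu>)"
  shows "ennreal (exp (- (real n * C) - n * \<beta> * E - \<beta> / n * (real n * (real n - 1) / 2 * (q - B) + n * (w - b)))) \<le>
    partition_function f \<beta> n"
proof -
  define P where "P = (\<Pi>\<^sub>M i\<in>{1..n}. \<mu>)"
  have E_P: "E = (\<integral>x. f (empirical_measure n x) \<partial>P)" by (simp only: E_def P_def)
  interpret P: prob_space P unfolding P_def by (intro prob_space_PiM prob_measuresD \<mu>)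
  have P_eq: "P = density (\<Pi>\<^sub>M i\<in>{1..n}. l) (\<lambda>x. \<Prod>i\<in>{1..n}. \<rho> (x i))"
    unfolding P_def \<mu>(2)
  proof (rule PiM_density[OF _ \<rho>])
    show "sigma_finite_measure (density l \<rho>)"
      using prob_space_imp_sigma_finite[OF prob_measuresD(2)[OF \<mu>(1)]] \<mu>(2) by simp
  qed simp
  define \<Phi> where "\<Phi> x = ennreal (n * \<beta> * (f (empirical_measure n x) + F)) +
      ennreal (\<beta> / n) * ((\<Sum>j=1..n. \<Sum>i=1..<j. Q (x i, x j)) + (\<Sum>i=1..n. v (x i)))" for x
  \<comment> \<open>\<open>K\<close> collects the shifts hidden in \<open>\<Phi>\<close>, and
    \<open>a\<close> below is the mean of \<open>\<Phi>\<close>; in \<open>K - n * C - a\<close> the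
    shifts recombine to \<open>q - B\<close>, \<open>w - b\<close> and the unshifted mean
    \<open>E\<close>.\<close>
  define K where "K = n * \<beta> * F + \<beta> / n * (B * (real n * (real n - 1) / 2) + b * n)"
  have fF: "0 \<le> f (empirical_measure n x) + F" "\<bar>f (empirical_measure n x)\<bar> \<le> F" for x
    using F[OF empirical_measure_in_prob_measures[OF n], of x] by linarith+
  have fm: "(\<lambda>x. f (empirical_measure n x)) \<in> borel_measurable (\<Pi>\<^sub>M i\<in>{1..n}. l)"
    by (rule measurable_compose_empirical_measure[OF f n sets_l])
  have fmP: "(\<lambda>x. f (empirical_measure n x)) \<in> borel_measurable P"
    unfolding P_eq using fm by simp
  have coord: "(\<lambda>x. x i) \<in> borel_measurable P" if "i \<in> {1..n}" for i
    unfolding P_eq using measurable_coordinate[OF that] by simp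
  have QmP: "(\<lambda>x. (\<Sum>j=1..n. \<Sum>i=1..<j. Q (x i, x j)) + (\<Sum>i=1..n. v (x i))) \<in> borel_measurable P"
    by (intro borel_measurable_add borel_measurable_sum measurable_compose[OF _ Q_meas]
      measurable_compose[OF _ v_meas] measurable_Pair coord) auto
  have \<Phi>mP: "\<Phi> \<in> borel_measurable P"
    unfolding \<Phi>_def using fmP QmP by measurable
  have \<Phi>m: "\<Phi> \<in> borel_measurable (\<Pi>\<^sub>M i\<in>{1..n}. l)"
    using \<Phi>mP unfolding P_eq by simp
  have exp\<Phi>m: "(\<lambda>x. exp_ereal (- enn2ereal (\<Phi> x))) \<in> borel_measurable (\<Pi>\<^sub>M i\<in>{1..n}. l)"
    by (intro measurable_compose[OF _ borel_measurable_exp_ereal] borel_measurable_uminus_ereal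
      measurable_compose[OF \<Phi>m measurable_enn2ereal])
  have \<rho>l: "(\<lambda>x. \<rho> (x i)) \<in> borel_measurable (\<Pi>\<^sub>M i\<in>{1..n}. l)" if "i \<in> {1..n}" for i
    by (rule measurable_compose[OF _ \<rho>]) (rule measurable_component_singleton[OF that])
  define a where "a = n * \<beta> * (E + F) + \<beta> / n * (real n * (real n - 1) / 2 * q + n * w)"
  have int: "integrable P (\<lambda>x. f (empirical_measure n x))"
    by (rule P.integrable_const_bound[of _ F]) (use fF fmP in auto)
  have E_plus: "(\<integral>x. f (empirical_measure n x) + F \<partial>P) = E + F"
    using int by (simp add: E_P P.prob_space)
  have EF: "0 \<le> E + F"
  proof -
    have "0 \<le> (\<integral>x. f (empirical_measure n x) + F \<partial>P)" using fF by (intro Bochner_Integration.integral_nonneg) auto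
    then show ?thesis by (simp only: E_plus)
  qed
  have nn: "0 \<le> real n * (real n - 1) / 2 * q + n * w" using n q w by simp
  have \<beta>n: "0 \<le> \<beta> / n" using \<beta> by simp
  have p: "0 \<le> n * \<beta> * (E + F)" "0 \<le> \<beta> / n * (real n * (real n - 1) / 2 * q + n * w)"
    using EF \<beta> mult_nonneg_nonneg[OF \<beta>n nn] by simp_all
  have "(\<integral>\<^sup>+x. \<Phi> x \<partial>P) = (\<integral>\<^sup>+x. ennreal (n * \<beta> * (f (empirical_measure n x) + F)) \<partial>P) +
      (\<integral>\<^sup>+x. ennreal (\<beta> / n) * ((\<Sum>j=1..n. \<Sum>i=1..<j. Q (x i, x j)) + (\<Sum>i=1..n. v (x i))) \<partial>P)"
    unfolding \<Phi>_def
  proof (rule nn_integral_add)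
    show "(\<lambda>x. ennreal (n * \<beta> * (f (empirical_measure n x) + F))) \<in> borel_measurable P"
      using fmP by measurable
    show "(\<lambda>x. ennreal (\<beta> / n) * ((\<Sum>j=1..n. \<Sum>i=1..<j. Q (x i, x j)) + (\<Sum>i=1..n. v (x i)))) \<in> borel_measurable P"
      by (rule borel_measurable_times_ennreal[OF borel_measurable_const QmP])
  qed
  also have "(\<integral>\<^sup>+x. ennreal (n * \<beta> * (f (empirical_measure n x) + F)) \<partial>P) = ennreal (n * \<beta> * (E + F))"
  proof (subst nn_integral_eq_integral)
    show "integrable P (\<lambda>x. n * \<beta> * (f (empirical_measure n x) + F))" using int by simp
    show "AE x in P. 0 \<le> n * \<beta> * (f (empirical_measure n x) + F)" using fF \<beta> by simp
    have "(\<integral>x. n * \<beta> * (f (empirical_measure n x) + F) \<partial>P) = n * \<beta> * (E + F)"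
      by (simp only: integral_mult_right_zero E_plus)
    then show "ennreal (\<integral>x. n * \<beta> * (f (empirical_measure n x) + F) \<partial>P) = ennreal (n * \<beta> * (E + F))" by (simp only:)
  qed
  also have "(\<integral>\<^sup>+x. ennreal (\<beta> / n) * ((\<Sum>j=1..n. \<Sum>i=1..<j. Q (x i, x j)) + (\<Sum>i=1..n. v (x i))) \<partial>P) =
      ennreal (\<beta> / n) * ennreal (real n * (real n - 1) / 2 * q + n * w)"
    unfolding nn_integral_cmult[OF QmP] unfolding P_def by (simp only: nn_integral_empirical_energy[OF \<mu>(1) q w])
  also have "ennreal (n * \<beta> * (E + F)) + ennreal (\<beta> / n) * ennreal (real n * (real n - 1) / 2 * q + n * w) = ennreal a"
    by (simp only: a_def ennreal_plus[OF p] ennreal_mult[OF \<beta>n nn])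
  finally have \<Phi>_int: "(\<integral>\<^sup>+x. \<Phi> x \<partial>P) = ennreal a" .
  have a: "0 \<le> a" unfolding a_def by (rule add_nonneg_nonneg[OF p])
  have "ennreal (exp (- a)) \<le> (\<integral>\<^sup>+x. exp_ereal (- enn2ereal (\<Phi> x)) \<partial>P)"
    by (rule exp_neg_nn_integral_le[OF P.prob_space_axioms \<Phi>mP \<Phi>_int a])
  also have "\<dots> = (\<integral>\<^sup>+x. (\<Prod>i\<in>{1..n}. \<rho> (x i)) * exp_ereal (- enn2ereal (\<Phi> x)) \<partial>(\<Pi>\<^sub>M i\<in>{1..n}. l))"
    unfolding P_eq
    by (intro nn_integral_density borel_measurable_prod_ennreal exp\<Phi>m \<rho>l)
  also have "\<dots> \<le> (\<integral>\<^sup>+x. ennreal (exp (n * C)) * exp_ereal (- enn2ereal (\<Phi> x)) \<partial>(\<Pi>\<^sub>M i\<in>{1..n}. l))"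
  proof (intro nn_integral_mono mult_right_mono)
    fix x :: "nat \<Rightarrow> 'a"
    have "(\<Prod>i\<in>{1..n}. \<rho> (x i)) \<le> (\<Prod>i\<in>{1..n}. ennreal (exp C))"
      by (intro prod_mono_ennreal C)
    then show "(\<Prod>i\<in>{1..n}. \<rho> (x i)) \<le> ennreal (exp (n * C))"
      by (simp add: ennreal_power exp_of_nat_mult)
  qed simp
  also have "\<dots> = ennreal (exp (n * C)) * (\<integral>\<^sup>+x. exp_ereal (- enn2ereal (\<Phi> x)) \<partial>(\<Pi>\<^sub>M i\<in>{1..n}. l))"
    by (rule nn_integral_cmult[OF exp\<Phi>m])
  finally have "ennreal (exp (K - n * C)) * ennreal (exp (- a)) \<le> ennreal (exp (K - n * C)) *
      (ennreal (exp (n * C)) * (\<integral>\<^sup>+x. exp_ereal (- enn2ereal (\<Phi> x)) \<partial>(\<Pi>\<^sub>M i\<in>{1..n}. l)))"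
    by (rule mult_left_mono) simp
  also have "\<dots> = ennreal (exp K) * (\<integral>\<^sup>+x. exp_ereal (- enn2ereal (\<Phi> x)) \<partial>(\<Pi>\<^sub>M i\<in>{1..n}. l))"
    by (simp add: mult.assoc[symmetric] ennreal_mult[symmetric] exp_add[symmetric])
  also have "\<dots> = (\<integral>\<^sup>+x. ennreal (exp K) * exp_ereal (- enn2ereal (\<Phi> x)) \<partial>(\<Pi>\<^sub>M i\<in>{1..n}. l))"
    by (rule nn_integral_cmult[OF exp\<Phi>m, symmetric])
  also have "\<dots> \<le> partition_function f \<beta> n"
    unfolding partition_function_eq[OF n f] K_def \<Phi>_def
    by (intro nn_integral_mono boltzmann_weight_ge[OF n \<beta>] fF)
  finally have "ennreal (exp (K - n * C - a)) \<le> partition_function f \<beta> n"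
    by (simp add: ennreal_mult[symmetric] exp_add[symmetric])
  moreover have "K - n * C - a =
      - (real n * C) - n * \<beta> * E - \<beta> / n * (real n * (real n - 1) / 2 * (q - B) + n * (w - b))"
  proof -
    define \<kappa> where "\<kappa> = \<beta> / n"
    show ?thesis unfolding K_def a_def \<kappa>_def[symmetric] by (simp add: field_simps)
  qed
  ultimately show ?thesis by simp
qed

lemma eventually_log_partition_function_greater_bounded_density:
  fixes \<beta> :: "nat \<Rightarrow> real"
  assumes \<beta>: "filterlim \<beta> at_top sequentially"
    and \<mu>: "\<mu> \<in> prob_measures" "\<mu> = density l \<rho>" and \<rho>: "\<rho> \<in> borel_measurable l"
    and C: "\<And>x. \<rho> x \<le> ennreal (exp C)"
    and q: "(\<integral>\<^sup>+z. Q z \<partial>(\<mu> \<Otimes>\<^sub>M \<mu>)) = ennreal q" "0 \<le> q"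
    and f: "continuous_map weak_topology euclideanreal f"
    and F: "\<And>\<nu>. \<nu> \<in> prob_measures \<Longrightarrow> \<bar>f \<nu>\<bar> \<le> F"
    and r: "r < - (f \<mu> + (q - B) / 2)"
  shows "\<forall>\<^sub>F n in sequentially.
    ereal r < ereal (1 / (real n * \<beta> n)) * ln_ennreal (partition_function f (\<beta> n) n)"
proof -
  obtain w where w: "(\<integral>\<^sup>+x. v x \<partial>\<mu>) = ennreal w" "0 \<le> w"
    using nn_integral_v_finite[OF \<mu>(1) q(1)] by blast
  define E where "E n = (\<integral>x. f (empirical_measure n x) \<partial>(\<Pi>\<^sub>M i\<in>{1..n}. \<mu>))" for n
  define L where "L n = - (C / \<beta> n) - E n - (1 - 1 / real n) / 2 * (q - B) - (w - b) / real n" for n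
  have "E \<longlonglongrightarrow> f \<mu>"
    unfolding E_def by (rule expectation_empirical_measure_tendsto[OF \<mu>(1) f F])
  then have "L \<longlonglongrightarrow> - 0 - f \<mu> - (1 - 0) / 2 * (q - B) - 0"
    unfolding L_def
    by (intro tendsto_intros real_tendsto_divide_at_top[OF tendsto_const \<beta>]
      real_tendsto_divide_at_top[OF tendsto_const filterlim_real_sequentially]) simp_all
  then have "\<forall>\<^sub>F n in sequentially. r < L n"
    by (rule order_tendstoD(1)) (use r in simp)
  moreover have "\<forall>\<^sub>F n in sequentially. 0 < \<beta> n"
    using \<beta> by (simp add: filterlim_at_top_dense)
  ultimately show ?thesis
    using eventually_ge_at_top[of 1]
  proof eventually_elim
    case (elim n)
    define X where "X = - (real n * C) - n * \<beta> n * E n - \<beta> n / n * (real n * (real n - 1) / 2 * (q - B) + n * (w - b))"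
    have "ennreal (exp X) \<le> partition_function f (\<beta> n) n"
      unfolding X_def E_def by (rule partition_function_ge[OF elim(3,2) \<mu> \<rho> C q w f F])
    from ln_ennreal_mono[OF this] have "ereal X \<le> ln_ennreal (partition_function f (\<beta> n) n)"
      by (simp add: ln_ennreal_ennreal)
    then have "ereal (1 / (real n * \<beta> n)) * ereal X \<le>
        ereal (1 / (real n * \<beta> n)) * ln_ennreal (partition_function f (\<beta> n) n)"
      using elim by (intro ereal_mult_left_mono) auto
    moreover have "1 / (real n * \<beta> n) * X = L n"
      using elim by (simp add: X_def L_def field_simps)
    moreover have "ereal r < ereal (L n)" using elim(1) by simp
    ultimately show ?case by (simp only: times_ereal.simps)
  qed
qed

text \<open>Radon-Nikodym is used relative to the finite measure with density
  \<open>g = exp(-\<xi> V)\<close>. Its null sets can differ from those of \<open>l\<close> only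
  where \<open>V\<close> is infinite, and \<open>\<mu>\<close> gives that set no mass because its
  energy is finite.\<close>

lemma density_exists:
  assumes \<mu>: "\<mu> \<in> prob_measures" and ac: "absolutely_continuous l \<mu>"
    and q: "(\<integral>\<^sup>+z. Q z \<partial>(\<mu> \<Otimes>\<^sub>M \<mu>)) = ennreal q"
  obtains \<rho> where "\<rho> \<in> borel_measurable l" "\<mu> = density l \<rho>"
proof -
  note \<mu>' = prob_measuresD[OF \<mu>]
  define g where "g x = exp_ereal (- ereal \<xi> * V x)" for x
  have g [measurable]: "g \<in> borel_measurable l" unfolding g_def by measurable
  have g_zero: "V x = \<infinity>" if "g x = 0" for x
    using that \<xi>(1) V_range[of x] by (cases "V x") (auto simp: g_def)
  have v\<mu>: "v \<in> borel_measurable \<mu>"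
    using v_meas by (simp add: measurable_cong_sets[OF \<mu>'(1) refl])
  have "(\<integral>\<^sup>+x. v x \<partial>\<mu>) \<noteq> \<infinity>"
    by (rule nn_integral_v_finite[OF \<mu> q]) simp
  from nn_integral_PInf_AE[OF v\<mu> this]
  have AE_V: "AE x in \<mu>. V x \<noteq> \<infinity>"
    by eventually_elim (auto simp: v_def e2ennreal_infty)
  interpret \<nu>: finite_measure "density l g"
  proof
    have "emeasure (density l g) (space (density l g)) = (\<integral>\<^sup>+x. g x \<partial>l)"
      by (subst emeasure_density) (auto intro!: nn_integral_cong)
    then show "emeasure (density l g) (space (density l g)) \<noteq> \<infinity>"
      using \<xi>(2) by (simp add: g_def)
  qed
  have "absolutely_continuous (density l g) \<mu>"
    unfolding absolutely_continuous_def
  proof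
    fix A assume "A \<in> null_sets (density l g)"
    then have A: "A \<in> sets l" "AE x in l. x \<in> A \<longrightarrow> g x = 0"
      by (simp_all add: null_sets_density_iff)
    then have "AE x in l. \<not> (x \<in> A \<and> V x \<noteq> \<infinity>)"
      using g_zero by (auto elim: eventually_mono)
    then have "AE x in \<mu>. \<not> (x \<in> A \<and> V x \<noteq> \<infinity>)"
      by (rule absolutely_continuous_AE[OF _ ac, rotated]) (simp add: sets_l \<mu>'(1))
    with AE_V have "AE x in \<mu>. x \<notin> A" by eventually_elim blast
    then show "A \<in> null_sets \<mu>"
      using A(1) by (subst AE_iff_null_sets) (simp_all add: sets_l \<mu>'(1))
  qed
  then obtain h where h: "h \<in> borel_measurable (density l g)" "density (density l g) h = \<mu>"
    using \<nu>.Radon_Nikodym[of \<mu>] by (auto simp: sets_l \<mu>'(1))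
  have h': "h \<in> borel_measurable l" using h(1) by simp
  show thesis
  proof (rule that)
    show "(\<lambda>x. g x * h x) \<in> borel_measurable l" using h' by measurable
    show "\<mu> = density l (\<lambda>x. g x * h x)"
      using h(2) density_density_eq[OF g h'] by simp
  qed
qed

text \<open>Conditioning on the set where the density is at most \<open>m\<close> gives a bounded
  density and multiplies the integral of \<open>Q\<close> by at most \<open>1 / p m ^ 2\<close>,
  with \<open>p m\<close> tending to \<open>1\<close>. The lower bound asks only for an upper bound
  on the energy, so one large \<open>m\<close> suffices.\<close>

lemma eventually_log_partition_function_greater_ac:
  fixes \<beta> :: "nat \<Rightarrow> real"
  assumes \<beta>: "filterlim \<beta> at_top sequentially"
    and \<mu>: "\<mu> \<in> prob_measures" "absolutely_continuous l \<mu>"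
    and q: "(\<integral>\<^sup>+z. Q z \<partial>(\<mu> \<Otimes>\<^sub>M \<mu>)) = ennreal q" "0 \<le> q"
    and f: "continuous_map weak_topology euclideanreal f"
    and F: "\<And>\<nu>. \<nu> \<in> prob_measures \<Longrightarrow> \<bar>f \<nu>\<bar> \<le> F"
    and r: "r < - (f \<mu> + (q - B) / 2)"
  shows "\<forall>\<^sub>F n in sequentially.
    ereal r < ereal (1 / (real n * \<beta> n)) * ln_ennreal (partition_function f (\<beta> n) n)"
proof -
  note \<mu>' = prob_measuresD[OF \<mu>(1)]
  interpret prob_space \<mu> by (rule \<mu>')
  obtain \<rho> where \<rho>: "\<rho> \<in> borel_measurable l" and \<mu>\<rho>: "\<mu> = density l \<rho>"
    using density_exists[OF \<mu> q(1)] .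
  note \<rho> [measurable]
  define A where "A m = {x \<in> space l. \<rho> x \<le> of_nat m}" for m :: nat
  have A_l [measurable]: "A m \<in> sets l" for m unfolding A_def by measurable
  then have A: "A m \<in> sets \<mu>" for m by (simp add: sets_l \<mu>')
  have "AE x in \<mu>. \<rho> x \<noteq> \<infinity>"
  proof -
    have "(\<integral>\<^sup>+x. \<rho> x \<partial>l) = emeasure \<mu> (space \<mu>)"
      unfolding \<mu>\<rho> by (simp add: emeasure_density cong: nn_integral_cong)
    then have "(\<integral>\<^sup>+x. \<rho> x \<partial>l) \<noteq> \<infinity>" by (simp add: emeasure_space_1)
    from nn_integral_PInf_AE[OF \<rho> this] show ?thesis
      unfolding \<mu>\<rho> by (auto simp: AE_density elim: eventually_mono)
  qed
  then have AE_fin: "AE x in \<mu>. x \<in> {x. \<rho> x \<noteq> \<infinity>}" by simp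
  have ev: "\<forall>\<^sub>F m in sequentially. x \<in> A m" if x: "x \<in> {x. \<rho> x \<noteq> \<infinity>}" for x
  proof -
    obtain k :: nat where k: "\<rho> x < of_nat k"
      using ennreal_Ex_less_of_nat[of "\<rho> x"] x by (auto simp: less_top)
    have "x \<in> A m" if "k \<le> m" for m
    proof -
      have "space l = UNIV" using sets_eq_imp_space_eq[OF sets_l] by simp
      moreover have "\<rho> x \<le> of_nat m" using k that by (meson of_nat_mono order_trans less_imp_le)
      ultimately show ?thesis by (simp add: A_def)
    qed
    then show ?thesis by (auto simp: eventually_sequentially)
  qed
  define p where "p m = measure \<mu> (A m)" for m
  have p: "p \<longlonglongrightarrow> 1"
    unfolding p_def using limitin_uniform_measure(1)[OF \<mu>(1) A ev AE_fin] .
  have weak: "limitin weak_topology (\<lambda>m. uniform_measure \<mu> (A m)) \<mu> sequentially"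
    using limitin_uniform_measure(2)[OF \<mu>(1) A ev AE_fin] .
  have "(\<lambda>m. f (uniform_measure \<mu> (A m))) \<longlonglongrightarrow> f \<mu>"
    using continuous_map_limit[OF f weak] by (simp add: o_def)
  then have "(\<lambda>m. f (uniform_measure \<mu> (A m)) + (q / p m / p m - B) / 2) \<longlonglongrightarrow> f \<mu> + (q / 1 / 1 - B) / 2"
    by (intro tendsto_intros p) simp_all
  then have "\<forall>\<^sub>F m in sequentially. f (uniform_measure \<mu> (A m)) + (q / p m / p m - B) / 2 < - r"
    by (rule order_tendstoD(2)) (use r in simp)
  moreover have "\<forall>\<^sub>F m in sequentially. 0 < p m" by (rule order_tendstoD(1)[OF p]) simp
  ultimately have "\<forall>\<^sub>F m in sequentially. f (uniform_measure \<mu> (A m)) + (q / p m / p m - B) / 2 < - r \<and> 0 < p m"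
    by eventually_elim simp
  from eventually_happens'[OF sequentially_bot this]
  obtain m where m: "f (uniform_measure \<mu> (A m)) + (q / p m / p m - B) / 2 < - r" and pm: "0 < p m"
    by blast
  let ?u = "uniform_measure \<mu> (A m)"
  define \<sigma> where "\<sigma> x = \<rho> x * (indicator (A m) x / ennreal (p m))" for x
  have u: "?u \<in> prob_measures"
    using pm by (intro uniform_measure_in_prob_measures \<mu>) (simp add: p_def)
  have \<sigma>_meas: "\<sigma> \<in> borel_measurable l" unfolding \<sigma>_def by measurable
  have u_density: "?u = density l \<sigma>"
  proof -
    have "?u = density \<mu> (\<lambda>x. indicator (A m) x / ennreal (p m))"
      by (simp add: uniform_measure_def emeasure_eq_measure p_def)
    also have "\<dots> = density l \<sigma>"
      unfolding \<sigma>_def by (subst \<mu>\<rho>, rule density_density_eq) measurable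
    finally show ?thesis .
  qed
  \<comment> \<open>The bound \<open>m / p m\<close> is weakened through
    \<open>y \<le> exp y\<close> to the form \<open>exp C\<close> of the bounded case.\<close>
  have \<sigma>_le: "\<sigma> x \<le> ennreal (exp (m / p m))" for x
  proof (cases "x \<in> A m")
    case True
    then have "\<sigma> x \<le> of_nat m * (1 / ennreal (p m))"
      unfolding \<sigma>_def by (intro mult_mono) (auto simp: A_def)
    also have "\<dots> = ennreal (m / p m)"
      using pm divide_ennreal[of 1 "p m"] by (simp add: ennreal_of_nat_eq_real_of_nat ennreal_mult[symmetric])
    also have "\<dots> \<le> ennreal (exp (m / p m))"
      using exp_ge_add_one_self[of "m / p m"] by (intro ennreal_leI) linarith
    finally show ?thesis .
  qed (simp add: \<sigma>_def)
  have "(\<integral>\<^sup>+z. Q z \<partial>(?u \<Otimes>\<^sub>M ?u)) \<le> ennreal q / ennreal (p m) / ennreal (p m)"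
    using nn_integral_pair_uniform_measure_le[OF prob_space_axioms A _ Q_meas_pair[OF \<mu>(1)], of m] pm q
    by (simp add: p_def)
  also have "\<dots> = ennreal (q / p m / p m)"
    using q pm by (simp add: divide_ennreal)
  finally have le: "(\<integral>\<^sup>+z. Q z \<partial>(?u \<Otimes>\<^sub>M ?u)) \<le> ennreal (q / p m / p m)" .
  then obtain q' where q': "(\<integral>\<^sup>+z. Q z \<partial>(?u \<Otimes>\<^sub>M ?u)) = ennreal q'" "0 \<le> q'"
    by (cases "\<integral>\<^sup>+z. Q z \<partial>(?u \<Otimes>\<^sub>M ?u)") (auto simp: top_unique)
  then have "q' \<le> q / p m / p m" using le q pm by simp
  then have r': "r < - (f ?u + (q' - B) / 2)" using m by (simp add: field_simps)
  show ?thesis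
    by (rule eventually_log_partition_function_greater_bounded_density[OF \<beta> u u_density \<sigma>_meas \<sigma>_le q' f F r'])
qed

text \<open>Both bounds are eventual strict inequalities against real thresholds, so
  \<open>order_tendstoI\<close> also covers an infinite infimum, with limit
  \<open>-\<infinity>\<close>.\<close>

lemma log_partition_function_tendsto:
  fixes \<beta> :: "nat \<Rightarrow> real"
  assumes \<beta>: "filterlim \<beta> at_top sequentially"
    and f: "continuous_map weak_topology euclideanreal f"
    and F: "\<And>\<nu>. \<nu> \<in> prob_measures \<Longrightarrow> \<bar>f \<nu>\<bar> \<le> F"
    and approx: "\<And>\<mu>. \<mu> \<in> prob_measures \<Longrightarrow> macroscopic_energy G V \<mu> < \<infinity> \<Longrightarrow>
      \<exists>\<mu>s. (\<forall>n::nat. \<mu>s n \<in> prob_measures \<and> absolutely_continuous l (\<mu>s n)) \<and>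
        limitin weak_topology \<mu>s \<mu> sequentially \<and>
        (\<lambda>n. macroscopic_energy G V (\<mu>s n)) \<longlonglongrightarrow> macroscopic_energy G V \<mu>"
  shows "(\<lambda>n. ereal (1 / (real n * \<beta> n)) * ln_ennreal (partition_function f (\<beta> n) n))
    \<longlonglongrightarrow> - (INF \<mu>\<in>prob_measures. ereal (f \<mu>) + macroscopic_energy G V \<mu>)"
proof (rule order_tendstoI)
  let ?I = "INF \<mu>\<in>prob_measures. ereal (f \<mu>) + macroscopic_energy G V \<mu>"
  fix a assume "a < - ?I"
  then obtain r where r: "a < ereal r" "ereal r < - ?I" using ereal_dense2 by blast
  then have "?I < ereal (- r)" using ereal_less_uminus_reorder[of "ereal r" ?I] by simp
  then obtain \<mu> where \<mu>: "\<mu> \<in> prob_measures" "ereal (f \<mu>) + macroscopic_energy G V \<mu> < ereal (- r)"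
    by (auto simp: INF_less_iff)
  then have fin: "macroscopic_energy G V \<mu> < \<infinity>" by (cases "macroscopic_energy G V \<mu>") auto
  \<comment> \<open>Along this sequence the value of \<open>f\<close> plus the energy converges, so
    some member \<open>\<mu>s k\<close> still lies below \<open>- r\<close> and has finite energy;
    the bound for absolutely continuous measures is applied to that member alone.\<close>
  obtain \<mu>s where \<mu>s: "\<And>n :: nat. \<mu>s n \<in> prob_measures" "\<And>n. absolutely_continuous l (\<mu>s n)"
    and weak: "limitin weak_topology \<mu>s \<mu> sequentially"
    and energy: "(\<lambda>n. macroscopic_energy G V (\<mu>s n)) \<longlonglongrightarrow> macroscopic_energy G V \<mu>"
    using approx[OF \<mu>(1) fin] by blast
  obtain q where q: "macroscopic_energy G V \<mu> = ereal ((q - B) / 2)"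
    using macroscopic_energy_finiteE[OF \<mu>(1) fin] by blast
  have "(\<lambda>n. f (\<mu>s n)) \<longlonglongrightarrow> f \<mu>"
    using continuous_map_limit[OF f weak] by (simp add: o_def)
  then have "(\<lambda>n. ereal (f (\<mu>s n)) + macroscopic_energy G V (\<mu>s n)) \<longlonglongrightarrow> ereal (f \<mu>) + macroscopic_energy G V \<mu>"
    by (intro tendsto_add_ereal_general energy) (auto simp: q)
  from eventually_happens'[OF sequentially_bot order_tendstoD(2)[OF this \<mu>(2)]]
  obtain k where k: "ereal (f (\<mu>s k)) + macroscopic_energy G V (\<mu>s k) < ereal (- r)"
    by blast
  then have "macroscopic_energy G V (\<mu>s k) < \<infinity>" by (cases "macroscopic_energy G V (\<mu>s k)") auto
  then obtain q' where q': "(\<integral>\<^sup>+z. Q z \<partial>(\<mu>s k \<Otimes>\<^sub>M \<mu>s k)) = ennreal q'" "0 \<le> q'"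
      "macroscopic_energy G V (\<mu>s k) = ereal ((q' - B) / 2)"
    using macroscopic_energy_finiteE[OF \<mu>s(1)] by blast
  have "r < - (f (\<mu>s k) + (q' - B) / 2)" using k by (simp add: q'(3))
  from eventually_log_partition_function_greater_ac[OF \<beta> \<mu>s q'(1,2) f F this]
  show "\<forall>\<^sub>F n in sequentially. a < ereal (1 / (real n * \<beta> n)) * ln_ennreal (partition_function f (\<beta> n) n)"
    by (rule eventually_mono) (use r(1) in \<open>auto intro: less_trans\<close>)
next
  let ?I = "INF \<mu>\<in>prob_measures. ereal (f \<mu>) + macroscopic_energy G V \<mu>"
  fix a assume "- ?I < a"
  then obtain r where r: "- ?I < ereal r" "ereal r < a" using ereal_dense2 by blast
  then obtain s where s: "- ?I < ereal s" "ereal s < ereal r" using ereal_dense2 by blast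
  then have "ereal (- s) < ?I" using ereal_uminus_less_reorder[of ?I "ereal s"] by simp
  from eventually_log_partition_function_less[OF \<beta> f F this, of r] s(2)
  have "\<forall>\<^sub>F n in sequentially. ereal (1 / (real n * \<beta> n)) * ln_ennreal (partition_function f (\<beta> n) n) < ereal r"
    by simp
  then show "\<forall>\<^sub>F n in sequentially. ereal (1 / (real n * \<beta> n)) * ln_ennreal (partition_function f (\<beta> n) n) < a"
    by (rule eventually_mono) (use r(2) in \<open>auto intro: less_trans\<close>)
qed

end

theorem theorem4p11:
  fixes l :: "'a::polish_space measure"
    and V :: "'a \<Rightarrow> ereal"
    and G :: "'a \<times> 'a \<Rightarrow> ereal"
    and \<beta> :: "nat \<Rightarrow> real"
    and f :: "'a measure \<Rightarrow> real"
  assumes borel_l: "sets l = sets borel"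
    and V_range: "\<And>x. -\<infinity> < V x"
    and G_range: "\<And>x y. -\<infinity> < G (x, y)"
    and V_lsc: "lower_semicontinuous V"
    and G_lsc: "lower_semicontinuous G"
    and G_sym: "\<And>x y. G (x, y) = G (y, x)"
    and GVV_bdd: "bounded_from_below (\<lambda>(x, y). G (x, y) + V x + V y)"
    and beta: "filterlim \<beta> at_top sequentially"
    and h1: "\<exists>\<xi>>0. (\<integral>\<^sup>+ x. exp_ereal (- ereal \<xi> * V x) \<partial>l) < \<infinity>"
    and h2: "bounded_from_below V"
    and h3: "\<exists>\<epsilon>\<in>{0..<1}. bounded_from_below (\<lambda>(x, y). G (x, y) + ereal \<epsilon> * V x + ereal \<epsilon> * V y)"
    and h4: "\<forall>C::real. \<exists>K. compact K \<and> (\<forall>x\<in>-K. \<forall>y\<in>-K. ereal C \<le> G (x, y) + V x + V y)"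
    and h5: "\<forall>\<mu>\<in>prob_measures. macroscopic_energy G V \<mu> < \<infinity> \<longrightarrow>
      (\<exists>\<mu>s. (\<forall>n::nat. \<mu>s n \<in> prob_measures \<and> absolutely_continuous l (\<mu>s n)) \<and>
        limitin weak_topology \<mu>s \<mu> sequentially \<and>
        (\<lambda>n. macroscopic_energy G V (\<mu>s n)) \<longlonglongrightarrow> macroscopic_energy G V \<mu>)"
    and f_cont: "continuous_map weak_topology euclideanreal f"
    and f_bdd: "bounded (f ` prob_measures)"
  shows "(\<lambda>n. ereal (1 / (real n * \<beta> n)) *
            ln_ennreal (\<integral>\<^sup>+ x. exp_ereal (ereal (- (real n * \<beta> n * f (empirical_measure n x))))
              \<partial>gibbs_measure l G V (\<beta> n) n))
         \<longlonglongrightarrow> - (INF \<mu>\<in>prob_measures. ereal (f \<mu>) + macroscopic_energy G V \<mu>)"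
proof -
  have lower: "\<exists>c\<ge>0. \<forall>x. ereal (- c) \<le> g x" if g: "bounded_from_below g" for g :: "'b \<Rightarrow> ereal"
  proof -
    obtain c where c: "\<And>x. ereal c \<le> g x" using g by (auto simp: bounded_from_below_def)
    have "ereal (- max 0 (- c)) \<le> g x" for x
      using c[of x] by (rule order_trans[rotated]) simp
    then show ?thesis by (intro exI[of _ "max 0 (- c)"]) simp
  qed
  obtain \<xi> where \<xi>: "\<xi> > 0" "(\<integral>\<^sup>+ x. exp_ereal (- ereal \<xi> * V x) \<partial>l) < \<infinity>"
    using h1 by blast
  obtain \<epsilon> where \<epsilon>: "0 \<le> \<epsilon>" "\<epsilon> < 1"
      "bounded_from_below (\<lambda>(x, y). G (x, y) + ereal \<epsilon> * V x + ereal \<epsilon> * V y)"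
    using h3 by auto
  obtain B where B: "0 \<le> B" "\<And>x y. ereal (- B) \<le> G (x, y) + V x + V y"
    using lower[OF GVV_bdd] by auto
  obtain b where b: "0 \<le> b" "\<And>x. ereal (- b) \<le> V x"
    using lower[OF h2] by auto
  obtain c where c: "0 \<le> c" "\<And>x y. ereal (- c) \<le> G (x, y) + ereal \<epsilon> * V x + ereal \<epsilon> * V y"
    using lower[OF \<epsilon>(3)] by auto
  interpret interacting_gas l V G B b c \<epsilon> \<xi>
    by unfold_locales (fact borel_l G_range V_lsc G_lsc G_sym B b c \<epsilon> \<xi> spec[OF h4])+
  obtain F where F: "\<And>\<nu>. \<nu> \<in> prob_measures \<Longrightarrow> \<bar>f \<nu>\<bar> \<le> F"
    using f_bdd by (auto simp: bounded_iff)
  show ?thesis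
    using log_partition_function_tendsto[OF beta f_cont F] h5
    unfolding partition_function_def by blast
qed

end
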